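(* Let $k$ be an arbitrary field. (a) If $B$ is a $k$-bialgebra which is a sub-bialgebra of a Hopf algebra but is not itself a Hopf algebra, then the unit map $B\to H^*(B)$ is an injective, non-surjective epimorphism of bialgebras. Similarly, if $B$ is a bialgebra which is not a Hopf algebra but is a quotient (as a bialgebra) of a Hopf algebra, then the counit map $H_*(B)\to B$ is a surjective, non-injective monomorphism of bialgebras. (b) If $H$ is a Hopf algebra over $k$ which does not have bijective antipode but is contained (as a Hopf subalgebra) in a Hopf algebra with bijective antipode, then the unit map $H\to K^*(H)$ is an injective, non-surjective epimorphism of Hopf algebras. Similarly, if $H$ does not have bijective antipode but is a quotient of a Hopf algebra with bijective antipode, then the counit map $K_*(H)\to H$ is a non-injective, surjective monomorphism of Hopf algebras.
   Context: All bialgebras and Hopf algebras are over the fixed field $k$. $\mathrm{BiAlg}$ is the category of $k$-bialgebras; $\mathrm{HopfAlg}$ is its full subcategory of Hopf algebras; $\mathrm{SHopfAlg}$ is the full subcategory of $\mathrm{HopfAlg}$ consisting of Hopf algebras with bijective antipode. The inclusion $j:\mathrm{HopfAlg}\to\mathrm{BiAlg}$ has a left adjoint $H^*$ and a right adjoint $H_*$; the inclusion $i:\mathrm{SHopfAlg}\to\mathrm{HopfAlg}$ has a left adjoint $K^*$ and a right adjoint $K_*$. The maps $B\to H^*(B)$ and $H\to K^*(H)$ are the units, and $H_*(B)\to B$ and $K_*(H)\to H$ the counits, of the corresponding adjunctions. "Epimorphism (monomorphism) of bialgebras" means epimorphism (monomorphism) in the category $\mathrm{BiAlg}$, and "epimorphism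 (monomorphism) of Hopf algebras" means epimorphism (monomorphism) in $\mathrm{HopfAlg}$. *)

theory Defs
  imports "HOL-Algebra.Module" "HOL-Algebra.AbelCoset"
begin

section \<open>Linear algebra over a field\<close>

definition module_hom ::
  "('a, 'r) ring_scheme \<Rightarrow> ('a, 'm, 's) module_scheme \<Rightarrow> ('a, 'n, 't) module_scheme \<Rightarrow> ('m \<Rightarrow> 'n) set"
where
  "module_hom k M N = {f \<in> carrier M \<rightarrow> carrier N.
     (\<forall>x\<in>carrier M. \<forall>y\<in>carrier M. f (x \<oplus>\<^bsub>M\<^esub> y) = f x \<oplus>\<^bsub>N\<^esub> f y) \<and>
     (\<forall>c\<in>carrier k. \<forall>x\<in>carrier M. f (c \<odot>\<^bsub>M\<^esub> x) = c \<odot>\<^bsub>N\<^esub> f x)}"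

definition self_module :: "('a, 'r) ring_scheme \<Rightarrow> ('a, 'a) module" where
  "self_module k = \<lparr>carrier = carrier k, mult = mult k, one = one k,
     zero = zero k, add = add k, smult = mult k\<rparr>"

text \<open>The fields \<open>mult\<close> and \<open>one\<close> of the records for the free module and for the tensor product of
  modules carry no information: the locale \<open>module\<close> does not use them.\<close>

definition free_module :: "('a, 'r) ring_scheme \<Rightarrow> 'x set \<Rightarrow> ('a, 'x \<Rightarrow> 'a) module" where
  "free_module k X = \<lparr>
     carrier = {f. (\<forall>x\<in>X. f x \<in> carrier k) \<and> (\<forall>x. x \<notin> X \<longrightarrow> f x = \<zero>\<^bsub>k\<^esub>) \<and> finite {x. f x \<noteq> \<zero>\<^bsub>k\<^esub>}},
     mult = (\<lambda>f g x. \<zero>\<^bsub>k\<^esub>), one = (\<lambda>x. \<zero>\<^bsub>k\<^esub>),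
     zero = (\<lambda>x. \<zero>\<^bsub>k\<^esub>), add = (\<lambda>f g x. f x \<oplus>\<^bsub>k\<^esub> g x),
     smult = (\<lambda>c f x. c \<otimes>\<^bsub>k\<^esub> f x)\<rparr>"

definition free_gen :: "('a, 'r) ring_scheme \<Rightarrow> 'x \<Rightarrow> 'x \<Rightarrow> 'a" where
  "free_gen k x = (\<lambda>y. if y = x then \<one>\<^bsub>k\<^esub> else \<zero>\<^bsub>k\<^esub>)"


section \<open>Tensor products\<close>

text \<open>\<open>M \<otimes> N\<close> is the free module on \<open>M \<times> N\<close> modulo the submodule generated by the
  bilinearity relators; its elements are the cosets of that submodule.\<close>

definition tensor_relators ::
  "('a, 'r) ring_scheme \<Rightarrow> ('a, 'm, 's) module_scheme \<Rightarrow> ('a, 'n, 't) module_scheme \<Rightarrow> ('m \<times> 'n \<Rightarrow> 'a) set"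
where
  "tensor_relators k M N = (let F = free_module k (carrier M \<times> carrier N); e = free_gen k in
     {e (x \<oplus>\<^bsub>M\<^esub> x', y) \<ominus>\<^bsub>F\<^esub> (e (x, y) \<oplus>\<^bsub>F\<^esub> e (x', y)) | x x' y.
        x \<in> carrier M \<and> x' \<in> carrier M \<and> y \<in> carrier N} \<union>
     {e (x, y \<oplus>\<^bsub>N\<^esub> y') \<ominus>\<^bsub>F\<^esub> (e (x, y) \<oplus>\<^bsub>F\<^esub> e (x, y')) | x y y'.
        x \<in> carrier M \<and> y \<in> carrier N \<and> y' \<in> carrier N} \<union>
     {e (c \<odot>\<^bsub>M\<^esub> x, y) \<ominus>\<^bsub>F\<^esub> c \<odot>\<^bsub>F\<^esub> e (x, y) | c x y.
        c \<in> carrier k \<and> x \<in> carrier M \<and> y \<in> carrier N} \<union>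
     {e (x, c \<odot>\<^bsub>N\<^esub> y) \<ominus>\<^bsub>F\<^esub> c \<odot>\<^bsub>F\<^esub> e (x, y) | c x y.
        c \<in> carrier k \<and> x \<in> carrier M \<and> y \<in> carrier N})"

definition tensor_rel ::
  "('a, 'r) ring_scheme \<Rightarrow> ('a, 'm, 's) module_scheme \<Rightarrow> ('a, 'n, 't) module_scheme \<Rightarrow> ('m \<times> 'n \<Rightarrow> 'a) set"
where
  "tensor_rel k M N =
     \<Inter>{S. submodule S k (free_module k (carrier M \<times> carrier N)) \<and> tensor_relators k M N \<subseteq> S}"

text \<open>In \<open>smult\<close> the submodule of relations is added back because \<open>c \<odot> X\<close>, taken elementwise, is a
  proper subset of a coset when \<open>c\<close> is zero.\<close>

definition tensor ::
  "('a, 'r) ring_scheme \<Rightarrow> ('a, 'm, 's) module_scheme \<Rightarrow> ('a, 'n, 't) module_scheme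
     \<Rightarrow> ('a, ('m \<times> 'n \<Rightarrow> 'a) set) module"
where
  "tensor k M N = (let F = free_module k (carrier M \<times> carrier N); R = tensor_rel k M N in \<lparr>
     carrier = a_rcosets\<^bsub>F\<^esub> R,
     mult = (\<lambda>X Y. R), one = R,
     zero = R, add = (\<lambda>X Y. X <+>\<^bsub>F\<^esub> Y),
     smult = (\<lambda>c X. R <+>\<^bsub>F\<^esub> ((\<lambda>f. c \<odot>\<^bsub>F\<^esub> f) ` X))\<rparr>)"

definition pure_tensor ::
  "('a, 'r) ring_scheme \<Rightarrow> ('a, 'm, 's) module_scheme \<Rightarrow> ('a, 'n, 't) module_scheme
     \<Rightarrow> 'm \<Rightarrow> 'n \<Rightarrow> ('m \<times> 'n \<Rightarrow> 'a) set"
where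
  "pure_tensor k M N x y =
     tensor_rel k M N +>\<^bsub>free_module k (carrier M \<times> carrier N)\<^esub> free_gen k (x, y)"

text \<open>The linear map \<open>M \<otimes> N \<rightarrow> P\<close> induced by a bilinear map \<open>f\<close> from \<open>M \<times> N\<close> to \<open>P\<close>. For bilinear
  \<open>f\<close> the value does not depend on the chosen representative.\<close>

definition tensor_lift ::
  "('a, 'r) ring_scheme \<Rightarrow> ('a, 'p, 's) module_scheme \<Rightarrow> ('m \<Rightarrow> 'n \<Rightarrow> 'p) \<Rightarrow> ('m \<times> 'n \<Rightarrow> 'a) set \<Rightarrow> 'p"
where
  "tensor_lift k P f t = (let r = (SOME r. r \<in> t) in
     \<Oplus>\<^bsub>P\<^esub>z\<in>{z. r z \<noteq> \<zero>\<^bsub>k\<^esub>}. r z \<odot>\<^bsub>P\<^esub> f (fst z) (snd z))"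

definition tensor_map ::
  "('a, 'r) ring_scheme \<Rightarrow> ('a, 'p, 's) module_scheme \<Rightarrow> ('a, 'q, 't) module_scheme
     \<Rightarrow> ('m \<Rightarrow> 'p) \<Rightarrow> ('n \<Rightarrow> 'q) \<Rightarrow> ('m \<times> 'n \<Rightarrow> 'a) set \<Rightarrow> ('p \<times> 'q \<Rightarrow> 'a) set"
where
  "tensor_map k P Q f g = tensor_lift k (tensor k P Q) (\<lambda>x y. pure_tensor k P Q (f x) (g y))"

definition tensor_assoc ::
  "('a, 'r) ring_scheme \<Rightarrow> ('a, 'l, 's) module_scheme \<Rightarrow> ('a, 'm, 't) module_scheme
     \<Rightarrow> ('a, 'n, 'u) module_scheme
     \<Rightarrow> (('l \<times> 'm \<Rightarrow> 'a) set \<times> 'n \<Rightarrow> 'a) set \<Rightarrow> ('l \<times> ('m \<times> 'n \<Rightarrow> 'a) set \<Rightarrow> 'a) set"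
where
  "tensor_assoc k L M N =
     (let T = tensor k L (tensor k M N) in
      tensor_lift k T (\<lambda>s z. tensor_lift k T
        (\<lambda>x y. pure_tensor k L (tensor k M N) x (pure_tensor k M N y z)) s))"


section \<open>Bialgebras and Hopf algebras\<close>

locale k_algebra = module k A + ring A for k (structure) and A (structure) +
  assumes smult_mult_left:
      "\<lbrakk>c \<in> carrier k; x \<in> carrier A; y \<in> carrier A\<rbrakk> \<Longrightarrow>
        (c \<odot>\<^bsub>A\<^esub> x) \<otimes>\<^bsub>A\<^esub> y = c \<odot>\<^bsub>A\<^esub> (x \<otimes>\<^bsub>A\<^esub> y)"
    and smult_mult_right:
      "\<lbrakk>c \<in> carrier k; x \<in> carrier A; y \<in> carrier A\<rbrakk> \<Longrightarrow>
        x \<otimes>\<^bsub>A\<^esub> (c \<odot>\<^bsub>A\<^esub> y) = c \<odot>\<^bsub>A\<^esub> (x \<otimes>\<^bsub>A\<^esub> y)"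

text \<open>The multiplication on \<open>A \<otimes> B\<close> is \<open>(a \<otimes> b) (a' \<otimes> b') = a a' \<otimes> b b'\<close>, extended bilinearly.\<close>

definition tensor_algebra ::
  "('a, 'r) ring_scheme \<Rightarrow> ('a, 'm, 's) module_scheme \<Rightarrow> ('a, 'n, 't) module_scheme
     \<Rightarrow> ('a, ('m \<times> 'n \<Rightarrow> 'a) set) module"
where
  "tensor_algebra k A B = (tensor k A B)\<lparr>
     mult := (\<lambda>s t. tensor_lift k (tensor k A B) (\<lambda>a b.
                      tensor_lift k (tensor k A B) (\<lambda>a' b'.
                        pure_tensor k A B (a \<otimes>\<^bsub>A\<^esub> a') (b \<otimes>\<^bsub>B\<^esub> b')) t) s),
     one := pure_tensor k A B \<one>\<^bsub>A\<^esub> \<one>\<^bsub>B\<^esub>\<rparr>"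

record ('a, 'b) bialg = "('a, 'b) module" +
  comult :: "'b \<Rightarrow> ('b \<times> 'b \<Rightarrow> 'a) set"
  counit :: "'b \<Rightarrow> 'a"

text \<open>The counit axiom uses the identifications of \<open>k \<otimes> C\<close> and \<open>C \<otimes> k\<close> with \<open>C\<close>.\<close>

definition coalgebra :: "('a, 'r) ring_scheme \<Rightarrow> ('a, 'b) bialg \<Rightarrow> bool" where
  "coalgebra k C \<longleftrightarrow>
     module k C \<and>
     comult C \<in> module_hom k C (tensor k C C) \<and>
     counit C \<in> module_hom k C (self_module k) \<and>
     (\<forall>x\<in>carrier C.
        tensor_assoc k C C C (tensor_map k (tensor k C C) C (comult C) id (comult C x))
          = tensor_map k C (tensor k C C) id (comult C) (comult C x)) \<and>
     (\<forall>x\<in>carrier C.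
        tensor_lift k C (\<lambda>a b. counit C a \<odot>\<^bsub>C\<^esub> b) (comult C x) = x \<and>
        tensor_lift k C (\<lambda>a b. counit C b \<odot>\<^bsub>C\<^esub> a) (comult C x) = x)"

definition bialgebra :: "('a, 'r) ring_scheme \<Rightarrow> ('a, 'b) bialg \<Rightarrow> bool" where
  "bialgebra k B \<longleftrightarrow>
     k_algebra k B \<and> coalgebra k B \<and>
     comult B \<in> ring_hom B (tensor_algebra k B B) \<and>
     counit B \<in> ring_hom B k"

definition bialg_hom ::
  "('a, 'r) ring_scheme \<Rightarrow> ('a, 'b) bialg \<Rightarrow> ('a, 'c) bialg \<Rightarrow> ('b \<Rightarrow> 'c) set"
where
  "bialg_hom k A B = {f \<in> ring_hom A B \<inter> module_hom k A B.
     (\<forall>x\<in>carrier A. comult B (f x) = tensor_map k B B f f (comult A x)) \<and>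
     (\<forall>x\<in>carrier A. counit B (f x) = counit A x)}"

definition antipode :: "('a, 'r) ring_scheme \<Rightarrow> ('a, 'b) bialg \<Rightarrow> ('b \<Rightarrow> 'b) \<Rightarrow> bool" where
  "antipode k B S \<longleftrightarrow>
     S \<in> module_hom k B B \<and>
     (\<forall>x\<in>carrier B.
        tensor_lift k B (\<lambda>a b. S a \<otimes>\<^bsub>B\<^esub> b) (comult B x) = counit B x \<odot>\<^bsub>B\<^esub> \<one>\<^bsub>B\<^esub> \<and>
        tensor_lift k B (\<lambda>a b. a \<otimes>\<^bsub>B\<^esub> S b) (comult B x) = counit B x \<odot>\<^bsub>B\<^esub> \<one>\<^bsub>B\<^esub>)"

definition hopf_algebra :: "('a, 'r) ring_scheme \<Rightarrow> ('a, 'b) bialg \<Rightarrow> bool" where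
  "hopf_algebra k H \<longleftrightarrow> bialgebra k H \<and> (\<exists>S. antipode k H S)"

definition shopf_algebra :: "('a, 'r) ring_scheme \<Rightarrow> ('a, 'b) bialg \<Rightarrow> bool" where
  "shopf_algebra k H \<longleftrightarrow>
     bialgebra k H \<and> (\<exists>S. antipode k H S \<and> bij_betw S (carrier H) (carrier H))"


section \<open>Categories of bialgebras\<close>

text \<open>All categories considered are full subcategories of the category of bialgebras and are given
  by the predicate \<open>P\<close> on their objects. In particular, morphisms of Hopf algebras are morphisms of
  bialgebras, which automatically commute with antipodes. Morphisms are functions that matter
  only on the carrier, so equality of morphisms is equality on the carrier.\<close>

definition epi_in ::
  "(('a, 'c) bialg \<Rightarrow> bool) \<Rightarrow> ('a, 'r) ring_scheme \<Rightarrow> ('a, 'b) bialg \<Rightarrow> ('a, 'd) bialg \<Rightarrow> ('b \<Rightarrow> 'd) \<Rightarrow> bool"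
where
  "epi_in P k A B f \<longleftrightarrow>
     f \<in> bialg_hom k A B \<and>
     (\<forall>C g h. P C \<and> g \<in> bialg_hom k B C \<and> h \<in> bialg_hom k B C \<and>
        (\<forall>x\<in>carrier A. g (f x) = h (f x)) \<longrightarrow> (\<forall>y\<in>carrier B. g y = h y))"

definition mono_in ::
  "(('a, 'c) bialg \<Rightarrow> bool) \<Rightarrow> ('a, 'r) ring_scheme \<Rightarrow> ('a, 'b) bialg \<Rightarrow> ('a, 'd) bialg \<Rightarrow> ('b \<Rightarrow> 'd) \<Rightarrow> bool"
where
  "mono_in P k A B f \<longleftrightarrow>
     f \<in> bialg_hom k A B \<and>
     (\<forall>C g h. P C \<and> g \<in> bialg_hom k C A \<and> h \<in> bialg_hom k C A \<and>
        (\<forall>x\<in>carrier C. f (g x) = f (h x)) \<longrightarrow> (\<forall>x\<in>carrier C. g x = h x))"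

text \<open>The unit at \<open>B\<close> of a left adjoint of the inclusion of the full subcategory \<open>P\<close>: the object \<open>H\<close> is
  the value of the left adjoint at \<open>B\<close>, and \<open>\<eta>\<close> is universal among the morphisms from \<open>B\<close> to
  objects of \<open>P\<close>. Dually for the counit of a right adjoint. The type \<open>'u\<close> is the universe: universality
  is tested on the objects whose carrier is a set of elements of \<open>'u\<close>.\<close>

definition left_adjoint_unit ::
  "(('a, 'u) bialg \<Rightarrow> bool) \<Rightarrow> ('a, 'r) ring_scheme \<Rightarrow> ('a, 'u) bialg \<Rightarrow> ('a, 'u) bialg \<Rightarrow> ('u \<Rightarrow> 'u) \<Rightarrow> bool"
where
  "left_adjoint_unit P k B H \<eta> \<longleftrightarrow>
     P H \<and> \<eta> \<in> bialg_hom k B H \<and>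
     (\<forall>K f. P K \<and> f \<in> bialg_hom k B K \<longrightarrow>
        (\<exists>\<phi>\<in>bialg_hom k H K. (\<forall>x\<in>carrier B. \<phi> (\<eta> x) = f x) \<and>
           (\<forall>\<psi>\<in>bialg_hom k H K. (\<forall>x\<in>carrier B. \<psi> (\<eta> x) = f x) \<longrightarrow>
              (\<forall>y\<in>carrier H. \<psi> y = \<phi> y))))"

definition right_adjoint_counit ::
  "(('a, 'u) bialg \<Rightarrow> bool) \<Rightarrow> ('a, 'r) ring_scheme \<Rightarrow> ('a, 'u) bialg \<Rightarrow> ('a, 'u) bialg \<Rightarrow> ('u \<Rightarrow> 'u) \<Rightarrow> bool"
where
  "right_adjoint_counit P k H B \<epsilon> \<longleftrightarrow>
     P H \<and> \<epsilon> \<in> bialg_hom k H B \<and>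
     (\<forall>K f. P K \<and> f \<in> bialg_hom k K B \<longrightarrow>
        (\<exists>\<phi>\<in>bialg_hom k K H. (\<forall>x\<in>carrier K. \<epsilon> (\<phi> x) = f x) \<and>
           (\<forall>\<psi>\<in>bialg_hom k K H. (\<forall>x\<in>carrier K. \<epsilon> (\<psi> x) = f x) \<longrightarrow>
              (\<forall>x\<in>carrier K. \<psi> x = \<phi> x))))"

text \<open>Up to isomorphism: \<open>B\<close> is a sub-bialgebra of \<open>L\<close> if there is an injective morphism
  of bialgebras \<open>B \<rightarrow> L\<close>, and a quotient of \<open>L\<close> if there is a surjective one \<open>L \<rightarrow> B\<close>.\<close>

definition sub_bialgebra_of ::
  "('a, 'r) ring_scheme \<Rightarrow> ('a, 'b) bialg \<Rightarrow> ('a, 'c) bialg \<Rightarrow> bool" where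
  "sub_bialgebra_of k B L \<longleftrightarrow> (\<exists>f\<in>bialg_hom k B L. inj_on f (carrier B))"

definition quotient_bialgebra_of ::
  "('a, 'r) ring_scheme \<Rightarrow> ('a, 'b) bialg \<Rightarrow> ('a, 'c) bialg \<Rightarrow> bool" where
  "quotient_bialgebra_of k B L \<longleftrightarrow> (\<exists>f\<in>bialg_hom k L B. f ` carrier L = carrier B)"

end

theory Submission
  imports Defs
begin

text \<open>
  Write \<open>P\<close> for the subcategory (Hopf algebras, or Hopf algebras with bijective antipode).

  A unit \<open>\<eta>: B \<rightarrow> H\<close> is injective because an embedding of \<open>B\<close> into an object of \<open>P\<close> factors
  through it, and if it were also surjective, the structure of \<open>H\<close> could be transported to \<open>B\<close>. Dually
  for counits. The point is that units are epimorphisms and counits monomorphisms, tested against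
  \<^emph>\<open>all\<close> bialgebras \<open>C\<close>.

  Let \<open>g, h: H \<rightarrow> C\<close> satisfy \<open>g \<circ> \<eta> = h \<circ> \<eta>\<close>. The largest subcoalgebra \<open>M\<close> of \<open>H\<close> on which \<open>g\<close> and
  \<open>h\<close> agree contains the image of \<open>\<eta>\<close> and is closed under products. If \<open>S\<close> is the antipode of \<open>H\<close>,
  then \<open>g \<circ> S\<close> and \<open>h \<circ> S\<close>, restricted to \<open>M\<close>, are convolution inverses of the same map
  \<open>M \<rightarrow> C\<close>, hence equal (\<open>antipode_sandwich\<close>). As \<open>S\<close> reverses coproducts (\<open>antipode_comult\<close>),
  \<open>S(M)\<close> is again closed under coproducts, and \<open>g\<close> and \<open>h\<close> agree on it, so
  \<open>S(M) \<subseteq> M\<close>. Thus \<open>M\<close> is an object of \<open>P\<close> through which \<open>\<eta>\<close> factors. Universality gives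
  \<open>H \<rightarrow> M \<rightarrow> H\<close> restricting to \<open>\<eta>\<close>; this is the identity, so \<open>M = H\<close> and \<open>g = h\<close>
  (\<open>left_adjoint_unit_epi\<close>).

  Dually, let \<open>g, h: C \<rightarrow> H\<close> satisfy \<open>\<epsilon> \<circ> g = \<epsilon> \<circ> h\<close> for a counit \<open>\<epsilon>: H \<rightarrow> B\<close>. The
  ideal \<open>I\<close> generated by all \<open>g(c) - h(c)\<close> lies in the kernel of \<open>\<epsilon>\<close> and is a biideal. With
  \<open>p: H \<rightarrow> H/I\<close>, the maps \<open>p \<circ> S \<circ> g\<close> and \<open>p \<circ> S \<circ> h\<close> are convolution inverses of
  \<open>p \<circ> g = p \<circ> h\<close>, hence equal, and since \<open>S\<close> reverses products (\<open>antipode_mult\<close>),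
  \<open>S(I) \<subseteq> I\<close>. So \<open>H/I\<close> is an object of \<open>P\<close> over \<open>B\<close>, and \<open>H \<rightarrow> H/I \<rightarrow> H\<close> is the
  identity, whence \<open>I = 0\<close> and \<open>g = h\<close> (\<open>right_adjoint_counit_mono\<close>).

  When \<open>S\<close> is bijective, \<open>M\<close> and \<open>I\<close> are also stable under the inverse of \<open>S\<close>: by
  \<open>inverse_antipode\<close> it is an antipode for the opposite multiplication, to which the same arguments apply.

  Both \<open>M\<close> and \<open>H/I\<close> live in the type of \<open>H\<close>, the universe over which \<open>\<eta>\<close> and \<open>\<epsilon>\<close> are
  universal, whatever the type of \<open>C\<close>: the quotient is realised on a linear complement of \<open>I\<close>. Linear
  complements (\<open>ex_linear_retraction\<close>) also provide the injectivity of \<open>M \<otimes> M \<rightarrow> H \<otimes> H\<close>.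
\<close>

section \<open>Linear and bilinear maps\<close>

lemma module_homI:
  assumes "\<And>x. x \<in> carrier M \<Longrightarrow> f x \<in> carrier N"
    and "\<And>x y. x \<in> carrier M \<Longrightarrow> y \<in> carrier M \<Longrightarrow> f (x \<oplus>\<^bsub>M\<^esub> y) = f x \<oplus>\<^bsub>N\<^esub> f y"
    and "\<And>c x. c \<in> carrier k \<Longrightarrow> x \<in> carrier M \<Longrightarrow> f (c \<odot>\<^bsub>M\<^esub> x) = c \<odot>\<^bsub>N\<^esub> f x"
  shows "f \<in> module_hom k M N"
  using assms by (auto simp: module_hom_def)

lemma module_hom_closed: "f \<in> module_hom k M N \<Longrightarrow> x \<in> carrier M \<Longrightarrow> f x \<in> carrier N"
  and module_hom_add: "f \<in> module_hom k M N \<Longrightarrow> x \<in> carrier M \<Longrightarrow> y \<in> carrier M \<Longrightarrow>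
    f (x \<oplus>\<^bsub>M\<^esub> y) = f x \<oplus>\<^bsub>N\<^esub> f y"
  and module_hom_smult: "f \<in> module_hom k M N \<Longrightarrow> c \<in> carrier k \<Longrightarrow> x \<in> carrier M \<Longrightarrow>
    f (c \<odot>\<^bsub>M\<^esub> x) = c \<odot>\<^bsub>N\<^esub> f x"
  by (auto simp: module_hom_def)

lemma module_hom_comp:
  "f \<in> module_hom k M N \<Longrightarrow> g \<in> module_hom k N P \<Longrightarrow> (\<lambda>x. g (f x)) \<in> module_hom k M P"
  by (auto simp: module_hom_def Pi_def)

lemma module_hom_id: "(\<lambda>x. x) \<in> module_hom k M M"
  by (auto simp: module_hom_def)

lemma module_hom_cong:
  assumes "f \<in> module_hom k M N" "module k M" "\<And>x. x \<in> carrier M \<Longrightarrow> f x = g x"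
  shows "g \<in> module_hom k M N"
proof -
  interpret module k M by fact
  show ?thesis using assms(1) assms(3)[symmetric] by (auto simp: module_hom_def Pi_def)
qed

lemma module_hom_zero:
  assumes "f \<in> module_hom k M N" "module k M" "module k N"
  shows "f \<zero>\<^bsub>M\<^esub> = \<zero>\<^bsub>N\<^esub>"
proof -
  interpret M: module k M by fact
  interpret N: module k N by fact
  have "f (\<zero>\<^bsub>k\<^esub> \<odot>\<^bsub>M\<^esub> \<zero>\<^bsub>M\<^esub>) = \<zero>\<^bsub>k\<^esub> \<odot>\<^bsub>N\<^esub> f \<zero>\<^bsub>M\<^esub>"
    by (rule module_hom_smult[OF assms(1)]) auto
  then show ?thesis using module_hom_closed[OF assms(1), of "\<zero>\<^bsub>M\<^esub>"] by simp
qed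

lemma module_minus_eq:
  assumes "module k M" "x \<in> carrier M"
  shows "\<ominus>\<^bsub>M\<^esub> x = (\<ominus>\<^bsub>k\<^esub> \<one>\<^bsub>k\<^esub>) \<odot>\<^bsub>M\<^esub> x"
proof -
  interpret M: module k M by fact
  show ?thesis using assms(2) by (simp add: M.smult_l_minus)
qed

lemma module_hom_minus:
  assumes "f \<in> module_hom k M N" "module k M" "module k N" "x \<in> carrier M" "y \<in> carrier M"
  shows "f (x \<ominus>\<^bsub>M\<^esub> y) = f x \<ominus>\<^bsub>N\<^esub> f y"
proof -
  interpret M: module k M by fact
  interpret N: module k N by fact
  show ?thesis using assms
    by (simp add: a_minus_def module_minus_eq[of k] module_hom_add module_hom_smult
        module_hom_closed)
qed

lemma module_eq_if_minus_zero:
  assumes "module k M" "x \<in> carrier M" "y \<in> carrier M" "x \<ominus>\<^bsub>M\<^esub> y = \<zero>\<^bsub>M\<^esub>"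
  shows "x = y"
proof -
  interpret M: module k M by fact
  have "x = (x \<ominus>\<^bsub>M\<^esub> y) \<oplus>\<^bsub>M\<^esub> y" using assms(2,3) by (simp add: a_minus_def M.add.m_assoc M.l_neg)
  then show ?thesis using assms by simp
qed

lemma module_minus_self: "module k M \<Longrightarrow> x \<in> carrier M \<Longrightarrow> x \<ominus>\<^bsub>M\<^esub> x = \<zero>\<^bsub>M\<^esub>"
  by (simp add: a_minus_def abelian_group.r_neg module_def)

lemma module_minus_zero:
  assumes "module k M" "x \<in> carrier M"
  shows "x \<ominus>\<^bsub>M\<^esub> \<zero>\<^bsub>M\<^esub> = x"
proof -
  interpret M: module k M by fact
  show ?thesis using assms(2) by (simp add: a_minus_def module_minus_eq[OF assms(1) M.M.zero_closed])
qed

text \<open>Used for cosets, and with \<open>\<pi>\<close> the identity for records that differ only in components that modules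
  ignore.\<close>

lemma surjective_image_is_module:
  assumes F: "module k F" and surj: "\<pi> ` carrier F = carrier T"
    and add: "\<And>x y. x \<in> carrier F \<Longrightarrow> y \<in> carrier F \<Longrightarrow> \<pi> (x \<oplus>\<^bsub>F\<^esub> y) = \<pi> x \<oplus>\<^bsub>T\<^esub> \<pi> y"
    and smult: "\<And>c x. c \<in> carrier k \<Longrightarrow> x \<in> carrier F \<Longrightarrow> \<pi> (c \<odot>\<^bsub>F\<^esub> x) = c \<odot>\<^bsub>T\<^esub> \<pi> x"
    and zero: "\<pi> \<zero>\<^bsub>F\<^esub> = \<zero>\<^bsub>T\<^esub>"
  shows "module k T"
proof -
  interpret F: module k F by fact
  have ex: "\<exists>x\<in>carrier F. y = \<pi> x" if "y \<in> carrier T" for y using that surj by auto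
  have cl: "\<pi> x \<in> carrier T" if "x \<in> carrier F" for x using that surj by auto
  show ?thesis
  proof (rule moduleI[OF F.is_cring], rule abelian_groupI)
    fix x y assume "x \<in> carrier T" "y \<in> carrier T"
    then obtain a b where ab: "a \<in> carrier F" "b \<in> carrier F" "x = \<pi> a" "y = \<pi> b"
      by (metis ex)
    show "x \<oplus>\<^bsub>T\<^esub> y \<in> carrier T" using ab add cl by (metis F.add.m_closed)
    show "x \<oplus>\<^bsub>T\<^esub> y = y \<oplus>\<^bsub>T\<^esub> x" using ab add by (metis F.add.m_comm)
    fix z assume "z \<in> carrier T"
    then obtain c where c: "c \<in> carrier F" "z = \<pi> c" by (metis ex)
    show "x \<oplus>\<^bsub>T\<^esub> y \<oplus>\<^bsub>T\<^esub> z = x \<oplus>\<^bsub>T\<^esub> (y \<oplus>\<^bsub>T\<^esub> z)"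
      using ab c by (simp add: add[symmetric] F.add.m_assoc)
  next
    show "\<zero>\<^bsub>T\<^esub> \<in> carrier T" using cl[OF F.zero_closed] zero by simp
  next
    fix x assume "x \<in> carrier T"
    then obtain a where a: "a \<in> carrier F" "x = \<pi> a" by (metis ex)
    show "\<zero>\<^bsub>T\<^esub> \<oplus>\<^bsub>T\<^esub> x = x" using a by (simp add: add[symmetric] zero[symmetric])
    have "\<pi> (\<ominus>\<^bsub>F\<^esub> a) \<oplus>\<^bsub>T\<^esub> x = \<zero>\<^bsub>T\<^esub>"
      using a by (simp add: add[symmetric] zero[symmetric] F.l_neg)
    then show "\<exists>y\<in>carrier T. y \<oplus>\<^bsub>T\<^esub> x = \<zero>\<^bsub>T\<^esub>" using cl a by (metis F.add.inv_closed)
    show "\<one>\<^bsub>k\<^esub> \<odot>\<^bsub>T\<^esub> x = x" using a by (simp add: smult[symmetric])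
  next
    fix c x assume c: "c \<in> carrier k" and "x \<in> carrier T"
    then obtain a where a: "a \<in> carrier F" "x = \<pi> a" by (metis ex)
    show "c \<odot>\<^bsub>T\<^esub> x \<in> carrier T" using a c smult cl by (metis F.smult_closed)
    fix d assume d: "d \<in> carrier k"
    show "(c \<oplus>\<^bsub>k\<^esub> d) \<odot>\<^bsub>T\<^esub> x = c \<odot>\<^bsub>T\<^esub> x \<oplus>\<^bsub>T\<^esub> d \<odot>\<^bsub>T\<^esub> x"
      using a c d by (simp add: smult[symmetric] add[symmetric] F.smult_l_distr)
    show "(c \<otimes>\<^bsub>k\<^esub> d) \<odot>\<^bsub>T\<^esub> x = c \<odot>\<^bsub>T\<^esub> (d \<odot>\<^bsub>T\<^esub> x)"
      using a c d by (simp add: smult[symmetric] F.smult_assoc1)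
  next
    fix c x y assume "c \<in> carrier k" "x \<in> carrier T" "y \<in> carrier T"
    moreover then obtain a b where "a \<in> carrier F" "b \<in> carrier F" "x = \<pi> a" "y = \<pi> b"
      by (metis ex)
    ultimately show "c \<odot>\<^bsub>T\<^esub> (x \<oplus>\<^bsub>T\<^esub> y) = c \<odot>\<^bsub>T\<^esub> x \<oplus>\<^bsub>T\<^esub> c \<odot>\<^bsub>T\<^esub> y"
      by (simp add: smult[symmetric] add[symmetric] F.smult_r_distr)
  qed
qed

lemma module_transfer:
  assumes "module k M" "carrier N = carrier M" "add N = add M" "smult N = smult M" "zero N = zero M"
  shows "module k N"
  by (rule surjective_image_is_module[where \<pi> = "\<lambda>x. x", OF assms(1)]) (simp_all add: assms)

definition bilinear_map ::
  "('a, 'r) ring_scheme \<Rightarrow> ('a, 'm, 's) module_scheme \<Rightarrow> ('a, 'n, 't) module_scheme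
     \<Rightarrow> ('a, 'p, 'u) module_scheme \<Rightarrow> ('m \<Rightarrow> 'n \<Rightarrow> 'p) \<Rightarrow> bool" where
  "bilinear_map k M N P f \<longleftrightarrow>
     (\<forall>x\<in>carrier M. f x \<in> module_hom k N P) \<and> (\<forall>y\<in>carrier N. (\<lambda>x. f x y) \<in> module_hom k M P)"

lemma bilinear_mapI:
  assumes "\<And>x. x \<in> carrier M \<Longrightarrow> (\<lambda>y. f x y) \<in> module_hom k N P"
    and "\<And>y. y \<in> carrier N \<Longrightarrow> (\<lambda>x. f x y) \<in> module_hom k M P"
  shows "bilinear_map k M N P f"
  using assms by (auto simp: bilinear_map_def)

lemma bilinear_map_left: "bilinear_map k M N P f \<Longrightarrow> y \<in> carrier N \<Longrightarrow> (\<lambda>x. f x y) \<in> module_hom k M P"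
  and bilinear_map_right: "bilinear_map k M N P f \<Longrightarrow> x \<in> carrier M \<Longrightarrow> f x \<in> module_hom k N P"
  by (auto simp: bilinear_map_def)

lemma bilinear_map_closed:
  "bilinear_map k M N P f \<Longrightarrow> x \<in> carrier M \<Longrightarrow> y \<in> carrier N \<Longrightarrow> f x y \<in> carrier P"
  by (auto simp: bilinear_map_def module_hom_def)

lemma bilinear_map_comp:
  assumes "bilinear_map k M' N' P f" "u \<in> module_hom k M M'" "v \<in> module_hom k N N'"
  shows "bilinear_map k M N P (\<lambda>x y. f (u x) (v y))"
proof (rule bilinear_mapI)
  fix x assume "x \<in> carrier M"
  then show "(\<lambda>y. f (u x) (v y)) \<in> module_hom k N P"
    using module_hom_comp[OF assms(3) bilinear_map_right[OF assms(1)]] assms(2)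
    by (auto dest: module_hom_closed)
next
  fix y assume "y \<in> carrier N"
  then show "(\<lambda>x. f (u x) (v y)) \<in> module_hom k M P"
    using module_hom_comp[OF assms(2) bilinear_map_left[OF assms(1)]] assms(3)
    by (auto dest: module_hom_closed)
qed

lemma bilinear_map_post:
  assumes "bilinear_map k M N P f" "u \<in> module_hom k P Q"
  shows "bilinear_map k M N Q (\<lambda>x y. u (f x y))"
  using assms by (auto simp: bilinear_map_def intro: module_hom_comp)


lemma bilinear_map_flip:
  "bilinear_map k M N P f \<Longrightarrow> bilinear_map k N M P (\<lambda>y x. f x y)"
  by (auto simp: bilinear_map_def)


section \<open>Free modules and their universal property\<close>

lemma free_module_simps:
  "carrier (free_module k X) =
     {f. (\<forall>x\<in>X. f x \<in> carrier k) \<and> (\<forall>x. x \<notin> X \<longrightarrow> f x = \<zero>\<^bsub>k\<^esub>) \<and> finite {x. f x \<noteq> \<zero>\<^bsub>k\<^esub>}}"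
  "\<zero>\<^bsub>free_module k X\<^esub> = (\<lambda>x. \<zero>\<^bsub>k\<^esub>)"
  "f \<oplus>\<^bsub>free_module k X\<^esub> g = (\<lambda>x. f x \<oplus>\<^bsub>k\<^esub> g x)"
  "c \<odot>\<^bsub>free_module k X\<^esub> f = (\<lambda>x. c \<otimes>\<^bsub>k\<^esub> f x)"
  by (simp_all add: free_module_def)

lemma free_module_closed:
  fixes k (structure)
  assumes "cring k" "f \<in> carrier (free_module k X)"
  shows "f x \<in> carrier k"
proof -
  interpret cring k by fact
  show ?thesis using assms(2) by (cases "x \<in> X") (auto simp: free_module_simps)
qed

lemma free_module_is_module:
  fixes k (structure)
  assumes "cring k"
  shows "module k (free_module k X)"
proof -
  interpret cring k by fact
  note cl = free_module_closed[OF assms, of _ X]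
  show ?thesis
  proof (rule moduleI[OF assms], rule abelian_groupI)
    fix f g assume f: "f \<in> carrier (free_module k X)" and g: "g \<in> carrier (free_module k X)"
    have "{x. f x \<oplus> g x \<noteq> \<zero>} \<subseteq> {x. f x \<noteq> \<zero>} \<union> {x. g x \<noteq> \<zero>}"
      using f g by auto
    then have "finite {x. f x \<oplus> g x \<noteq> \<zero>}"
      by (rule finite_subset) (use f g in \<open>auto simp: free_module_simps\<close>)
    then show "f \<oplus>\<^bsub>free_module k X\<^esub> g \<in> carrier (free_module k X)"
      using f g by (auto simp: free_module_simps)
    show "f \<oplus>\<^bsub>free_module k X\<^esub> g = g \<oplus>\<^bsub>free_module k X\<^esub> f"
      using cl[OF f] cl[OF g] by (auto simp: free_module_simps a_comm)
  next
    fix f g h assume "f \<in> carrier (free_module k X)" "g \<in> carrier (free_module k X)"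
      "h \<in> carrier (free_module k X)"
    then show "f \<oplus>\<^bsub>free_module k X\<^esub> g \<oplus>\<^bsub>free_module k X\<^esub> h
        = f \<oplus>\<^bsub>free_module k X\<^esub> (g \<oplus>\<^bsub>free_module k X\<^esub> h)"
      using cl by (simp add: free_module_simps(3) a_assoc)
  next
    fix f assume f: "f \<in> carrier (free_module k X)"
    have "{x. \<ominus> f x \<noteq> \<zero>} \<subseteq> {x. f x \<noteq> \<zero>}" by auto
    then have "finite {x. \<ominus> f x \<noteq> \<zero>}"
      by (rule finite_subset) (use f in \<open>auto simp: free_module_simps\<close>)
    then have "(\<lambda>x. \<ominus> f x) \<in> carrier (free_module k X)"
      using f by (auto simp: free_module_simps)
    then show "\<exists>g\<in>carrier (free_module k X). g \<oplus>\<^bsub>free_module k X\<^esub> f = \<zero>\<^bsub>free_module k X\<^esub>"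
      using cl[OF f] by (auto simp: free_module_simps(2,3) l_neg intro!: bexI[of _ "\<lambda>x. \<ominus> f x"])
  next
    fix c f assume c: "c \<in> carrier k" and f: "f \<in> carrier (free_module k X)"
    have "{x. c \<otimes> f x \<noteq> \<zero>} \<subseteq> {x. f x \<noteq> \<zero>}" using c by auto
    then have "finite {x. c \<otimes> f x \<noteq> \<zero>}"
      by (rule finite_subset) (use f in \<open>auto simp: free_module_simps\<close>)
    then show "c \<odot>\<^bsub>free_module k X\<^esub> f \<in> carrier (free_module k X)"
      using c f by (auto simp: free_module_simps)
  qed (use cl in \<open>auto simp: free_module_simps(2-4) l_distr r_distr m_assoc\<close>,
       auto simp: free_module_simps)
qed

lemma free_gen_closed:
  fixes k (structure)
  assumes "cring k" "x \<in> X"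
  shows "free_gen k x \<in> carrier (free_module k X)"
proof -
  interpret cring k by fact
  have "{y. free_gen k x y \<noteq> \<zero>} \<subseteq> {x}" by (auto simp: free_gen_def)
  then have "finite {y. free_gen k x y \<noteq> \<zero>}" by (rule finite_subset) simp
  then show ?thesis using assms(2) by (auto simp: free_module_simps free_gen_def)
qed

text \<open>Induction on the support: \<open>f\<close> is \<open>f(x := 0)\<close> plus a multiple of a generator.\<close>

lemma free_module_generated:
  fixes k (structure)
  assumes "cring k" "submodule S k (free_module k X)" "\<And>x. x \<in> X \<Longrightarrow> free_gen k x \<in> S"
  shows "carrier (free_module k X) \<subseteq> S"
proof
  interpret cring k by fact
  interpret F: module k "free_module k X" by (rule free_module_is_module) fact
  note S = F.submoduleE[OF assms(2)]
  fix f assume f: "f \<in> carrier (free_module k X)"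
  then have "finite {x. f x \<noteq> \<zero>}" by (auto simp: free_module_simps)
  then show "f \<in> S" using f
  proof (induction "{x. f x \<noteq> \<zero>}" arbitrary: f rule: finite_psubset_induct)
    case psubset
    note f = psubset.prems
    show ?case
    proof (cases "\<exists>x. f x \<noteq> \<zero>")
      case False
      then have "f = \<zero>\<^bsub>free_module k X\<^esub>" by (auto simp: free_module_simps)
      moreover obtain s where "s \<in> S" using S(2) by auto
      ultimately show ?thesis using S(1,3,5) F.r_neg by (metis subsetD)
    next
      case True
      then obtain x where x: "f x \<noteq> \<zero>" by auto
      then have xX: "x \<in> X" using f by (auto simp: free_module_simps)
      let ?g = "f(x := \<zero>)"
      have sub: "{y. ?g y \<noteq> \<zero>} \<subset> {y. f y \<noteq> \<zero>}" using x by auto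
      have g: "?g \<in> carrier (free_module k X)"
        using f finite_subset[OF psubset_imp_subset[OF sub]] by (auto simp: free_module_simps)
      have "f = ?g \<oplus>\<^bsub>free_module k X\<^esub> (f x \<odot>\<^bsub>free_module k X\<^esub> free_gen k x)"
        using free_module_closed[OF assms(1) f] by (auto simp: free_module_simps free_gen_def)
      moreover have "?g \<in> S" by (rule psubset.hyps(2)[OF sub g])
      moreover have "f x \<odot>\<^bsub>free_module k X\<^esub> free_gen k x \<in> S"
        using S(4) assms(3)[OF xX] free_module_closed[OF assms(1) f] by simp
      ultimately show ?thesis using S(5) by metis
    qed
  qed
qed

text \<open>The value of \<open>tensor_lift\<close> at a tensor is this linear extension, evaluated at a representative.\<close>

definition free_ext ::
  "('a, 'r) ring_scheme \<Rightarrow> ('a, 'p, 's) module_scheme \<Rightarrow> ('x \<Rightarrow> 'p) \<Rightarrow> ('x \<Rightarrow> 'a) \<Rightarrow> 'p" where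
  "free_ext k P f r = (\<Oplus>\<^bsub>P\<^esub>z\<in>{z. r z \<noteq> \<zero>\<^bsub>k\<^esub>}. r z \<odot>\<^bsub>P\<^esub> f z)"

lemma free_ext_superset:
  assumes "module k P" "f \<in> X \<rightarrow> carrier P" "r \<in> carrier (free_module k X)"
    and "finite A" "A \<subseteq> X" "{z. r z \<noteq> \<zero>\<^bsub>k\<^esub>} \<subseteq> A"
  shows "free_ext k P f r = (\<Oplus>\<^bsub>P\<^esub>z\<in>A. r z \<odot>\<^bsub>P\<^esub> f z)"
proof -
  interpret P: module k P by fact
  have cl: "r z \<in> carrier k" for z by (rule free_module_closed[OF P.is_cring assms(3)])
  show ?thesis unfolding free_ext_def
    by (rule P.add.finprod_mono_neutral_cong_left) (use assms cl in \<open>auto intro!: P.smult_l_null P.smult_closed dest!: funcset_mem\<close>)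
qed

lemma free_ext_hom:
  assumes "module k P" "f \<in> X \<rightarrow> carrier P"
  shows "free_ext k P f \<in> module_hom k (free_module k X) P"
proof -
  interpret P: module k P by fact
  interpret F: module k "free_module k X" by (rule free_module_is_module) (rule P.is_cring)
  note cl = free_module_closed[OF P.is_cring, of _ X]
  have supp: "finite {z. r z \<noteq> \<zero>\<^bsub>k\<^esub>}" "{z. r z \<noteq> \<zero>\<^bsub>k\<^esub>} \<subseteq> X"
    if "r \<in> carrier (free_module k X)" for r
    using that by (auto simp: free_module_simps)
  have tm: "r z \<odot>\<^bsub>P\<^esub> f z \<in> carrier P" if "r \<in> carrier (free_module k X)" "z \<in> X" for r z
    using that cl assms(2) by auto
  show ?thesis
  proof (rule module_homI)
    fix r assume r: "r \<in> carrier (free_module k X)"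
    show "free_ext k P f r \<in> carrier P" unfolding free_ext_def
      by (rule P.finsum_closed) (use supp(2)[OF r] tm[OF r] in auto)
  next
    fix r s assume r: "r \<in> carrier (free_module k X)" and s: "s \<in> carrier (free_module k X)"
    let ?A = "{z. r z \<noteq> \<zero>\<^bsub>k\<^esub>} \<union> {z. s z \<noteq> \<zero>\<^bsub>k\<^esub>}"
    let ?t = "r \<oplus>\<^bsub>free_module k X\<^esub> s"
    have A: "finite ?A" "?A \<subseteq> X" using supp r s by auto
    have t: "?t \<in> carrier (free_module k X)" using r s by simp
    have "{z. ?t z \<noteq> \<zero>\<^bsub>k\<^esub>} \<subseteq> ?A" by (auto simp: free_module_simps)
    then have "free_ext k P f ?t = (\<Oplus>\<^bsub>P\<^esub>z\<in>?A. ?t z \<odot>\<^bsub>P\<^esub> f z)"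
      by (rule free_ext_superset[OF assms t A])
    also have "\<dots> = (\<Oplus>\<^bsub>P\<^esub>z\<in>?A. r z \<odot>\<^bsub>P\<^esub> f z \<oplus>\<^bsub>P\<^esub> s z \<odot>\<^bsub>P\<^esub> f z)"
      by (rule P.finsum_cong') (use A(2) cl tm r s assms(2) in
          \<open>auto simp: free_module_simps(3) intro!: P.smult_l_distr P.add.m_closed\<close>)
    also have "\<dots> = (\<Oplus>\<^bsub>P\<^esub>z\<in>?A. r z \<odot>\<^bsub>P\<^esub> f z) \<oplus>\<^bsub>P\<^esub> (\<Oplus>\<^bsub>P\<^esub>z\<in>?A. s z \<odot>\<^bsub>P\<^esub> f z)"
      by (rule P.finsum_addf) (use A(2) tm r s in auto)
    also have "\<dots> = free_ext k P f r \<oplus>\<^bsub>P\<^esub> free_ext k P f s"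
      using free_ext_superset[OF assms r A] free_ext_superset[OF assms s A] by simp
    finally show "free_ext k P f ?t = \<dots>" .
  next
    fix c r assume c: "c \<in> carrier k" and r: "r \<in> carrier (free_module k X)"
    let ?A = "{z. r z \<noteq> \<zero>\<^bsub>k\<^esub>}"
    let ?t = "c \<odot>\<^bsub>free_module k X\<^esub> r"
    have t: "?t \<in> carrier (free_module k X)" using c r by simp
    have "{z. ?t z \<noteq> \<zero>\<^bsub>k\<^esub>} \<subseteq> ?A" using c by (auto simp: free_module_simps)
    then have "free_ext k P f ?t = (\<Oplus>\<^bsub>P\<^esub>z\<in>?A. ?t z \<odot>\<^bsub>P\<^esub> f z)"
      by (rule free_ext_superset[OF assms t supp[OF r]])
    also have "\<dots> = (\<Oplus>\<^bsub>P\<^esub>z\<in>?A. c \<odot>\<^bsub>P\<^esub> (r z \<odot>\<^bsub>P\<^esub> f z))"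
      by (rule P.finsum_cong') (use supp(2)[OF r] cl[OF r] c tm[OF r] assms(2) in
          \<open>auto simp: free_module_simps(4) intro!: P.smult_assoc1\<close>)
    also have "\<dots> = c \<odot>\<^bsub>P\<^esub> free_ext k P f r" unfolding free_ext_def
      by (rule P.finsum_smult_ldistr[symmetric]) (use supp[OF r] tm[OF r] c in auto)
    finally show "free_ext k P f ?t = \<dots>" .
  qed
qed

lemma free_ext_gen:
  assumes "module k P" "f \<in> X \<rightarrow> carrier P" "x \<in> X"
  shows "free_ext k P f (free_gen k x) = f x"
proof -
  interpret P: module k P by fact
  have "free_ext k P f (free_gen k x) = (\<Oplus>\<^bsub>P\<^esub>z\<in>{x}. free_gen k x z \<odot>\<^bsub>P\<^esub> f z)"
    by (rule free_ext_superset[OF assms(1,2) free_gen_closed[OF P.is_cring assms(3)]])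
      (use assms(3) in \<open>auto simp: free_gen_def\<close>)
  also have "\<dots> = f x"
    using assms by (simp add: free_gen_def Pi_def)
  finally show ?thesis .
qed


section \<open>Tensor products and their universal property\<close>

lemma tensor_relators_subset:
  assumes "module k M" "module k N"
  shows "tensor_relators k M N \<subseteq> carrier (free_module k (carrier M \<times> carrier N))"
proof -
  interpret M: module k M by fact
  interpret N: module k N by fact
  interpret F: module k "free_module k (carrier M \<times> carrier N)"
    by (rule free_module_is_module) (rule M.is_cring)
  have "free_gen k (x, y) \<in> carrier (free_module k (carrier M \<times> carrier N))"
    if "x \<in> carrier M" "y \<in> carrier N" for x y
    using that by (intro free_gen_closed) (auto intro: M.is_cring)
  then show ?thesis
    by (auto simp: tensor_relators_def Let_def intro!: F.minus_closed F.add.m_closed)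
qed

lemma tensor_rel_submodule:
  assumes "module k M" "module k N"
  shows "submodule (tensor_rel k M N) k (free_module k (carrier M \<times> carrier N))"
proof -
  interpret M: module k M by fact
  interpret F: module k "free_module k (carrier M \<times> carrier N)"
    by (rule free_module_is_module) (rule M.is_cring)
  have top: "submodule (carrier (free_module k (carrier M \<times> carrier N))) k
      (free_module k (carrier M \<times> carrier N))"
    by (rule F.carrier_is_submodule)
  have z: "\<zero>\<^bsub>free_module k (carrier M \<times> carrier N)\<^esub> \<in> S"
    if "submodule S k (free_module k (carrier M \<times> carrier N))" for S
    using subgroup.one_closed[OF submodule.axioms(1)[OF that]] by simp
  show ?thesis unfolding tensor_rel_def
  proof (rule F.submoduleI)
    show "\<Inter> {S. submodule S k (free_module k (carrier M \<times> carrier N)) \<and> tensor_relators k M N \<subseteq> S}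
        \<subseteq> carrier (free_module k (carrier M \<times> carrier N))"
      using top tensor_relators_subset[OF assms] by blast
  qed (auto simp: z F.submoduleE(3-5))
qed

abbreviation tensor_coset where
  "tensor_coset k M N \<equiv> a_r_coset (free_module k (carrier M \<times> carrier N)) (tensor_rel k M N)"

context
  fixes k :: "('a, 'r) ring_scheme" and M :: "('a, 'm, 's) module_scheme"
    and N :: "('a, 'n, 't) module_scheme"
  assumes M: "module k M" and N: "module k N"
begin

interpretation M: module k M by (rule M)
interpretation N: module k N by (rule N)
interpretation F: module k "free_module k (carrier M \<times> carrier N)"
  by (rule free_module_is_module) (rule M.is_cring)
interpretation R: abelian_subgroup "tensor_rel k M N" "free_module k (carrier M \<times> carrier N)"
  by (rule abelian_subgroupI3)
    (auto intro: additive_subgroup.intro submodule.axioms(1) tensor_rel_submodule[OF M N]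
      F.abelian_group_axioms)

lemma tensor_coset_surj:
  "tensor_coset k M N ` carrier (free_module k (carrier M \<times> carrier N)) = carrier (tensor k M N)"
  by (auto simp: tensor_def Let_def A_RCOSETS_def')

lemma tensor_coset_add:
  assumes "r \<in> carrier (free_module k (carrier M \<times> carrier N))"
    "s \<in> carrier (free_module k (carrier M \<times> carrier N))"
  shows "tensor_coset k M N (r \<oplus>\<^bsub>free_module k (carrier M \<times> carrier N)\<^esub> s) =
    tensor_coset k M N r \<oplus>\<^bsub>tensor k M N\<^esub> tensor_coset k M N s"
  using R.a_rcos_sum[OF assms] by (simp add: tensor_def Let_def)

lemma tensor_coset_smult:
  assumes "c \<in> carrier k" "r \<in> carrier (free_module k (carrier M \<times> carrier N))"
  shows "tensor_coset k M N (c \<odot>\<^bsub>free_module k (carrier M \<times> carrier N)\<^esub> r) =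
    c \<odot>\<^bsub>tensor k M N\<^esub> tensor_coset k M N r"
proof -
  let ?F = "free_module k (carrier M \<times> carrier N)" and ?R = "tensor_rel k M N"
  note S = F.submoduleE[OF tensor_rel_submodule[OF M N]]
  have z: "\<zero>\<^bsub>?F\<^esub> \<in> ?R" by simp
  have "?R <+>\<^bsub>?F\<^esub> ((\<lambda>f. c \<odot>\<^bsub>?F\<^esub> f) ` (?R +>\<^bsub>?F\<^esub> r)) = ?R +>\<^bsub>?F\<^esub> (c \<odot>\<^bsub>?F\<^esub> r)" (is "?A = ?B")
  proof
    show "?A \<subseteq> ?B"
    proof
      fix z assume "z \<in> ?A"
      then obtain h h' where h: "h \<in> ?R" "h' \<in> ?R"
        and zz: "z = h \<oplus>\<^bsub>?F\<^esub> c \<odot>\<^bsub>?F\<^esub> (h' \<oplus>\<^bsub>?F\<^esub> r)"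
        by (auto simp: set_add_def' a_r_coset_def')
      have hF: "h \<in> carrier ?F" "h' \<in> carrier ?F" using h S(1) by auto
      have "z = (h \<oplus>\<^bsub>?F\<^esub> c \<odot>\<^bsub>?F\<^esub> h') \<oplus>\<^bsub>?F\<^esub> c \<odot>\<^bsub>?F\<^esub> r"
        using hF assms zz by (simp add: F.smult_r_distr F.add.m_assoc)
      moreover have "h \<oplus>\<^bsub>?F\<^esub> c \<odot>\<^bsub>?F\<^esub> h' \<in> ?R" using h S(4,5) assms by simp
      ultimately show "z \<in> ?B" by (auto simp: a_r_coset_def')
    qed
    show "?B \<subseteq> ?A"
    proof
      fix z assume "z \<in> ?B"
      then obtain h where "h \<in> ?R" "z = h \<oplus>\<^bsub>?F\<^esub> c \<odot>\<^bsub>?F\<^esub> r" by (auto simp: a_r_coset_def')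
      moreover have "r \<in> ?R +>\<^bsub>?F\<^esub> r" by (rule R.a_rcos_self) (rule assms)
      ultimately show "z \<in> ?A" by (auto simp: set_add_def')
    qed
  qed
  then show ?thesis by (simp add: tensor_def Let_def)
qed

lemma tensor_coset_zero:
  assumes "r \<in> tensor_rel k M N"
  shows "tensor_coset k M N r = \<zero>\<^bsub>tensor k M N\<^esub>"
  using R.a_rcos_const[OF assms] by (simp add: tensor_def Let_def)

lemma tensor_is_module: "module k (tensor k M N)"
  by (rule surjective_image_is_module[where \<pi> = "tensor_coset k M N",
        OF F.module_axioms tensor_coset_surj tensor_coset_add tensor_coset_smult])
    (simp_all add: tensor_coset_zero)

interpretation T: module k "tensor k M N" by (rule tensor_is_module)

lemma tensor_coset_hom:
  "tensor_coset k M N \<in> module_hom k (free_module k (carrier M \<times> carrier N)) (tensor k M N)"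
  by (rule module_homI)
    (simp_all add: tensor_coset_surj[symmetric] tensor_coset_add tensor_coset_smult)

lemma tensor_coset_eqI:
  assumes "r \<ominus>\<^bsub>free_module k (carrier M \<times> carrier N)\<^esub> s \<in> tensor_relators k M N"
    and "r \<in> carrier (free_module k (carrier M \<times> carrier N))"
    and "s \<in> carrier (free_module k (carrier M \<times> carrier N))"
  shows "tensor_coset k M N r = tensor_coset k M N s"
proof -
  have "r \<ominus>\<^bsub>free_module k (carrier M \<times> carrier N)\<^esub> s \<in> tensor_rel k M N"
    using assms(1) by (auto simp: tensor_rel_def)
  then show ?thesis
    using tensor_coset_zero module_hom_minus[OF tensor_coset_hom F.module_axioms T.module_axioms assms(2,3)]
      module_hom_closed[OF tensor_coset_hom assms(2)] module_hom_closed[OF tensor_coset_hom assms(3)]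
      module_eq_if_minus_zero[OF T.module_axioms] by simp
qed

lemma pure_tensor_eq: "pure_tensor k M N x y = tensor_coset k M N (free_gen k (x, y))"
  by (simp add: pure_tensor_def)

lemma gen_closed:
  "x \<in> carrier M \<Longrightarrow> y \<in> carrier N \<Longrightarrow>
    free_gen k (x, y) \<in> carrier (free_module k (carrier M \<times> carrier N))"
  by (rule free_gen_closed) (auto intro: M.is_cring)

lemma pure_tensor_bilinear: "bilinear_map k M N (tensor k M N) (pure_tensor k M N)"
proof (rule bilinear_mapI; rule module_homI)
  fix x y assume "x \<in> carrier M" "y \<in> carrier N"
  then show "pure_tensor k M N x y \<in> carrier (tensor k M N)"
    unfolding pure_tensor_eq by (intro module_hom_closed[OF tensor_coset_hom] gen_closed)
  then show "pure_tensor k M N x y \<in> carrier (tensor k M N)" .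
next
  fix x y y' assume a: "x \<in> carrier M" "y \<in> carrier N" "y' \<in> carrier N"
  then show "pure_tensor k M N x (y \<oplus>\<^bsub>N\<^esub> y') = pure_tensor k M N x y \<oplus>\<^bsub>tensor k M N\<^esub> pure_tensor k M N x y'"
    unfolding pure_tensor_eq
    by (subst tensor_coset_add[symmetric], simp_all add: gen_closed, intro tensor_coset_eqI)
      (auto simp: tensor_relators_def Let_def gen_closed)
next
  fix c x y assume a: "x \<in> carrier M" "y \<in> carrier N" "c \<in> carrier k"
  then show "pure_tensor k M N x (c \<odot>\<^bsub>N\<^esub> y) = c \<odot>\<^bsub>tensor k M N\<^esub> pure_tensor k M N x y"
    unfolding pure_tensor_eq
    by (subst tensor_coset_smult[symmetric], simp_all add: gen_closed, intro tensor_coset_eqI)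
      (auto simp: tensor_relators_def Let_def gen_closed)
next
  fix x x' y assume a: "x \<in> carrier M" "x' \<in> carrier M" "y \<in> carrier N"
  then show "pure_tensor k M N (x \<oplus>\<^bsub>M\<^esub> x') y = pure_tensor k M N x y \<oplus>\<^bsub>tensor k M N\<^esub> pure_tensor k M N x' y"
    unfolding pure_tensor_eq
    by (subst tensor_coset_add[symmetric], simp_all add: gen_closed, intro tensor_coset_eqI)
      (auto simp: tensor_relators_def Let_def gen_closed)
next
  fix c x y assume a: "x \<in> carrier M" "y \<in> carrier N" "c \<in> carrier k"
  then show "pure_tensor k M N (c \<odot>\<^bsub>M\<^esub> x) y = c \<odot>\<^bsub>tensor k M N\<^esub> pure_tensor k M N x y"
    unfolding pure_tensor_eq
    by (subst tensor_coset_smult[symmetric], simp_all add: gen_closed, intro tensor_coset_eqI)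
      (auto simp: tensor_relators_def Let_def gen_closed)
qed

lemmas pure_tensor_closed = bilinear_map_closed[OF pure_tensor_bilinear]

text \<open>Scalar multiples are a case of their own because they are what generates the free module from its
  generators; in applications both closure cases are instances of linearity.\<close>

lemma tensor_induct [consumes 1, case_names pure add smult]:
  assumes "t \<in> carrier (tensor k M N)"
    and "\<And>x y. x \<in> carrier M \<Longrightarrow> y \<in> carrier N \<Longrightarrow> Q (pure_tensor k M N x y)"
    and "\<And>s t. s \<in> carrier (tensor k M N) \<Longrightarrow> t \<in> carrier (tensor k M N) \<Longrightarrow> Q s \<Longrightarrow> Q t
      \<Longrightarrow> Q (s \<oplus>\<^bsub>tensor k M N\<^esub> t)"
    and "\<And>c t. c \<in> carrier k \<Longrightarrow> t \<in> carrier (tensor k M N) \<Longrightarrow> Q t \<Longrightarrow> Q (c \<odot>\<^bsub>tensor k M N\<^esub> t)"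
  shows "Q t"
proof -
  let ?F = "free_module k (carrier M \<times> carrier N)"
  note hom = tensor_coset_hom
  note cl = module_hom_closed[OF hom]
  have zero: "Q (tensor_coset k M N \<zero>\<^bsub>?F\<^esub>)"
    using assms(4)[OF M.R.zero_closed pure_tensor_closed[OF M.zero_closed N.zero_closed]
        assms(2)[OF M.zero_closed N.zero_closed]]
      pure_tensor_closed[OF M.zero_closed N.zero_closed]
    by (simp add: module_hom_zero[OF hom F.module_axioms T.module_axioms])
  have "submodule {r \<in> carrier ?F. Q (tensor_coset k M N r)} k ?F"
  proof (rule F.submoduleI)
    fix r assume "r \<in> {r \<in> carrier ?F. Q (tensor_coset k M N r)}"
    then show "\<ominus>\<^bsub>?F\<^esub> r \<in> {r \<in> carrier ?F. Q (tensor_coset k M N r)}"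
      using cl by (auto simp: module_minus_eq[OF F.module_axioms] module_hom_smult[OF hom] intro!: assms(4))
  qed (use zero cl in \<open>auto simp: module_hom_add[OF hom] module_hom_smult[OF hom] intro!: assms(3,4)\<close>)
  then have "carrier ?F \<subseteq> {r \<in> carrier ?F. Q (tensor_coset k M N r)}"
    by (rule free_module_generated[OF M.is_cring])
      (use assms(2) in \<open>auto simp: gen_closed pure_tensor_eq\<close>)
  moreover obtain r where "r \<in> carrier ?F" "t = tensor_coset k M N r"
    using assms(1) unfolding tensor_coset_surj[symmetric] by blast
  ultimately show ?thesis by blast
qed

text \<open>Since \<open>f\<close> is bilinear, its linear extension kills the relators, so its kernel contains the whole
  submodule of relations, and the arbitrary choice of a representative in \<open>tensor_lift\<close> is harmless.\<close>

lemma tensor_lift_coset: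
  assumes P: "module k P" and f: "bilinear_map k M N P f"
    and r: "r \<in> carrier (free_module k (carrier M \<times> carrier N))"
  shows "tensor_lift k P f (tensor_coset k M N r) = free_ext k P (\<lambda>z. f (fst z) (snd z)) r"
proof -
  interpret P: module k P by fact
  let ?X = "carrier M \<times> carrier N"
  let ?F = "free_module k ?X" and ?g = "\<lambda>z. f (fst z) (snd z)"
  have g: "?g \<in> ?X \<rightarrow> carrier P" using bilinear_map_closed[OF f] by auto
  note hom = free_ext_hom[OF P g]
  note cl = module_hom_closed[OF hom]
  let ?K = "{r \<in> carrier ?F. free_ext k P ?g r = \<zero>\<^bsub>P\<^esub>}"
  have "submodule ?K k ?F"
  proof (rule F.submoduleI)
    fix r assume "r \<in> ?K"
    then show "\<ominus>\<^bsub>?F\<^esub> r \<in> ?K"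
      by (simp add: module_minus_eq[OF F.module_axioms] module_hom_smult[OF hom])
  qed (auto simp: module_hom_add[OF hom] module_hom_smult[OF hom]
        module_hom_zero[OF hom F.module_axioms P])
  moreover have "tensor_relators k M N \<subseteq> ?K"
  proof
    fix r assume r: "r \<in> tensor_relators k M N"
    have fg: "free_ext k P ?g (free_gen k (x, y)) = f x y" if "x \<in> carrier M" "y \<in> carrier N" for x y
      using free_ext_gen[OF P g, of "(x, y)"] that by simp
    note fl = module_hom_add[OF bilinear_map_left[OF f]] module_hom_add[OF bilinear_map_right[OF f]]
      module_hom_smult[OF bilinear_map_left[OF f]] module_hom_smult[OF bilinear_map_right[OF f]]
      bilinear_map_closed[OF f]
    show "r \<in> ?K"
      using r tensor_relators_subset[OF M N]
      by (auto simp: tensor_relators_def Let_def module_hom_minus[OF hom F.module_axioms P]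
         module_hom_add[OF hom] module_hom_smult[OF hom] gen_closed fg fl P.r_neg a_minus_def[of P])
  qed
  ultimately have K: "tensor_rel k M N \<subseteq> ?K" by (auto simp: tensor_rel_def)
  define s where "s = (SOME s. s \<in> tensor_coset k M N r)"
  have "s \<in> tensor_coset k M N r" unfolding s_def
    by (rule someI[of _ r]) (rule R.a_rcos_self[OF r])
  then obtain h where "h \<in> tensor_rel k M N" "s = h \<oplus>\<^bsub>?F\<^esub> r" by (auto simp: a_r_coset_def')
  then have "free_ext k P ?g s = free_ext k P ?g r"
    using K r cl by (auto simp: module_hom_add[OF hom])
  then show ?thesis by (simp add: tensor_lift_def Let_def s_def[symmetric] free_ext_def)
qed

lemma tensor_lift_pure:
  assumes "module k P" "bilinear_map k M N P f" "x \<in> carrier M" "y \<in> carrier N"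
  shows "tensor_lift k P f (pure_tensor k M N x y) = f x y"
proof -
  have "(\<lambda>z. f (fst z) (snd z)) \<in> carrier M \<times> carrier N \<rightarrow> carrier P"
    using bilinear_map_closed[OF assms(2)] by auto
  from free_ext_gen[OF assms(1) this, of "(x, y)"] assms show ?thesis
    by (simp add: pure_tensor_eq tensor_lift_coset gen_closed)
qed

lemma tensor_lift_hom:
  assumes P: "module k P" and f: "bilinear_map k M N P f"
  shows "tensor_lift k P f \<in> module_hom k (tensor k M N) P"
proof -
  let ?X = "carrier M \<times> carrier N"
  let ?g = "\<lambda>z. f (fst z) (snd z)"
  have g: "?g \<in> ?X \<rightarrow> carrier P" using bilinear_map_closed[OF f] by auto
  note hom = free_ext_hom[OF P g]
  have ex: "\<exists>r\<in>carrier (free_module k ?X). t = tensor_coset k M N r"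
    if "t \<in> carrier (tensor k M N)" for t
    using that tensor_coset_surj by blast
  note lc = tensor_lift_coset[OF assms]
  show ?thesis
  proof (rule module_homI)
    fix t assume "t \<in> carrier (tensor k M N)"
    then obtain r where "r \<in> carrier (free_module k ?X)" "t = tensor_coset k M N r"
      using ex by meson
    then show "tensor_lift k P f t \<in> carrier P"
      by (simp add: lc module_hom_closed[OF hom])
  next
    fix s t assume "s \<in> carrier (tensor k M N)" "t \<in> carrier (tensor k M N)"
    then obtain r r' where "r \<in> carrier (free_module k ?X)" "r' \<in> carrier (free_module k ?X)"
      "s = tensor_coset k M N r" "t = tensor_coset k M N r'" using ex by meson
    then show "tensor_lift k P f (s \<oplus>\<^bsub>tensor k M N\<^esub> t) = tensor_lift k P f s \<oplus>\<^bsub>P\<^esub> tensor_lift k P f t"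
      by (simp add: tensor_coset_add[symmetric] lc module_hom_add[OF hom])
  next
    fix c t assume "c \<in> carrier k" "t \<in> carrier (tensor k M N)"
    moreover then obtain r where "r \<in> carrier (free_module k ?X)" "t = tensor_coset k M N r"
      using ex by meson
    ultimately show "tensor_lift k P f (c \<odot>\<^bsub>tensor k M N\<^esub> t) = c \<odot>\<^bsub>P\<^esub> tensor_lift k P f t"
      by (simp add: tensor_coset_smult[symmetric] lc module_hom_smult[OF hom])
  qed
qed

lemma tensor_hom_eqI:
  assumes "u \<in> module_hom k (tensor k M N) P" "v \<in> module_hom k (tensor k M N) P"
    and "\<And>x y. x \<in> carrier M \<Longrightarrow> y \<in> carrier N \<Longrightarrow>
      u (pure_tensor k M N x y) = v (pure_tensor k M N x y)"
    and "t \<in> carrier (tensor k M N)"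
  shows "u t = v t"
  using assms(4)
  by (induction rule: tensor_induct)
    (simp_all add: assms(3) module_hom_add[OF assms(1)] module_hom_add[OF assms(2)]
      module_hom_smult[OF assms(1)] module_hom_smult[OF assms(2)])

text \<open>A linear map composed with the linear extension of a bilinear map \<open>f\<close> is again such an
  extension; this is how equations between finite sums \<open>\<Sum> f(a\<^sub>i, b\<^sub>i)\<close> are manipulated
  without choosing representations \<open>\<Sum> a\<^sub>i \<otimes> b\<^sub>i\<close>.\<close>

lemma tensor_lift_post:
  assumes "module k P" "module k Q" "bilinear_map k M N P f" "u \<in> module_hom k P Q"
    and "t \<in> carrier (tensor k M N)"
  shows "u (tensor_lift k P f t) = tensor_lift k Q (\<lambda>a b. u (f a b)) t"
  by (rule tensor_hom_eqI[OF module_hom_comp[OF tensor_lift_hom[OF assms(1,3)] assms(4)]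
        tensor_lift_hom[OF assms(2) bilinear_map_post[OF assms(3,4)]] _ assms(5)])
    (simp add: tensor_lift_pure assms bilinear_map_post[OF assms(3,4)])

lemma tensor_lift_cong:
  assumes "module k P" "bilinear_map k M N P f" "bilinear_map k M N P g"
    and "\<And>a b. a \<in> carrier M \<Longrightarrow> b \<in> carrier N \<Longrightarrow> f a b = g a b"
    and "t \<in> carrier (tensor k M N)"
  shows "tensor_lift k P f t = tensor_lift k P g t"
  by (rule tensor_hom_eqI[OF tensor_lift_hom[OF assms(1,2)] tensor_lift_hom[OF assms(1,3)] _ assms(5)])
    (simp add: tensor_lift_pure assms)

lemma tensor_lift_pure_id:
  assumes "t \<in> carrier (tensor k M N)"
  shows "tensor_lift k (tensor k M N) (pure_tensor k M N) t = t"
  by (rule tensor_hom_eqI[OF tensor_lift_hom[OF tensor_is_module pure_tensor_bilinear] module_hom_id _ assms])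
    (simp add: tensor_lift_pure[OF tensor_is_module pure_tensor_bilinear])

lemma tensor_lift_closed:
  assumes "module k P" "bilinear_map k M N P f" "t \<in> carrier (tensor k M N)"
  shows "tensor_lift k P f t \<in> carrier P"
  by (rule module_hom_closed[OF tensor_lift_hom[OF assms(1,2)] assms(3)])

text \<open>With this, sums over one tensor are again multilinear in the remaining variables, as is needed to
  sum over a second tensor.\<close>

lemma tensor_lift_param_hom:
  assumes P: "module k P" and L: "module k L" and t: "t \<in> carrier (tensor k M N)"
    and f: "\<And>x. x \<in> carrier L \<Longrightarrow> bilinear_map k M N P (f x)"
    and lin: "\<And>a b. a \<in> carrier M \<Longrightarrow> b \<in> carrier N \<Longrightarrow> (\<lambda>x. f x a b) \<in> module_hom k L P"
  shows "(\<lambda>x. tensor_lift k P (f x) t) \<in> module_hom k L P"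
proof -
  interpret P: module k P by fact
  interpret L: module k L by fact
  note hom = tensor_lift_hom[OF P f]
  show ?thesis
  proof (rule module_homI)
    fix x assume "x \<in> carrier L"
    then show "tensor_lift k P (f x) t \<in> carrier P" by (rule tensor_lift_closed[OF P f t])
  next
    fix x y assume x: "x \<in> carrier L" and y: "y \<in> carrier L"
    have xy: "x \<oplus>\<^bsub>L\<^esub> y \<in> carrier L" using x y by simp
    show "tensor_lift k P (f (x \<oplus>\<^bsub>L\<^esub> y)) t = tensor_lift k P (f x) t \<oplus>\<^bsub>P\<^esub> tensor_lift k P (f y) t"
      using t
    proof (induction rule: tensor_induct)
      case (pure a b)
      then show ?case
        by (simp add: tensor_lift_pure[OF P f] x y module_hom_add[OF lin])
    next
      case (add s t)
      then show ?case
        using module_hom_closed[OF hom] x y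
        by (simp add: module_hom_add[OF hom] P.add.m_ac)
    next
      case (smult c t)
      then show ?case
        using module_hom_closed[OF hom] x y
        by (simp add: module_hom_smult[OF hom] P.smult_r_distr)
    qed
  next
    fix c x assume c: "c \<in> carrier k" and x: "x \<in> carrier L"
    have cx: "c \<odot>\<^bsub>L\<^esub> x \<in> carrier L" using c x by simp
    show "tensor_lift k P (f (c \<odot>\<^bsub>L\<^esub> x)) t = c \<odot>\<^bsub>P\<^esub> tensor_lift k P (f x) t"
      using t
    proof (induction rule: tensor_induct)
      case (pure a b)
      then show ?case
        by (simp add: tensor_lift_pure[OF P f] x c module_hom_smult[OF lin])
    next
      case (add s t)
      then show ?case
        using module_hom_closed[OF hom] x c
        by (simp add: module_hom_add[OF hom] P.smult_r_distr)
    next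
      case (smult d t)
      then show ?case
        using module_hom_closed[OF hom] x c
        by (simp add: module_hom_smult[OF hom] P.smult_assoc1[symmetric] M.R.m_comm)
    qed
  qed
qed

end

lemma tensor_lift_param_bilinear:
  assumes M: "module k M" and N: "module k N" and P: "module k P"
    and L: "module k L" and L': "module k L'" and t: "t \<in> carrier (tensor k M N)"
    and f: "\<And>x y. x \<in> carrier L \<Longrightarrow> y \<in> carrier L' \<Longrightarrow> bilinear_map k M N P (f x y)"
    and lin: "\<And>a b. a \<in> carrier M \<Longrightarrow> b \<in> carrier N \<Longrightarrow> bilinear_map k L L' P (\<lambda>x y. f x y a b)"
  shows "bilinear_map k L L' P (\<lambda>x y. tensor_lift k P (f x y) t)"
proof (rule bilinear_mapI)
  fix x assume x: "x \<in> carrier L"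
  show "(\<lambda>y. tensor_lift k P (f x y) t) \<in> module_hom k L' P"
    by (rule tensor_lift_param_hom[OF M N P L' t f[OF x]], assumption)
      (rule bilinear_map_right[OF lin x])
next
  fix y assume y: "y \<in> carrier L'"
  show "(\<lambda>x. tensor_lift k P (f x y) t) \<in> module_hom k L P"
    by (rule tensor_lift_param_hom[OF M N P L t f[OF _ y]], assumption)
      (rule bilinear_map_left[OF lin y])
qed

text \<open>Interchange of two finite sums: both sides are linear in \<open>s\<close>, and for a pure tensor \<open>s\<close> each is a
  single sum over \<open>t\<close>.\<close>

lemma tensor_lift_swap:
  assumes M: "module k M" and N: "module k N" and P: "module k P"
    and L: "module k L" and L': "module k L'"
    and s: "s \<in> carrier (tensor k L L')" and t: "t \<in> carrier (tensor k M N)"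
    and f: "\<And>x y. x \<in> carrier L \<Longrightarrow> y \<in> carrier L' \<Longrightarrow> bilinear_map k M N P (f x y)"
    and g: "\<And>a b. a \<in> carrier M \<Longrightarrow> b \<in> carrier N \<Longrightarrow> bilinear_map k L L' P (\<lambda>x y. f x y a b)"
  shows "tensor_lift k P (\<lambda>x y. tensor_lift k P (f x y) t) s =
    tensor_lift k P (\<lambda>a b. tensor_lift k P (\<lambda>x y. f x y a b) s) t"
proof (rule tensor_hom_eqI[OF L L', where P = P, OF _ _ _ s])
  show "tensor_lift k P (\<lambda>x y. tensor_lift k P (f x y) t) \<in> module_hom k (tensor k L L') P"
    by (rule tensor_lift_hom[OF L L' P tensor_lift_param_bilinear[OF M N P L L' t f g]])
  show "(\<lambda>s. tensor_lift k P (\<lambda>a b. tensor_lift k P (\<lambda>x y. f x y a b) s) t)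
      \<in> module_hom k (tensor k L L') P"
    by (rule tensor_lift_param_hom[OF M N P tensor_is_module[OF L L'] t])
      (auto intro: tensor_lift_param_bilinear[OF L L' P M N _ g f] tensor_lift_hom[OF L L' P g])
next
  fix x y assume xy: "x \<in> carrier L" "y \<in> carrier L'"
  have b: "bilinear_map k M N P (\<lambda>a b. tensor_lift k P (\<lambda>x y. f x y a b) (pure_tensor k L L' x y))"
    by (rule tensor_lift_param_bilinear[OF L L' P M N _ g f])
      (auto intro: pure_tensor_closed[OF L L'] xy)
  have "tensor_lift k P (\<lambda>x y. tensor_lift k P (f x y) t) (pure_tensor k L L' x y) =
      tensor_lift k P (f x y) t"
    by (rule tensor_lift_pure[OF L L' P tensor_lift_param_bilinear[OF M N P L L' t f g] xy])
  also have "\<dots> = tensor_lift k P (\<lambda>a b. tensor_lift k P (\<lambda>x y. f x y a b) (pure_tensor k L L' x y)) t"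
    by (rule tensor_lift_cong[OF M N P f[OF xy] b _ t]) (simp add: tensor_lift_pure[OF L L' P g xy])
  finally show "tensor_lift k P (\<lambda>x y. tensor_lift k P (f x y) t) (pure_tensor k L L' x y) = \<dots>" .
qed

lemma tensor_map_bilinear:
  assumes "module k M" "module k N" "module k P" "module k Q"
    and "f \<in> module_hom k M P" "g \<in> module_hom k N Q"
  shows "bilinear_map k M N (tensor k P Q) (\<lambda>x y. pure_tensor k P Q (f x) (g y))"
  by (rule bilinear_map_comp[OF pure_tensor_bilinear[OF assms(3,4)] assms(5,6)])

lemma tensor_lift_tensor_map:
  assumes "module k M" "module k N" "module k P" "module k Q" "module k V"
    and "f \<in> module_hom k M P" "g \<in> module_hom k N Q" "bilinear_map k P Q V u"
    and "t \<in> carrier (tensor k M N)"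
  shows "tensor_lift k V u (tensor_map k P Q f g t) = tensor_lift k V (\<lambda>x y. u (f x) (g y)) t"
proof -
  note b = tensor_map_bilinear[OF assms(1-4,6,7)]
  have "tensor_lift k V u (tensor_map k P Q f g t) =
      tensor_lift k V (\<lambda>x y. tensor_lift k V u (pure_tensor k P Q (f x) (g y))) t"
    unfolding tensor_map_def
    by (rule tensor_lift_post[OF assms(1,2) tensor_is_module[OF assms(3,4)] assms(5) b
          tensor_lift_hom[OF assms(3,4,5,8)] assms(9)])
  also have "\<dots> = tensor_lift k V (\<lambda>x y. u (f x) (g y)) t"
    by (rule tensor_lift_cong[OF assms(1,2,5) bilinear_map_post[OF b tensor_lift_hom[OF assms(3,4,5,8)]]
          bilinear_map_comp[OF assms(8,6,7)] _ assms(9)])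
      (simp add: tensor_lift_pure[OF assms(3,4,5,8)] module_hom_closed[OF assms(6)]
        module_hom_closed[OF assms(7)])
  finally show ?thesis .
qed


section \<open>Algebras and their tensor products\<close>

lemma k_algebraI:
  assumes A: "module k A" and b: "bilinear_map k A A A (mult A)" and one: "\<one>\<^bsub>A\<^esub> \<in> carrier A"
    and assoc: "\<And>x y z. x \<in> carrier A \<Longrightarrow> y \<in> carrier A \<Longrightarrow> z \<in> carrier A \<Longrightarrow>
      x \<otimes>\<^bsub>A\<^esub> y \<otimes>\<^bsub>A\<^esub> z = x \<otimes>\<^bsub>A\<^esub> (y \<otimes>\<^bsub>A\<^esub> z)"
    and l_one: "\<And>x. x \<in> carrier A \<Longrightarrow> \<one>\<^bsub>A\<^esub> \<otimes>\<^bsub>A\<^esub> x = x"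
    and r_one: "\<And>x. x \<in> carrier A \<Longrightarrow> x \<otimes>\<^bsub>A\<^esub> \<one>\<^bsub>A\<^esub> = x"
  shows "k_algebra k A"
proof -
  interpret A: module k A by fact
  show ?thesis
  proof (intro k_algebra.intro k_algebra_axioms.intro A ringI monoidI)
    show "abelian_group A" by (rule A.abelian_group_axioms)
  qed (auto simp: one assoc l_one r_one bilinear_map_closed[OF b]
      module_hom_add[OF bilinear_map_left[OF b]] module_hom_add[OF bilinear_map_right[OF b]]
      module_hom_smult[OF bilinear_map_left[OF b]] module_hom_smult[OF bilinear_map_right[OF b]])
qed

lemma k_algebra_is_module: "k_algebra k A \<Longrightarrow> module k A"
  by (rule k_algebra.axioms(1))

lemma k_algebra_bilinear:
  assumes "k_algebra k A"
  shows "bilinear_map k A A A (mult A)"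
proof -
  interpret A: k_algebra k A by fact
  show ?thesis
    by (auto intro!: bilinear_mapI module_homI
        simp: A.l_distr A.r_distr A.smult_mult_left A.smult_mult_right)
qed

lemma self_module_is_module:
  assumes "cring k"
  shows "module k (self_module k)"
proof -
  interpret cring k by fact
  show ?thesis
  proof (rule moduleI[OF assms], rule abelian_groupI)
    fix x assume "x \<in> carrier (self_module k)"
    then show "\<exists>y\<in>carrier (self_module k). y \<oplus>\<^bsub>self_module k\<^esub> x = \<zero>\<^bsub>self_module k\<^esub>"
      by (auto simp: self_module_def intro!: bexI[of _ "\<ominus>\<^bsub>k\<^esub> x"] l_neg)
  qed (auto simp: self_module_def a_ac l_distr r_distr m_assoc)
qed

lemma smult_bilinear:
  assumes "module k M"
  shows "bilinear_map k (self_module k) M M (smult M)"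
proof -
  interpret M: module k M by fact
  show ?thesis
    by (auto intro!: bilinear_mapI module_homI simp: self_module_def M.smult_l_distr M.smult_r_distr
        M.smult_assoc1[symmetric] M.R.m_comm)
qed

definition trilinear_map ::
  "('a, 'r) ring_scheme \<Rightarrow> ('a, 'l, 's) module_scheme \<Rightarrow> ('a, 'm, 't) module_scheme
     \<Rightarrow> ('a, 'n, 'u) module_scheme \<Rightarrow> ('a, 'p, 'v) module_scheme
     \<Rightarrow> ('l \<Rightarrow> 'm \<Rightarrow> 'n \<Rightarrow> 'p) \<Rightarrow> bool" where
  "trilinear_map k L M N P f \<longleftrightarrow>
     (\<forall>x\<in>carrier L. bilinear_map k M N P (f x)) \<and>
     (\<forall>y\<in>carrier M. \<forall>z\<in>carrier N. (\<lambda>x. f x y z) \<in> module_hom k L P)"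

lemma trilinear_map_bilinear_right:
  "trilinear_map k L M N P f \<Longrightarrow> x \<in> carrier L \<Longrightarrow> bilinear_map k M N P (f x)"
  by (simp add: trilinear_map_def)

lemma trilinear_map_bilinear_left:
  "trilinear_map k L M N P f \<Longrightarrow> z \<in> carrier N \<Longrightarrow> bilinear_map k L M P (\<lambda>x y. f x y z)"
  by (auto simp: trilinear_map_def intro!: bilinear_mapI dest: bilinear_map_left)

lemma trilinear_map_linear:
  "trilinear_map k L M N P f \<Longrightarrow> y \<in> carrier M \<Longrightarrow> z \<in> carrier N \<Longrightarrow>
     (\<lambda>x. f x y z) \<in> module_hom k L P"
  by (simp add: trilinear_map_def)

lemma trilinear_map_right_nested:
  assumes "bilinear_map k L Q P f" "bilinear_map k M N Q g"
  shows "trilinear_map k L M N P (\<lambda>x y z. f x (g y z))"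
proof -
  have "bilinear_map k M N P (\<lambda>y z. f x (g y z))" if "x \<in> carrier L" for x
    by (rule bilinear_map_post[OF assms(2) bilinear_map_right[OF assms(1) that]])
  moreover have "(\<lambda>x. f x (g y z)) \<in> module_hom k L P" if "y \<in> carrier M" "z \<in> carrier N" for y z
    by (rule bilinear_map_left[OF assms(1) bilinear_map_closed[OF assms(2) that]])
  ultimately show ?thesis by (simp add: trilinear_map_def)
qed

lemma trilinear_map_comp:
  assumes "trilinear_map k L' M' N' P f" "u \<in> module_hom k L L'" "v \<in> module_hom k M M'"
    "w \<in> module_hom k N N'"
  shows "trilinear_map k L M N P (\<lambda>x y z. f (u x) (v y) (w z))"
proof -
  have "bilinear_map k M N P (\<lambda>y z. f (u x) (v y) (w z))" if "x \<in> carrier L" for x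
    by (rule bilinear_map_comp[OF trilinear_map_bilinear_right[OF assms(1)] assms(3,4)])
      (rule module_hom_closed[OF assms(2) that])
  moreover have "(\<lambda>x. f (u x) (v y) (w z)) \<in> module_hom k L P"
    if "y \<in> carrier M" "z \<in> carrier N" for y z
    by (rule module_hom_comp[OF assms(2) trilinear_map_linear[OF assms(1)]])
      (use that assms(3,4) in \<open>auto dest: module_hom_closed\<close>)
  ultimately show ?thesis by (simp add: trilinear_map_def)
qed

lemma trilinear_map_post:
  assumes f: "trilinear_map k L M N P f" and u: "u \<in> module_hom k P Q"
  shows "trilinear_map k L M N Q (\<lambda>x y z. u (f x y z))"
proof -
  have "(\<lambda>x. u (f x y z)) \<in> module_hom k L Q" if "y \<in> carrier M" "z \<in> carrier N" for y z
    by (rule module_hom_comp[OF trilinear_map_linear[OF f that] u])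
  then show ?thesis
    using bilinear_map_post[OF trilinear_map_bilinear_right[OF f] u] by (simp add: trilinear_map_def)
qed

lemma tensor_algebra_simps:
  "carrier (tensor_algebra k A B) = carrier (tensor k A B)"
  "add (tensor_algebra k A B) = add (tensor k A B)"
  "zero (tensor_algebra k A B) = zero (tensor k A B)"
  "smult (tensor_algebra k A B) = smult (tensor k A B)"
  "\<one>\<^bsub>tensor_algebra k A B\<^esub> = pure_tensor k A B \<one>\<^bsub>A\<^esub> \<one>\<^bsub>B\<^esub>"
  "s \<otimes>\<^bsub>tensor_algebra k A B\<^esub> t = tensor_lift k (tensor k A B) (\<lambda>a b.
     tensor_lift k (tensor k A B) (\<lambda>a' b'. pure_tensor k A B (a \<otimes>\<^bsub>A\<^esub> a') (b \<otimes>\<^bsub>B\<^esub> b')) t) s"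
  by (simp_all add: tensor_algebra_def)

lemma module_hom_tensor_algebra_iff:
  "module_hom k M (tensor_algebra k A B) = module_hom k M (tensor k A B)"
  "module_hom k (tensor_algebra k A B) M = module_hom k (tensor k A B) M"
  by (simp_all add: module_hom_def tensor_algebra_simps)

context
  fixes k :: "('a, 'r) ring_scheme" and A :: "('a, 'm, 's) module_scheme"
    and B :: "('a, 'n, 't) module_scheme"
  assumes A: "k_algebra k A" and B: "k_algebra k B"
begin

interpretation A: k_algebra k A by (rule A)
interpretation B: k_algebra k B by (rule B)
interpretation T: module k "tensor k A B"
  by (rule tensor_is_module) (rule A.module_axioms B.module_axioms)+

lemma tensor_mult_bilinear_outer:
  assumes "a' \<in> carrier A" "b' \<in> carrier B"
  shows "bilinear_map k A B (tensor k A B) (\<lambda>a b. pure_tensor k A B (a \<otimes>\<^bsub>A\<^esub> a') (b \<otimes>\<^bsub>B\<^esub> b'))"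
  by (rule bilinear_map_comp[OF pure_tensor_bilinear[OF A.module_axioms B.module_axioms]
        bilinear_map_left[OF k_algebra_bilinear[OF A] assms(1)]
        bilinear_map_left[OF k_algebra_bilinear[OF B] assms(2)]])

lemma tensor_mult_bilinear_inner:
  assumes "a \<in> carrier A" "b \<in> carrier B"
  shows "bilinear_map k A B (tensor k A B) (\<lambda>a' b'. pure_tensor k A B (a \<otimes>\<^bsub>A\<^esub> a') (b \<otimes>\<^bsub>B\<^esub> b'))"
  by (rule bilinear_map_comp[OF pure_tensor_bilinear[OF A.module_axioms B.module_axioms]
        bilinear_map_right[OF k_algebra_bilinear[OF A] assms(1)]
        bilinear_map_right[OF k_algebra_bilinear[OF B] assms(2)]])

lemma tensor_mult_lift_bilinear:
  assumes "t \<in> carrier (tensor k A B)"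
  shows "bilinear_map k A B (tensor k A B) (\<lambda>a b. tensor_lift k (tensor k A B)
    (\<lambda>a' b'. pure_tensor k A B (a \<otimes>\<^bsub>A\<^esub> a') (b \<otimes>\<^bsub>B\<^esub> b')) t)"
  by (rule tensor_lift_param_bilinear[OF A.module_axioms B.module_axioms T.module_axioms
        A.module_axioms B.module_axioms assms])
    (simp_all add: tensor_mult_bilinear_inner tensor_mult_bilinear_outer)

lemma tensor_algebra_mult_bilinear:
  "bilinear_map k (tensor k A B) (tensor k A B) (tensor k A B) (mult (tensor_algebra k A B))"
proof (rule bilinear_mapI)
  fix t assume "t \<in> carrier (tensor k A B)"
  then show "(\<lambda>s. s \<otimes>\<^bsub>tensor_algebra k A B\<^esub> t) \<in> module_hom k (tensor k A B) (tensor k A B)"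
    unfolding tensor_algebra_simps
    by (intro tensor_lift_hom A.module_axioms B.module_axioms T.module_axioms tensor_mult_lift_bilinear)
next
  fix s assume s: "s \<in> carrier (tensor k A B)"
  show "(\<lambda>t. s \<otimes>\<^bsub>tensor_algebra k A B\<^esub> t) \<in> module_hom k (tensor k A B) (tensor k A B)"
    unfolding tensor_algebra_simps
    by (rule tensor_lift_param_hom[OF A.module_axioms B.module_axioms T.module_axioms T.module_axioms s])
      (simp_all add: tensor_mult_lift_bilinear tensor_mult_bilinear_inner
        tensor_lift_hom[OF A.module_axioms B.module_axioms T.module_axioms])
qed

lemma tensor_algebra_mult_pure:
  assumes "a \<in> carrier A" "b \<in> carrier B" "a' \<in> carrier A" "b' \<in> carrier B"
  shows "pure_tensor k A B a b \<otimes>\<^bsub>tensor_algebra k A B\<^esub> pure_tensor k A B a' b' =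
    pure_tensor k A B (a \<otimes>\<^bsub>A\<^esub> a') (b \<otimes>\<^bsub>B\<^esub> b')"
  using assms
  by (simp add: tensor_algebra_simps tensor_lift_pure[OF A.module_axioms B.module_axioms T.module_axioms]
      tensor_mult_lift_bilinear tensor_mult_bilinear_inner
      pure_tensor_closed[OF A.module_axioms B.module_axioms])

text \<open>By linearity in each factor, associativity is reduced to pure tensors, one factor at a time.\<close>

lemma tensor_algebra_is_k_algebra: "k_algebra k (tensor_algebra k A B)"
proof (rule k_algebraI)
  let ?T = "tensor k A B" and ?m = "mult (tensor_algebra k A B)"
  note b = tensor_algebra_mult_bilinear
  note cl = bilinear_map_closed[OF b]
  note pc = pure_tensor_closed[OF A.module_axioms B.module_axioms]
  note eqI = tensor_hom_eqI[OF A.module_axioms B.module_axioms, where P = ?T]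
  show "module k (tensor_algebra k A B)"
    by (rule module_transfer[OF T.module_axioms]) (simp_all add: tensor_algebra_simps)
  show "bilinear_map k (tensor_algebra k A B) (tensor_algebra k A B) (tensor_algebra k A B) ?m"
    using b by (simp add: bilinear_map_def module_hom_tensor_algebra_iff tensor_algebra_simps(1))
  show "\<one>\<^bsub>tensor_algebra k A B\<^esub> \<in> carrier (tensor_algebra k A B)"
    by (simp add: tensor_algebra_simps pc)
  note bl = bilinear_map_left[OF b] and br = bilinear_map_right[OF b]
  fix x assume x: "x \<in> carrier (tensor_algebra k A B)"
  show "\<one>\<^bsub>tensor_algebra k A B\<^esub> \<otimes>\<^bsub>tensor_algebra k A B\<^esub> x = x"
    by (rule eqI[OF br module_hom_id])
      (use x in \<open>simp_all add: tensor_algebra_simps(1,5) tensor_algebra_mult_pure pc\<close>)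
  show "x \<otimes>\<^bsub>tensor_algebra k A B\<^esub> \<one>\<^bsub>tensor_algebra k A B\<^esub> = x"
    by (rule eqI[OF bl module_hom_id])
      (use x in \<open>simp_all add: tensor_algebra_simps(1,5) tensor_algebra_mult_pure pc\<close>)
  fix y z assume y: "y \<in> carrier (tensor_algebra k A B)" and z: "z \<in> carrier (tensor_algebra k A B)"
  note xyz = x[unfolded tensor_algebra_simps] y[unfolded tensor_algebra_simps] z[unfolded tensor_algebra_simps]
  have 1: "?m (?m (pure_tensor k A B a b) (pure_tensor k A B a' b')) z =
      ?m (pure_tensor k A B a b) (?m (pure_tensor k A B a' b') z)"
    if ab: "a \<in> carrier A" "b \<in> carrier B" "a' \<in> carrier A" "b' \<in> carrier B" for a b a' b'
    by (rule eqI[OF br module_hom_comp[OF br br] _ xyz(3)])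
      (use ab in \<open>simp_all add: tensor_algebra_mult_pure pc A.m_assoc B.m_assoc\<close>)
  have 2: "?m (?m (pure_tensor k A B a b) y) z = ?m (pure_tensor k A B a b) (?m y z)"
    if ab: "a \<in> carrier A" "b \<in> carrier B" for a b
    by (rule eqI[OF module_hom_comp[OF br bl] module_hom_comp[OF bl br] _ xyz(2)])
      (use ab xyz(3) in \<open>simp_all add: 1 pc\<close>)
  show "?m (?m x y) z = ?m x (?m y z)"
    by (rule eqI[OF module_hom_comp[OF bl bl] bl _ xyz(1)]) (use xyz in \<open>simp_all add: 2 cl\<close>)
qed

end


section \<open>Coalgebras\<close>

text \<open>For a linear map out of \<open>C \<otimes> C\<close> given by a bilinear \<open>f\<close>, the value
  \<open>tensor_lift k P f (comult C x)\<close> is \<open>\<Sum> f(x\<^sub>1, x\<^sub>2)\<close> in Sweedler's notation. The axioms of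
  coalgebras and bialgebras are restated in terms of such sums.\<close>

abbreviation sweedler where
  "sweedler k P C f x \<equiv> tensor_lift k P f (comult C x)"

lemma coalgebra_is_module: "coalgebra k C \<Longrightarrow> module k C"
  and comult_hom: "coalgebra k C \<Longrightarrow> comult C \<in> module_hom k C (tensor k C C)"
  and counit_hom: "coalgebra k C \<Longrightarrow> counit C \<in> module_hom k C (self_module k)"
  by (simp_all add: coalgebra_def)

lemma comult_closed: "coalgebra k C \<Longrightarrow> x \<in> carrier C \<Longrightarrow> comult C x \<in> carrier (tensor k C C)"
  by (rule module_hom_closed[OF comult_hom])

lemma counit_closed: "coalgebra k C \<Longrightarrow> x \<in> carrier C \<Longrightarrow> counit C x \<in> carrier k"
  using module_hom_closed[OF counit_hom] by (fastforce simp: self_module_def)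

lemma sweedler_hom:
  assumes "coalgebra k C" "module k P" "bilinear_map k C C P f"
  shows "sweedler k P C f \<in> module_hom k C P"
  by (rule module_hom_comp[OF comult_hom[OF assms(1)]
        tensor_lift_hom[OF coalgebra_is_module[OF assms(1)] coalgebra_is_module[OF assms(1)] assms(2,3)]])

lemma sweedler_post:
  assumes "coalgebra k C" "module k P" "module k Q" "bilinear_map k C C P f" "u \<in> module_hom k P Q"
    and "x \<in> carrier C"
  shows "u (sweedler k P C f x) = sweedler k Q C (\<lambda>a b. u (f a b)) x"
  by (rule tensor_lift_post[OF coalgebra_is_module[OF assms(1)] coalgebra_is_module[OF assms(1)]
        assms(2-5) comult_closed[OF assms(1,6)]])

lemma sweedler_cong:
  assumes "coalgebra k C" "module k P" "bilinear_map k C C P f" "bilinear_map k C C P g"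
    and "\<And>a b. a \<in> carrier C \<Longrightarrow> b \<in> carrier C \<Longrightarrow> f a b = g a b"
    and "x \<in> carrier C"
  shows "sweedler k P C f x = sweedler k P C g x"
  by (rule tensor_lift_cong[OF coalgebra_is_module[OF assms(1)] coalgebra_is_module[OF assms(1)]
        assms(2-5) comult_closed[OF assms(1,6)]])

text \<open>These two facts make iterated sums \<open>\<Sum> f(x\<^sub>1, x\<^sub>2, x\<^sub>3)\<close> meaningful, for either way of
  splitting \<open>x\<close> twice.\<close>

lemma sweedler_trilinear_bilinear:
  assumes M: "module k C" and D: "comult C \<in> module_hom k C (tensor k C C)"
    and P: "module k P" and f: "trilinear_map k C C C P f"
  shows "bilinear_map k C C P (\<lambda>a b. sweedler k P C (f a) b)"
    and "bilinear_map k C C P (\<lambda>a b. sweedler k P C (\<lambda>c d. f c d b) a)"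
proof -
  have hom: "sweedler k P C u \<in> module_hom k C P" if "bilinear_map k C C P u" for u
    by (rule module_hom_comp[OF D tensor_lift_hom[OF M M P that]])
  show "bilinear_map k C C P (\<lambda>a b. sweedler k P C (f a) b)"
  proof (rule bilinear_mapI)
    fix b assume "b \<in> carrier C"
    then show "(\<lambda>a. sweedler k P C (f a) b) \<in> module_hom k C P"
      by (intro tensor_lift_param_hom[OF M M P M] module_hom_closed[OF D])
        (auto intro: trilinear_map_bilinear_right[OF f] trilinear_map_linear[OF f])
  qed (rule hom, rule trilinear_map_bilinear_right[OF f])
  show "bilinear_map k C C P (\<lambda>a b. sweedler k P C (\<lambda>c d. f c d b) a)"
  proof (rule bilinear_mapI)
    fix a assume "a \<in> carrier C"
    then show "(\<lambda>b. sweedler k P C (\<lambda>c d. f c d b) a) \<in> module_hom k C P"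
      by (intro tensor_lift_param_hom[OF M M P M] module_hom_closed[OF D])
        (auto intro: trilinear_map_bilinear_left[OF f]
          bilinear_map_right[OF trilinear_map_bilinear_right[OF f]])
  qed (rule hom, rule trilinear_map_bilinear_left[OF f])
qed

lemmas trilinear_sweedler_bilinear =
  sweedler_trilinear_bilinear[OF coalgebra_is_module comult_hom]

context
  fixes k :: "('a, 'r) ring_scheme" and C :: "('a, 'b) bialg"
  assumes M: "module k C" and D: "comult C \<in> module_hom k C (tensor k C C)"
begin

text \<open>The two sides of the coassociativity axiom, as iterated Sweedler sums in \<open>C \<otimes> (C \<otimes> C)\<close>.\<close>

lemma coassoc_left_form:
  assumes x: "x \<in> carrier C"
  shows "tensor_assoc k C C C (tensor_map k (tensor k C C) C (comult C) id (comult C x)) =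
    sweedler k (tensor k C (tensor k C C)) C (\<lambda>a b.
      sweedler k (tensor k C (tensor k C C)) C (\<lambda>c d. pure_tensor k C (tensor k C C) c (pure_tensor k C C d b)) a) x"
proof -
  let ?CC = "tensor k C C" and ?T = "tensor k C (tensor k C C)"
  note CC = tensor_is_module[OF M M]
  note T = tensor_is_module[OF M CC]
  have tri: "trilinear_map k C C C ?T (\<lambda>c d b. pure_tensor k C ?CC c (pure_tensor k C C d b))"
    by (rule trilinear_map_right_nested[OF pure_tensor_bilinear[OF M CC] pure_tensor_bilinear[OF M M]])
  have b: "bilinear_map k ?CC C ?T (\<lambda>s z. tensor_lift k ?T
      (\<lambda>x y. pure_tensor k C ?CC x (pure_tensor k C C y z)) s)"
  proof (rule bilinear_mapI)
    fix s assume "s \<in> carrier ?CC"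
    then show "(\<lambda>z. tensor_lift k ?T (\<lambda>x y. pure_tensor k C ?CC x (pure_tensor k C C y z)) s)
        \<in> module_hom k C ?T"
      by (intro tensor_lift_param_hom[OF M M T M] trilinear_map_bilinear_left[OF tri])
        (auto intro: bilinear_map_right[OF trilinear_map_bilinear_right[OF tri]])
  qed (intro tensor_lift_hom[OF M M T] trilinear_map_bilinear_left[OF tri])
  have "id \<in> module_hom k C C" using module_hom_id by (simp add: id_def)
  from tensor_lift_tensor_map[OF M M CC M T D this b module_hom_closed[OF D x]]
  show ?thesis by (simp add: tensor_assoc_def Let_def)
qed

lemma coassoc_right_form:
  assumes x: "x \<in> carrier C"
  shows "tensor_map k C (tensor k C C) id (comult C) (comult C x) =
    sweedler k (tensor k C (tensor k C C)) C (\<lambda>a b.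
      sweedler k (tensor k C (tensor k C C)) C (\<lambda>c d. pure_tensor k C (tensor k C C) a (pure_tensor k C C c d)) b) x"
proof -
  let ?CC = "tensor k C C" and ?T = "tensor k C (tensor k C C)"
  note CC = tensor_is_module[OF M M]
  note T = tensor_is_module[OF M CC]
  note pb = pure_tensor_bilinear[OF M CC]
  have tri: "trilinear_map k C C C ?T (\<lambda>c d b. pure_tensor k C ?CC c (pure_tensor k C C d b))"
    by (rule trilinear_map_right_nested[OF pb pure_tensor_bilinear[OF M M]])
  have eq: "pure_tensor k C ?CC a (comult C b) =
      sweedler k ?T C (\<lambda>c d. pure_tensor k C ?CC a (pure_tensor k C C c d)) b"
    if "a \<in> carrier C" "b \<in> carrier C" for a b
    using tensor_lift_post[OF M M CC T pure_tensor_bilinear[OF M M] bilinear_map_right[OF pb that(1)]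
        module_hom_closed[OF D that(2)]]
    by (simp add: tensor_lift_pure_id[OF M M module_hom_closed[OF D that(2)]])
  have b1: "bilinear_map k C C ?T (\<lambda>a b. pure_tensor k C ?CC (id a) (comult C b))"
    using bilinear_map_comp[OF pb module_hom_id D] by simp
  note b2 = sweedler_trilinear_bilinear(1)[OF M D T tri]
  show ?thesis unfolding tensor_map_def
    by (rule tensor_lift_cong[OF M M T b1 b2 _ module_hom_closed[OF D x]]) (simp add: eq)
qed

lemma coalgebraI:
  assumes "counit C \<in> module_hom k C (self_module k)"
    and "\<And>x. x \<in> carrier C \<Longrightarrow> sweedler k (tensor k C (tensor k C C)) C (\<lambda>a b.
        sweedler k (tensor k C (tensor k C C)) C (\<lambda>c d. pure_tensor k C (tensor k C C) c (pure_tensor k C C d b)) a) x =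
      sweedler k (tensor k C (tensor k C C)) C (\<lambda>a b.
        sweedler k (tensor k C (tensor k C C)) C (\<lambda>c d. pure_tensor k C (tensor k C C) a (pure_tensor k C C c d)) b) x"
    and "\<And>x. x \<in> carrier C \<Longrightarrow> sweedler k C C (\<lambda>a b. counit C a \<odot>\<^bsub>C\<^esub> b) x = x"
    and "\<And>x. x \<in> carrier C \<Longrightarrow> sweedler k C C (\<lambda>a b. counit C b \<odot>\<^bsub>C\<^esub> a) x = x"
  shows "coalgebra k C"
  using assms M D by (simp add: coalgebra_def coassoc_left_form coassoc_right_form)

end

text \<open>The axiom is the case of the universal trilinear map into \<open>C \<otimes> (C \<otimes> C)\<close>; any other
  trilinear \<open>f\<close> is this one followed by a linear map \<open>F\<close>.\<close>

theorem sweedler_coassoc: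
  assumes C: "coalgebra k C" and P: "module k P" and f: "trilinear_map k C C C P f"
    and x: "x \<in> carrier C"
  shows "sweedler k P C (\<lambda>a b. sweedler k P C (\<lambda>c d. f c d b) a) x =
    sweedler k P C (\<lambda>a b. sweedler k P C (\<lambda>c d. f a c d) b) x"
proof -
  let ?CC = "tensor k C C" and ?T = "tensor k C (tensor k C C)"
  note M = coalgebra_is_module[OF C] and D = comult_hom[OF C]
  note CC = tensor_is_module[OF M M]
  note T = tensor_is_module[OF M CC]
  note Dc = module_hom_closed[OF D]
  let ?p = "\<lambda>a b c. pure_tensor k C ?CC a (pure_tensor k C C b c)"
  have tri: "trilinear_map k C C C ?T ?p"
    by (rule trilinear_map_right_nested[OF pure_tensor_bilinear[OF M CC] pure_tensor_bilinear[OF M M]])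
  have bF: "bilinear_map k C ?CC P (\<lambda>a t. tensor_lift k P (f a) t)"
  proof (rule bilinear_mapI)
    fix t assume "t \<in> carrier ?CC"
    then show "(\<lambda>a. tensor_lift k P (f a) t) \<in> module_hom k C P"
      by (intro tensor_lift_param_hom[OF M M P M] trilinear_map_bilinear_right[OF f]
          trilinear_map_linear[OF f])
  qed (intro tensor_lift_hom[OF M M P] trilinear_map_bilinear_right[OF f])
  define F where "F = tensor_lift k P (\<lambda>a t. tensor_lift k P (f a) t)"
  have F: "F \<in> module_hom k ?T P" unfolding F_def by (rule tensor_lift_hom[OF M CC P bF])
  have Fp: "F (?p a b c) = f a b c" if "a \<in> carrier C" "b \<in> carrier C" "c \<in> carrier C" for a b c
    using that by (simp add: F_def tensor_lift_pure[OF M CC P bF] pure_tensor_closed[OF M M]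
        tensor_lift_pure[OF M M P trilinear_map_bilinear_right[OF f]])
  have Ftri: "trilinear_map k C C C P (\<lambda>a b c. F (?p a b c))"
    by (rule trilinear_map_post[OF tri F])
  note b1 = trilinear_sweedler_bilinear[OF C C T tri]
  note b2 = trilinear_sweedler_bilinear[OF C C P Ftri]
  note b3 = trilinear_sweedler_bilinear[OF C C P f]
  have "sweedler k ?T C (\<lambda>a b. sweedler k ?T C (\<lambda>c d. ?p c d b) a) x =
      sweedler k ?T C (\<lambda>a b. sweedler k ?T C (\<lambda>c d. ?p a c d) b) x"
    using C x unfolding coassoc_left_form[OF M D x, symmetric] coassoc_right_form[OF M D x, symmetric]
    by (simp add: coalgebra_def)
  then have "F (sweedler k ?T C (\<lambda>a b. sweedler k ?T C (\<lambda>c d. ?p c d b) a) x) =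
      F (sweedler k ?T C (\<lambda>a b. sweedler k ?T C (\<lambda>c d. ?p a c d) b) x)" by simp
  moreover have "F (sweedler k ?T C (\<lambda>a b. sweedler k ?T C (\<lambda>c d. ?p c d b) a) x) =
      sweedler k P C (\<lambda>a b. sweedler k P C (\<lambda>c d. f c d b) a) x"
    unfolding sweedler_post[OF C T P b1(2) F x]
  proof (rule sweedler_cong[OF C P bilinear_map_post[OF b1(2) F] b3(2) _ x])
    fix a b assume ab: "a \<in> carrier C" "b \<in> carrier C"
    show "F (sweedler k ?T C (\<lambda>c d. ?p c d b) a) = sweedler k P C (\<lambda>c d. f c d b) a"
      unfolding sweedler_post[OF C T P trilinear_map_bilinear_left[OF tri ab(2)] F ab(1)]
      by (rule sweedler_cong[OF C P trilinear_map_bilinear_left[OF Ftri ab(2)]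
            trilinear_map_bilinear_left[OF f ab(2)] _ ab(1)]) (simp add: Fp ab)
  qed
  moreover have "F (sweedler k ?T C (\<lambda>a b. sweedler k ?T C (\<lambda>c d. ?p a c d) b) x) =
      sweedler k P C (\<lambda>a b. sweedler k P C (\<lambda>c d. f a c d) b) x"
    unfolding sweedler_post[OF C T P b1(1) F x]
  proof (rule sweedler_cong[OF C P bilinear_map_post[OF b1(1) F] b3(1) _ x])
    fix a b assume ab: "a \<in> carrier C" "b \<in> carrier C"
    show "F (sweedler k ?T C (\<lambda>c d. ?p a c d) b) = sweedler k P C (\<lambda>c d. f a c d) b"
      unfolding sweedler_post[OF C T P trilinear_map_bilinear_right[OF tri ab(1)] F ab(2)]
      by (rule sweedler_cong[OF C P trilinear_map_bilinear_right[OF Ftri ab(1)]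
            trilinear_map_bilinear_right[OF f ab(1)] _ ab(2)]) (simp add: Fp ab)
  qed
  ultimately show ?thesis by simp
qed

lemma counit_smult_bilinear:
  assumes C: "coalgebra k C" and P: "module k P" and u: "u \<in> module_hom k C P"
  shows "bilinear_map k C C P (\<lambda>a b. counit C a \<odot>\<^bsub>P\<^esub> u b)"
    and "bilinear_map k C C P (\<lambda>a b. counit C b \<odot>\<^bsub>P\<^esub> u a)"
proof -
  note b = bilinear_map_comp[OF smult_bilinear[OF P] counit_hom[OF C] u]
  then show "bilinear_map k C C P (\<lambda>a b. counit C a \<odot>\<^bsub>P\<^esub> u b)" .
  show "bilinear_map k C C P (\<lambda>a b. counit C b \<odot>\<^bsub>P\<^esub> u a)"
    by (rule bilinear_mapI) (use b in \<open>auto simp: bilinear_map_def\<close>)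
qed

lemma sweedler_counit:
  assumes C: "coalgebra k C" and P: "module k P" and u: "u \<in> module_hom k C P" and x: "x \<in> carrier C"
  shows "sweedler k P C (\<lambda>a b. counit C a \<odot>\<^bsub>P\<^esub> u b) x = u x"
    and "sweedler k P C (\<lambda>a b. counit C b \<odot>\<^bsub>P\<^esub> u a) x = u x"
proof -
  note M = coalgebra_is_module[OF C]
  note b = counit_smult_bilinear[OF C M module_hom_id] and b' = counit_smult_bilinear[OF C P u]
  have "sweedler k P C (\<lambda>a b. counit C a \<odot>\<^bsub>P\<^esub> u b) x =
      sweedler k P C (\<lambda>a b. u (counit C a \<odot>\<^bsub>C\<^esub> b)) x"
    by (rule sweedler_cong[OF C P b'(1) bilinear_map_post[OF b(1) u] _ x])
      (simp add: module_hom_smult[OF u] counit_closed[OF C])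
  also have "\<dots> = u (sweedler k C C (\<lambda>a b. counit C a \<odot>\<^bsub>C\<^esub> b) x)"
    by (rule sweedler_post[OF C M P b(1) u x, symmetric])
  finally show "sweedler k P C (\<lambda>a b. counit C a \<odot>\<^bsub>P\<^esub> u b) x = u x"
    using C x by (simp add: coalgebra_def)
  have "sweedler k P C (\<lambda>a b. counit C b \<odot>\<^bsub>P\<^esub> u a) x =
      sweedler k P C (\<lambda>a b. u (counit C b \<odot>\<^bsub>C\<^esub> a)) x"
    by (rule sweedler_cong[OF C P b'(2) bilinear_map_post[OF b(2) u] _ x])
      (simp add: module_hom_smult[OF u] counit_closed[OF C])
  also have "\<dots> = u (sweedler k C C (\<lambda>a b. counit C b \<odot>\<^bsub>C\<^esub> a) x)"
    by (rule sweedler_post[OF C M P b(2) u x, symmetric])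
  finally show "sweedler k P C (\<lambda>a b. counit C b \<odot>\<^bsub>P\<^esub> u a) x = u x"
    using C x by (simp add: coalgebra_def)
qed

definition coalg_hom ::
  "('a, 'r) ring_scheme \<Rightarrow> ('a, 'b) bialg \<Rightarrow> ('a, 'c) bialg \<Rightarrow> ('b \<Rightarrow> 'c) set" where
  "coalg_hom k C D = {f \<in> module_hom k C D.
     (\<forall>x\<in>carrier C. comult D (f x) = tensor_map k D D f f (comult C x)) \<and>
     (\<forall>x\<in>carrier C. counit D (f x) = counit C x)}"

lemma sweedler_coalg_hom:
  assumes f: "f \<in> coalg_hom k C D" and C: "coalgebra k C" and D: "module k D" and P: "module k P"
    and u: "bilinear_map k D D P u" and x: "x \<in> carrier C"
  shows "sweedler k P D u (f x) = sweedler k P C (\<lambda>a b. u (f a) (f b)) x"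
proof -
  note M = coalgebra_is_module[OF C]
  have lin: "f \<in> module_hom k C D" using f by (simp add: coalg_hom_def)
  show ?thesis
    using tensor_lift_tensor_map[OF M M D D P lin lin u comult_closed[OF C x]] f x
    by (simp add: coalg_hom_def)
qed


section \<open>Convolution\<close>

definition conv ::
  "('a, 'r) ring_scheme \<Rightarrow> ('a, 'b) bialg \<Rightarrow> ('a, 'm, 's) module_scheme \<Rightarrow> ('b \<Rightarrow> 'm) \<Rightarrow> ('b \<Rightarrow> 'm) \<Rightarrow> 'b \<Rightarrow> 'm"
where
  "conv k C A f g x = sweedler k A C (\<lambda>a b. f a \<otimes>\<^bsub>A\<^esub> g b) x"

context
  fixes k :: "('a, 'r) ring_scheme" and C :: "('a, 'b) bialg" and A :: "('a, 'm, 's) module_scheme"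
  assumes C: "coalgebra k C" and A: "k_algebra k A"
begin

interpretation A: k_algebra k A by (rule A)

lemma conv_bilinear:
  assumes "f \<in> module_hom k C A" "g \<in> module_hom k C A"
  shows "bilinear_map k C C A (\<lambda>a b. f a \<otimes>\<^bsub>A\<^esub> g b)"
  by (rule bilinear_map_comp[OF k_algebra_bilinear[OF A] assms])

lemma conv_hom:
  assumes "f \<in> module_hom k C A" "g \<in> module_hom k C A"
  shows "conv k C A f g \<in> module_hom k C A"
proof -
  have "conv k C A f g = sweedler k A C (\<lambda>a b. f a \<otimes>\<^bsub>A\<^esub> g b)" by (simp add: conv_def fun_eq_iff)
  then show ?thesis by (simp add: sweedler_hom[OF C A.module_axioms conv_bilinear[OF assms]])
qed

lemma conv_cong:
  assumes "f \<in> module_hom k C A" "g \<in> module_hom k C A" "f' \<in> module_hom k C A" "g' \<in> module_hom k C A"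
    and "\<And>x. x \<in> carrier C \<Longrightarrow> f x = f' x" "\<And>x. x \<in> carrier C \<Longrightarrow> g x = g' x" "x \<in> carrier C"
  shows "conv k C A f g x = conv k C A f' g' x"
  unfolding conv_def
  by (rule sweedler_cong[OF C A.module_axioms conv_bilinear[OF assms(1,2)] conv_bilinear[OF assms(3,4)]])
    (simp_all add: assms)

lemma conv_assoc:
  assumes f: "f \<in> module_hom k C A" and g: "g \<in> module_hom k C A" and h: "h \<in> module_hom k C A"
    and x: "x \<in> carrier C"
  shows "conv k C A (conv k C A f g) h x = conv k C A f (conv k C A g h) x"
proof -
  note b = k_algebra_bilinear[OF A]
  note M = A.module_axioms
  let ?t = "\<lambda>a b c. f a \<otimes>\<^bsub>A\<^esub> (g b \<otimes>\<^bsub>A\<^esub> h c)"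
  have tri: "trilinear_map k C C C A ?t"
    by (rule trilinear_map_comp[OF trilinear_map_right_nested[OF b b] f g h])
  note bt = trilinear_sweedler_bilinear[OF C C M tri]
  note cf = module_hom_closed[OF f] and cg = module_hom_closed[OF g] and ch = module_hom_closed[OF h]
  have "conv k C A (conv k C A f g) h x = sweedler k A C (\<lambda>a b. sweedler k A C (\<lambda>c d. ?t c d b) a) x"
    unfolding conv_def[of k C A "conv k C A f g"]
  proof (rule sweedler_cong[OF C M conv_bilinear[OF conv_hom[OF f g] h] bt(2) _ x])
    fix a b assume ab: "a \<in> carrier C" "b \<in> carrier C"
    have "conv k C A f g a \<otimes>\<^bsub>A\<^esub> h b = sweedler k A C (\<lambda>c d. f c \<otimes>\<^bsub>A\<^esub> g d \<otimes>\<^bsub>A\<^esub> h b) a"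
      unfolding conv_def
      by (rule sweedler_post[OF C M M conv_bilinear[OF f g] bilinear_map_left[OF b ch[OF ab(2)]] ab(1)])
    also have "\<dots> = sweedler k A C (\<lambda>c d. ?t c d b) a"
      by (rule sweedler_cong[OF C M bilinear_map_post[OF conv_bilinear[OF f g] bilinear_map_left[OF b ch[OF ab(2)]]]
          trilinear_map_bilinear_left[OF tri ab(2)] _ ab(1)]) (simp add: cf cg ch ab A.m_assoc)
    finally show "conv k C A f g a \<otimes>\<^bsub>A\<^esub> h b = sweedler k A C (\<lambda>c d. ?t c d b) a" .
  qed
  also have "\<dots> = sweedler k A C (\<lambda>a b. sweedler k A C (\<lambda>c d. ?t a c d) b) x"
    by (rule sweedler_coassoc[OF C M tri x])
  also have "\<dots> = conv k C A f (conv k C A g h) x"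
    unfolding conv_def[of k C A f]
  proof (rule sweedler_cong[OF C M bt(1) conv_bilinear[OF f conv_hom[OF g h]] _ x])
    fix a b assume ab: "a \<in> carrier C" "b \<in> carrier C"
    show "sweedler k A C (\<lambda>c d. ?t a c d) b = f a \<otimes>\<^bsub>A\<^esub> conv k C A g h b"
      unfolding conv_def
      by (rule sweedler_post[OF C M M conv_bilinear[OF g h] bilinear_map_right[OF b cf[OF ab(1)]] ab(2),
            symmetric])
  qed
  finally show ?thesis .
qed

lemma conv_one_hom: "(\<lambda>x. counit C x \<odot>\<^bsub>A\<^esub> \<one>\<^bsub>A\<^esub>) \<in> module_hom k C A"
  by (rule module_hom_comp[OF counit_hom[OF C] bilinear_map_left[OF smult_bilinear[OF A.module_axioms]]])
    simp

lemma conv_one_left: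
  assumes f: "f \<in> module_hom k C A" and x: "x \<in> carrier C"
  shows "conv k C A (\<lambda>x. counit C x \<odot>\<^bsub>A\<^esub> \<one>\<^bsub>A\<^esub>) f x = f x"
proof -
  have "conv k C A (\<lambda>x. counit C x \<odot>\<^bsub>A\<^esub> \<one>\<^bsub>A\<^esub>) f x = sweedler k A C (\<lambda>a b. counit C a \<odot>\<^bsub>A\<^esub> f b) x"
    unfolding conv_def
    by (rule sweedler_cong[OF C A.module_axioms conv_bilinear[OF conv_one_hom f]
          counit_smult_bilinear(1)[OF C A.module_axioms f] _ x])
      (simp add: A.smult_mult_left counit_closed[OF C] module_hom_closed[OF f])
  then show ?thesis by (simp add: sweedler_counit(1)[OF C A.module_axioms f x])
qed

lemma conv_one_right:
  assumes f: "f \<in> module_hom k C A" and x: "x \<in> carrier C"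
  shows "conv k C A f (\<lambda>x. counit C x \<odot>\<^bsub>A\<^esub> \<one>\<^bsub>A\<^esub>) x = f x"
proof -
  have "conv k C A f (\<lambda>x. counit C x \<odot>\<^bsub>A\<^esub> \<one>\<^bsub>A\<^esub>) x = sweedler k A C (\<lambda>a b. counit C b \<odot>\<^bsub>A\<^esub> f a) x"
    unfolding conv_def
    by (rule sweedler_cong[OF C A.module_axioms conv_bilinear[OF f conv_one_hom]
          counit_smult_bilinear(2)[OF C A.module_axioms f] _ x])
      (simp add: A.smult_mult_right counit_closed[OF C] module_hom_closed[OF f])
  then show ?thesis by (simp add: sweedler_counit(2)[OF C A.module_axioms f x])
qed

text \<open>\<open>f = f * (g * h) = (f * g) * h = h\<close>.\<close>

lemma conv_inverse_unique:
  assumes f: "f \<in> module_hom k C A" and g: "g \<in> module_hom k C A" and h: "h \<in> module_hom k C A"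
    and fg: "\<And>x. x \<in> carrier C \<Longrightarrow> conv k C A f g x = counit C x \<odot>\<^bsub>A\<^esub> \<one>\<^bsub>A\<^esub>"
    and gh: "\<And>x. x \<in> carrier C \<Longrightarrow> conv k C A g h x = counit C x \<odot>\<^bsub>A\<^esub> \<one>\<^bsub>A\<^esub>"
    and x: "x \<in> carrier C"
  shows "f x = h x"
proof -
  have "f x = conv k C A f (conv k C A g h) x"
    using conv_cong[OF f conv_one_hom f conv_hom[OF g h] _ _ x] by (simp add: gh conv_one_right[OF f x])
  also have "\<dots> = conv k C A (conv k C A f g) h x" by (rule conv_assoc[OF f g h x, symmetric])
  also have "\<dots> = h x"
    using conv_cong[OF conv_hom[OF f g] h conv_one_hom h _ _ x] by (simp add: fg conv_one_left[OF h x])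
  finally show ?thesis .
qed

lemma conv_post:
  assumes f: "f \<in> module_hom k C A" and g: "g \<in> module_hom k C A" and B: "module k B"
    and u: "u \<in> module_hom k A B" and m: "\<And>x y. x \<in> carrier A \<Longrightarrow> y \<in> carrier A \<Longrightarrow>
      u (x \<otimes>\<^bsub>A\<^esub> y) = u x \<otimes>\<^bsub>B\<^esub> u y"
    and b: "bilinear_map k B B B (mult B)" and x: "x \<in> carrier C"
  shows "u (conv k C A f g x) = conv k C B (\<lambda>x. u (f x)) (\<lambda>x. u (g x)) x"
  unfolding conv_def sweedler_post[OF C A.module_axioms B conv_bilinear[OF f g] u x]
  by (rule sweedler_cong[OF C B bilinear_map_post[OF conv_bilinear[OF f g] u]
        bilinear_map_comp[OF b module_hom_comp[OF f u] module_hom_comp[OF g u]] _ x])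
    (simp add: m module_hom_closed[OF f] module_hom_closed[OF g])

lemma conv_coalg_hom:
  assumes f: "f \<in> module_hom k C A" and g: "g \<in> module_hom k C A"
    and i: "i \<in> coalg_hom k C' C" and C': "coalgebra k C'" and x: "x \<in> carrier C'"
  shows "conv k C A f g (i x) = conv k C' A (\<lambda>x. f (i x)) (\<lambda>x. g (i x)) x"
  unfolding conv_def
  by (rule sweedler_coalg_hom[OF i C' coalgebra_is_module[OF C] A.module_axioms conv_bilinear[OF f g] x])

end


section \<open>Bialgebras\<close>

lemma bialgebra_is_k_algebra: "bialgebra k B \<Longrightarrow> k_algebra k B"
  and bialgebra_is_coalgebra: "bialgebra k B \<Longrightarrow> coalgebra k B"
  by (simp_all add: bialgebra_def)

lemma bialgebra_is_module: "bialgebra k B \<Longrightarrow> module k B"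
  by (rule k_algebra_is_module[OF bialgebra_is_k_algebra])

lemma comult_mult:
  "bialgebra k B \<Longrightarrow> x \<in> carrier B \<Longrightarrow> y \<in> carrier B \<Longrightarrow>
    comult B (x \<otimes>\<^bsub>B\<^esub> y) = comult B x \<otimes>\<^bsub>tensor_algebra k B B\<^esub> comult B y"
  and comult_one: "bialgebra k B \<Longrightarrow> comult B \<one>\<^bsub>B\<^esub> = pure_tensor k B B \<one>\<^bsub>B\<^esub> \<one>\<^bsub>B\<^esub>"
  and counit_mult: "bialgebra k B \<Longrightarrow> x \<in> carrier B \<Longrightarrow> y \<in> carrier B \<Longrightarrow>
    counit B (x \<otimes>\<^bsub>B\<^esub> y) = counit B x \<otimes>\<^bsub>k\<^esub> counit B y"
  and counit_one: "bialgebra k B \<Longrightarrow> counit B \<one>\<^bsub>B\<^esub> = \<one>\<^bsub>k\<^esub>"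
  by (auto simp: bialgebra_def ring_hom_def tensor_algebra_simps)

lemma bialgebraI:
  assumes A: "k_algebra k B" and C: "coalgebra k B"
    and "\<And>x y. x \<in> carrier B \<Longrightarrow> y \<in> carrier B \<Longrightarrow>
      comult B (x \<otimes>\<^bsub>B\<^esub> y) = comult B x \<otimes>\<^bsub>tensor_algebra k B B\<^esub> comult B y"
    and "comult B \<one>\<^bsub>B\<^esub> = pure_tensor k B B \<one>\<^bsub>B\<^esub> \<one>\<^bsub>B\<^esub>"
    and "\<And>x y. x \<in> carrier B \<Longrightarrow> y \<in> carrier B \<Longrightarrow>
      counit B (x \<otimes>\<^bsub>B\<^esub> y) = counit B x \<otimes>\<^bsub>k\<^esub> counit B y"
    and "counit B \<one>\<^bsub>B\<^esub> = \<one>\<^bsub>k\<^esub>"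
  shows "bialgebra k B"
  using assms module_hom_add[OF counit_hom[OF C]]
  by (auto simp: bialgebra_def tensor_algebra_simps(1,2,5) comult_closed counit_closed
      module_hom_add[OF comult_hom[OF C]] self_module_def intro!: ring_hom_memI)

lemma bialg_hom_iff: "bialg_hom k A B = ring_hom A B \<inter> coalg_hom k A B"
  by (auto simp: bialg_hom_def coalg_hom_def)

lemma coalg_hom_linear: "f \<in> coalg_hom k A B \<Longrightarrow> f \<in> module_hom k A B"
  by (simp add: coalg_hom_def)

lemma bialg_hom_linear: "f \<in> bialg_hom k A B \<Longrightarrow> f \<in> module_hom k A B"
  by (simp add: bialg_hom_def)

lemma coalg_hom_comult:
  "f \<in> coalg_hom k A B \<Longrightarrow> x \<in> carrier A \<Longrightarrow>
    comult B (f x) = sweedler k (tensor k B B) A (\<lambda>a b. pure_tensor k B B (f a) (f b)) x"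
  by (simp add: coalg_hom_def tensor_map_def)

lemma coalg_homI:
  assumes "f \<in> module_hom k A B"
    and "\<And>x. x \<in> carrier A \<Longrightarrow>
      comult B (f x) = sweedler k (tensor k B B) A (\<lambda>a b. pure_tensor k B B (f a) (f b)) x"
    and "\<And>x. x \<in> carrier A \<Longrightarrow> counit B (f x) = counit A x"
  shows "f \<in> coalg_hom k A B"
  using assms by (simp add: coalg_hom_def tensor_map_def)

lemma coalg_hom_comp:
  assumes f: "f \<in> coalg_hom k A B" and g: "g \<in> coalg_hom k B C"
    and A: "coalgebra k A" and B: "module k B" and C: "module k C"
  shows "(\<lambda>x. g (f x)) \<in> coalg_hom k A C"
proof (rule coalg_homI)
  note fl = coalg_hom_linear[OF f] and gl = coalg_hom_linear[OF g]
  show "(\<lambda>x. g (f x)) \<in> module_hom k A C" by (rule module_hom_comp[OF fl gl])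
  fix x assume x: "x \<in> carrier A"
  show "counit C (g (f x)) = counit A x"
    using f g x module_hom_closed[OF fl x] by (simp add: coalg_hom_def)
  have b: "bilinear_map k B B (tensor k C C) (\<lambda>a b. pure_tensor k C C (g a) (g b))"
    by (rule tensor_map_bilinear[OF B B C C gl gl])
  show "comult C (g (f x)) =
      sweedler k (tensor k C C) A (\<lambda>a b. pure_tensor k C C (g (f a)) (g (f b))) x"
    using coalg_hom_comult[OF g module_hom_closed[OF fl x]]
      sweedler_coalg_hom[OF f A B tensor_is_module[OF C C] b x] by simp
qed

lemma bialg_hom_comp:
  assumes f: "f \<in> bialg_hom k A B" and g: "g \<in> bialg_hom k B C"
    and A: "bialgebra k A" and B: "bialgebra k B" and C: "bialgebra k C"
  shows "(\<lambda>x. g (f x)) \<in> bialg_hom k A C"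
proof -
  have "(\<lambda>x. g (f x)) \<in> ring_hom A C"
    using f g ring_hom_trans[of f A B g C] by (simp add: bialg_hom_iff comp_def)
  moreover have "(\<lambda>x. g (f x)) \<in> coalg_hom k A C"
    by (rule coalg_hom_comp[of f k A B g C])
      (use f g A B C in \<open>auto simp: bialg_hom_iff bialgebra_is_coalgebra bialgebra_is_module\<close>)
  ultimately show ?thesis by (simp add: bialg_hom_iff)
qed

lemma bialg_hom_id:
  assumes "bialgebra k A"
  shows "(\<lambda>x. x) \<in> bialg_hom k A A"
proof -
  note M = bialgebra_is_module[OF assms] and C = bialgebra_is_coalgebra[OF assms]
  have "(\<lambda>x. x) \<in> coalg_hom k A A"
    by (rule coalg_homI) (simp_all add: module_hom_id tensor_lift_pure_id[OF M M comult_closed[OF C]])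
  then show ?thesis by (auto simp: bialg_hom_iff ring_hom_def)
qed

lemma sweedler_one:
  assumes "bialgebra k B" "module k P" "bilinear_map k B B P f"
  shows "sweedler k P B f \<one>\<^bsub>B\<^esub> = f \<one>\<^bsub>B\<^esub> \<one>\<^bsub>B\<^esub>"
proof -
  interpret B: k_algebra k B by (rule bialgebra_is_k_algebra) fact
  show ?thesis
    by (simp add: comult_one[OF assms(1)]
        tensor_lift_pure[OF B.module_axioms B.module_axioms assms(2,3)])
qed

lemma sweedler_mult:
  assumes B: "bialgebra k B" and P: "module k P" and f: "bilinear_map k B B P f"
    and x: "x \<in> carrier B" and y: "y \<in> carrier B"
  shows "sweedler k P B f (x \<otimes>\<^bsub>B\<^esub> y) =
    sweedler k P B (\<lambda>a b. sweedler k P B (\<lambda>c d. f (a \<otimes>\<^bsub>B\<^esub> c) (b \<otimes>\<^bsub>B\<^esub> d)) y) x"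
proof -
  note A = bialgebra_is_k_algebra[OF B] and C = bialgebra_is_coalgebra[OF B]
  note M = k_algebra_is_module[OF A] and b = k_algebra_bilinear[OF A]
  note T = tensor_is_module[OF M M] and hom = tensor_lift_hom[OF M M P f]
  note bx = tensor_mult_lift_bilinear[OF A A comult_closed[OF C y]]
  have bi: "bilinear_map k B B P (\<lambda>c d. f (a \<otimes>\<^bsub>B\<^esub> c) (b \<otimes>\<^bsub>B\<^esub> d))"
    if "a \<in> carrier B" "b \<in> carrier B" for a b
    by (rule bilinear_map_comp[OF f bilinear_map_right[OF b that(1)] bilinear_map_right[OF b that(2)]])
  have bo: "bilinear_map k B B P (\<lambda>a b. f (a \<otimes>\<^bsub>B\<^esub> c) (b \<otimes>\<^bsub>B\<^esub> d))"
    if "c \<in> carrier B" "d \<in> carrier B" for c d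
    by (rule bilinear_map_comp[OF f bilinear_map_left[OF b that(1)] bilinear_map_left[OF b that(2)]])
  show ?thesis
    unfolding comult_mult[OF B x y] tensor_algebra_simps
    unfolding sweedler_post[OF C T P bx hom x]
  proof (rule sweedler_cong[OF C P bilinear_map_post[OF bx hom]
        tensor_lift_param_bilinear[OF M M P M M comult_closed[OF C y] bi bo] _ x])
    fix a b assume ab: "a \<in> carrier B" "b \<in> carrier B"
    show "tensor_lift k P f (sweedler k (tensor k B B) B
        (\<lambda>a' b'. pure_tensor k B B (a \<otimes>\<^bsub>B\<^esub> a') (b \<otimes>\<^bsub>B\<^esub> b')) y) =
      sweedler k P B (\<lambda>c d. f (a \<otimes>\<^bsub>B\<^esub> c) (b \<otimes>\<^bsub>B\<^esub> d)) y"
      unfolding sweedler_post[OF C T P tensor_mult_bilinear_inner[OF A A ab] hom y]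
      by (rule sweedler_cong[OF C P bilinear_map_post[OF tensor_mult_bilinear_inner[OF A A ab] hom] bi[OF ab] _ y])
        (simp add: tensor_lift_pure[OF M M P f] bilinear_map_closed[OF b] ab)
  qed
qed


section \<open>Antipodes\<close>

lemma antipode_iff_conv:
  "antipode k H S \<longleftrightarrow> S \<in> module_hom k H H \<and>
    (\<forall>x\<in>carrier H. conv k H H S (\<lambda>x. x) x = counit H x \<odot>\<^bsub>H\<^esub> \<one>\<^bsub>H\<^esub> \<and>
      conv k H H (\<lambda>x. x) S x = counit H x \<odot>\<^bsub>H\<^esub> \<one>\<^bsub>H\<^esub>)"
  by (simp add: antipode_def conv_def)

lemma antipode_linear: "antipode k H S \<Longrightarrow> S \<in> module_hom k H H"
  and antipode_left: "antipode k H S \<Longrightarrow> x \<in> carrier H \<Longrightarrow>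
    conv k H H S (\<lambda>x. x) x = counit H x \<odot>\<^bsub>H\<^esub> \<one>\<^bsub>H\<^esub>"
  and antipode_right: "antipode k H S \<Longrightarrow> x \<in> carrier H \<Longrightarrow>
    conv k H H (\<lambda>x. x) S x = counit H x \<odot>\<^bsub>H\<^esub> \<one>\<^bsub>H\<^esub>"
  by (simp_all add: antipode_iff_conv)

text \<open>If \<open>i\<close> is a morphism of coalgebras and \<open>g\<close> one of algebras, then \<open>g \<circ> S \<circ> i\<close> is the
  convolution inverse of \<open>g \<circ> i\<close>. Inverses being unique, \<open>g \<circ> S \<circ> i\<close> depends only on \<open>g \<circ> i\<close>.\<close>

lemma antipode_sandwich:
  assumes D: "coalgebra k D" and H: "k_algebra k H" "coalgebra k H" and A: "k_algebra k A"
    and S: "antipode k H S"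
    and i: "i \<in> coalg_hom k D H" "i' \<in> coalg_hom k D H"
    and g: "g \<in> ring_hom H A" "g \<in> module_hom k H A" "g' \<in> ring_hom H A" "g' \<in> module_hom k H A"
    and eq: "\<And>x. x \<in> carrier D \<Longrightarrow> g (i x) = g' (i' x)"
    and x: "x \<in> carrier D"
  shows "g (S (i x)) = g' (S (i' x))"
proof -
  interpret A: k_algebra k A by (rule A)
  interpret H: k_algebra k H by (rule H)
  note M = A.module_axioms
  note b = k_algebra_bilinear[OF A]
  note Sl = antipode_linear[OF S]
  have lin: "(\<lambda>x. g (i x)) \<in> module_hom k D A" "(\<lambda>x. g (S (i x))) \<in> module_hom k D A"
    if "g \<in> module_hom k H A" "i \<in> coalg_hom k D H" for g i
    using that Sl by (auto intro: module_hom_comp coalg_hom_linear)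
  have conv_comp: "conv k D A (\<lambda>x. g (u (i x))) (\<lambda>x. g (v (i x))) x = g (conv k H H u v (i x))"
    if g: "g \<in> ring_hom H A" "g \<in> module_hom k H A" and i: "i \<in> coalg_hom k D H"
      and u: "u \<in> module_hom k H H" and v: "v \<in> module_hom k H H" and x: "x \<in> carrier D"
    for g i u v x
  proof -
    have ix: "i x \<in> carrier H" by (rule module_hom_closed[OF coalg_hom_linear[OF i] x])
    have "g (conv k H H u v (i x)) = conv k H A (\<lambda>x. g (u x)) (\<lambda>x. g (v x)) (i x)"
      by (rule conv_post[OF H(2,1) u v M g(2) _ b ix]) (rule ring_hom_mult[OF g(1)])
    also have "\<dots> = conv k D A (\<lambda>x. g (u (i x))) (\<lambda>x. g (v (i x))) x"
      by (rule conv_coalg_hom[OF H(2) A module_hom_comp[OF u g(2)] module_hom_comp[OF v g(2)] i D x])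
    finally show ?thesis by simp
  qed
  have unit: "g (counit H (i x) \<odot>\<^bsub>H\<^esub> \<one>\<^bsub>H\<^esub>) = counit D x \<odot>\<^bsub>A\<^esub> \<one>\<^bsub>A\<^esub>"
    if "g \<in> ring_hom H A" "g \<in> module_hom k H A" "i \<in> coalg_hom k D H" "x \<in> carrier D" for g i x
    using that counit_closed[OF D]
    by (simp add: coalg_hom_def module_hom_smult[of g k H A] ring_hom_one)
  show ?thesis
  proof (rule conv_inverse_unique[OF D A lin(2)[OF g(2) i(1)] lin(1)[OF g(2) i(1)] lin(2)[OF g(4) i(2)] _ _ x])
    fix x assume x: "x \<in> carrier D"
    then have ix: "i x \<in> carrier H" "i' x \<in> carrier H"
      by (auto intro: module_hom_closed[OF coalg_hom_linear] i)
    show "conv k D A (\<lambda>x. g (S (i x))) (\<lambda>x. g (i x)) x = counit D x \<odot>\<^bsub>A\<^esub> \<one>\<^bsub>A\<^esub>"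
      using conv_comp[OF g(1,2) i(1) Sl module_hom_id x] antipode_left[OF S ix(1)]
        unit[OF g(1,2) i(1) x] by simp
    have "conv k D A (\<lambda>x. g (i x)) (\<lambda>x. g' (S (i' x))) x =
        conv k D A (\<lambda>x. g' (i' x)) (\<lambda>x. g' (S (i' x))) x"
      by (rule conv_cong[OF D A lin(1)[OF g(2) i(1)] lin(2)[OF g(4) i(2)] lin(1)[OF g(4) i(2)]
            lin(2)[OF g(4) i(2)] eq _ x]) simp_all
    then show "conv k D A (\<lambda>x. g (i x)) (\<lambda>x. g' (S (i' x))) x = counit D x \<odot>\<^bsub>A\<^esub> \<one>\<^bsub>A\<^esub>"
      using conv_comp[OF g(3,4) i(2) module_hom_id Sl x] antipode_right[OF S ix(2)]
        unit[OF g(3,4) i(2) x] by simp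
  qed
qed

context
  fixes k :: "('a, 'r) ring_scheme" and H :: "('a, 'b) bialg" and S :: "'b \<Rightarrow> 'b"
  assumes H: "bialgebra k H" and S: "antipode k H S"
begin

interpretation H: k_algebra k H by (rule bialgebra_is_k_algebra[OF H])

private lemmas A = bialgebra_is_k_algebra[OF H]
private lemmas C = bialgebra_is_coalgebra[OF H]
private lemmas M = H.module_axioms
private lemmas b = k_algebra_bilinear[OF A]
private lemmas Sl = antipode_linear[OF S]
private lemmas Sc = module_hom_closed[OF Sl]
private lemmas ec = counit_closed[OF C]

text \<open>By this equation \<open>F\<close> is determined by its convolution product with the identity.\<close>

lemma antipode_cancel:
  assumes F: "F \<in> module_hom k H H" and x: "x \<in> carrier H"
  shows "F x = conv k H H (conv k H H F (\<lambda>x. x)) S x"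
proof -
  have "F x = conv k H H F (conv k H H (\<lambda>x. x) S) x"
    using conv_cong[OF C A F conv_one_hom[OF C A] F conv_hom[OF C A module_hom_id Sl] _ _ x]
    by (simp add: antipode_right[OF S] conv_one_right[OF C A F x])
  then show ?thesis by (simp add: conv_assoc[OF C A F module_hom_id Sl x])
qed

text \<open>Both sides are linear in \<open>y\<close>. Convolved on the right with the identity, as functions of \<open>y\<close>, they
  become \<open>\<Sum> S(x\<^sub>1 y\<^sub>1) x\<^sub>2 y\<^sub>2 = \<epsilon>(x y) 1\<close> and \<open>\<epsilon>(x) \<epsilon>(y) 1\<close>, and the identity may be
  cancelled. Together with the next lemma this replaces an argument in the convolution algebra of
  \<open>H \<otimes> H\<close> by two arguments in that of \<open>H\<close>.\<close>

lemma antipode_mult_aux: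
  assumes x: "x \<in> carrier H" and y: "y \<in> carrier H"
  shows "sweedler k H H (\<lambda>a b. S (a \<otimes>\<^bsub>H\<^esub> y) \<otimes>\<^bsub>H\<^esub> b) x = counit H x \<odot>\<^bsub>H\<^esub> S y"
proof -
  define G where "G = (\<lambda>y. sweedler k H H (\<lambda>a b. S (a \<otimes>\<^bsub>H\<^esub> y) \<otimes>\<^bsub>H\<^esub> b) x)"
  have bin: "bilinear_map k H H H (\<lambda>a b. S (a \<otimes>\<^bsub>H\<^esub> y) \<otimes>\<^bsub>H\<^esub> b)" if "y \<in> carrier H" for y
    by (rule bilinear_map_comp[OF b module_hom_comp[OF bilinear_map_left[OF b that] Sl] module_hom_id])
  have lin: "(\<lambda>y. S (a \<otimes>\<^bsub>H\<^esub> y) \<otimes>\<^bsub>H\<^esub> b) \<in> module_hom k H H" if "a \<in> carrier H" "b \<in> carrier H" for a b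
    by (rule module_hom_comp[OF module_hom_comp[OF bilinear_map_right[OF b that(1)] Sl]
          bilinear_map_left[OF b that(2)]])
  have G: "G \<in> module_hom k H H" unfolding G_def
    by (rule tensor_lift_param_hom[OF M M M M comult_closed[OF C x] bin lin])
  let ?f = "\<lambda>c d a b. S (a \<otimes>\<^bsub>H\<^esub> c) \<otimes>\<^bsub>H\<^esub> (b \<otimes>\<^bsub>H\<^esub> d)"
  have b1: "bilinear_map k H H H (?f c d)" if "c \<in> carrier H" "d \<in> carrier H" for c d
    by (rule bilinear_map_comp[OF b module_hom_comp[OF bilinear_map_left[OF b that(1)] Sl]
          bilinear_map_left[OF b that(2)]])
  have b2: "bilinear_map k H H H (\<lambda>c d. ?f c d a b)" if "a \<in> carrier H" "b \<in> carrier H" for a b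
    by (rule bilinear_map_comp[OF b module_hom_comp[OF bilinear_map_right[OF b that(1)] Sl]
          bilinear_map_right[OF b that(2)]])
  have SI: "bilinear_map k H H H (\<lambda>u v. S u \<otimes>\<^bsub>H\<^esub> v)"
    by (rule bilinear_map_comp[OF b Sl module_hom_id])
  have Gid: "conv k H H G (\<lambda>x. x) y = counit H x \<odot>\<^bsub>H\<^esub> (counit H y \<odot>\<^bsub>H\<^esub> \<one>\<^bsub>H\<^esub>)"
    if y: "y \<in> carrier H" for y
  proof -
    have "conv k H H G (\<lambda>x. x) y = sweedler k H H (\<lambda>c d. sweedler k H H (?f c d) x) y"
      unfolding conv_def
    proof (rule sweedler_cong[OF C M bilinear_map_comp[OF b G module_hom_id]
          tensor_lift_param_bilinear[OF M M M M M comult_closed[OF C x] b1 b2] _ y])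
      fix c d assume cd: "c \<in> carrier H" "d \<in> carrier H"
      show "G c \<otimes>\<^bsub>H\<^esub> d = sweedler k H H (?f c d) x"
        unfolding G_def sweedler_post[OF C M M bin[OF cd(1)] bilinear_map_left[OF b cd(2)] x]
        by (rule sweedler_cong[OF C M bilinear_map_post[OF bin[OF cd(1)] bilinear_map_left[OF b cd(2)]]
              b1[OF cd] _ x]) (simp add: Sc cd H.m_assoc)
    qed
    also have "\<dots> = sweedler k H H (\<lambda>a b. sweedler k H H (\<lambda>c d. ?f c d a b) y) x"
      by (rule tensor_lift_swap[OF M M M M M comult_closed[OF C y] comult_closed[OF C x] b1 b2])
    also have "\<dots> = sweedler k H H (\<lambda>u v. S u \<otimes>\<^bsub>H\<^esub> v) (x \<otimes>\<^bsub>H\<^esub> y)"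
      by (rule sweedler_mult[OF H M SI x y, symmetric])
    also have "\<dots> = counit H (x \<otimes>\<^bsub>H\<^esub> y) \<odot>\<^bsub>H\<^esub> \<one>\<^bsub>H\<^esub>"
      using antipode_left[OF S, of "x \<otimes>\<^bsub>H\<^esub> y"] x y by (simp add: conv_def)
    also have "\<dots> = counit H x \<odot>\<^bsub>H\<^esub> (counit H y \<odot>\<^bsub>H\<^esub> \<one>\<^bsub>H\<^esub>)"
      by (simp add: counit_mult[OF H x y] ec x y H.smult_assoc1)
    finally show ?thesis .
  qed
  have e: "(\<lambda>z. counit H x \<odot>\<^bsub>H\<^esub> u z) \<in> module_hom k H H" if "u \<in> module_hom k H H" for u
    by (rule module_hom_comp[OF that bilinear_map_right[OF smult_bilinear[OF M]]])
      (simp add: self_module_def ec x)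
  have "G y = conv k H H (\<lambda>y. counit H x \<odot>\<^bsub>H\<^esub> (counit H y \<odot>\<^bsub>H\<^esub> \<one>\<^bsub>H\<^esub>)) S y"
    unfolding antipode_cancel[OF G y]
    by (rule conv_cong[OF C A conv_hom[OF C A G module_hom_id] Sl e[OF conv_one_hom[OF C A]] Sl Gid _ y]) simp_all
  also have "\<dots> = sweedler k H H (\<lambda>a b. counit H a \<odot>\<^bsub>H\<^esub> (counit H x \<odot>\<^bsub>H\<^esub> S b)) y"
    unfolding conv_def
    by (rule sweedler_cong[OF C M conv_bilinear[OF C A e[OF conv_one_hom[OF C A]] Sl]
          counit_smult_bilinear(1)[OF C M e[OF Sl]] _ y])
      (simp add: H.smult_mult_left ec x Sc H.smult_assoc1[symmetric] H.R.m_comm)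
  also have "\<dots> = counit H x \<odot>\<^bsub>H\<^esub> S y"
    by (rule sweedler_counit(1)[OF C M e[OF Sl] y])
  finally show ?thesis by (simp add: G_def)
qed

text \<open>\<open>S(x y) = \<Sum> S(x\<^sub>1 y) x\<^sub>2 S(x\<^sub>3) = \<Sum> \<epsilon>(x\<^sub>1) S(y) S(x\<^sub>2) = S(y) S(x)\<close>.\<close>

lemma antipode_mult:
  assumes x: "x \<in> carrier H" and y: "y \<in> carrier H"
  shows "S (x \<otimes>\<^bsub>H\<^esub> y) = S y \<otimes>\<^bsub>H\<^esub> S x"
proof -
  let ?F = "\<lambda>x. S (x \<otimes>\<^bsub>H\<^esub> y)"
  have F: "?F \<in> module_hom k H H" by (rule module_hom_comp[OF bilinear_map_left[OF b y] Sl])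
  have e: "(\<lambda>x. counit H x \<odot>\<^bsub>H\<^esub> S y) \<in> module_hom k H H"
    by (rule module_hom_comp[OF counit_hom[OF C] bilinear_map_left[OF smult_bilinear[OF M] Sc[OF y]]])
  have u: "(\<lambda>z. S y \<otimes>\<^bsub>H\<^esub> S z) \<in> module_hom k H H"
    by (rule module_hom_comp[OF Sl bilinear_map_right[OF b Sc[OF y]]])
  have "S (x \<otimes>\<^bsub>H\<^esub> y) = conv k H H (\<lambda>x. counit H x \<odot>\<^bsub>H\<^esub> S y) S x"
    unfolding antipode_cancel[OF F x]
    by (rule conv_cong[OF C A conv_hom[OF C A F module_hom_id] Sl e Sl _ _ x])
      (simp_all add: conv_def[of k H H ?F] antipode_mult_aux y)
  also have "\<dots> = sweedler k H H (\<lambda>a b. counit H a \<odot>\<^bsub>H\<^esub> (S y \<otimes>\<^bsub>H\<^esub> S b)) x"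
    unfolding conv_def
    by (rule sweedler_cong[OF C M conv_bilinear[OF C A e Sl] counit_smult_bilinear(1)[OF C M u] _ x])
      (simp add: H.smult_mult_left ec Sc y)
  also have "\<dots> = S y \<otimes>\<^bsub>H\<^esub> S x" by (rule sweedler_counit(1)[OF C M u x])
  finally show ?thesis .
qed

text \<open>As maps into the algebra \<open>H \<otimes> H\<close>, both sides are convolution inverses of the comultiplication:
  the left one because comultiplication is multiplicative, the right one because
  \<open>\<Sum> x\<^sub>1 S(x\<^sub>4) \<otimes> x\<^sub>2 S(x\<^sub>3)\<close> collapses from the inside.\<close>

lemma antipode_comult:
  assumes x: "x \<in> carrier H"
  shows "comult H (S x) = sweedler k (tensor k H H) H (\<lambda>a b. pure_tensor k H H (S b) (S a)) x"
proof -
  let ?T = "tensor k H H" and ?A = "tensor_algebra k H H" and ?p = "pure_tensor k H H"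
  note TA = tensor_algebra_is_k_algebra[OF A A]
  interpret T: k_algebra k ?A by (rule TA)
  note T = tensor_is_module[OF M M]
  note pb = pure_tensor_bilinear[OF M M] and pc = pure_tensor_closed[OF M M]
  note mb = tensor_algebra_mult_bilinear[OF A A]
  note D = comult_hom[OF C]
  have lift_eq: "tensor_lift k ?A = tensor_lift k ?T"
    by (simp add: fun_eq_iff tensor_lift_def finsum_def tensor_algebra_simps)
  define h where "h = sweedler k ?T H (\<lambda>a b. ?p (S b) (S a))"
  have hb: "bilinear_map k H H ?T (\<lambda>a b. ?p (S b) (S a))"
    by (rule bilinear_map_flip[OF bilinear_map_comp[OF pb Sl Sl]])
  have h: "h \<in> module_hom k H ?T" unfolding h_def by (rule sweedler_hom[OF C T hb])
  have D1: "comult H (counit H x \<odot>\<^bsub>H\<^esub> \<one>\<^bsub>H\<^esub>) = counit H x \<odot>\<^bsub>?A\<^esub> \<one>\<^bsub>?A\<^esub>" if "x \<in> carrier H" for x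
    by (simp add: module_hom_smult[OF D] ec that comult_one[OF H] tensor_algebra_simps)
  have left: "conv k H ?A (\<lambda>x. comult H (S x)) (comult H) x = counit H x \<odot>\<^bsub>?A\<^esub> \<one>\<^bsub>?A\<^esub>"
    if x: "x \<in> carrier H" for x
    using conv_post[OF C A Sl module_hom_id T.module_axioms, of "comult H" x] D x
    by (simp add: module_hom_tensor_algebra_iff comult_mult[OF H] k_algebra_bilinear[OF TA]
        antipode_left[OF S x] D1)
  \<comment> \<open>With \<open>\<Delta>(d) = \<Sum> u \<otimes> v\<close>, the sum \<open>\<Psi>(a, c, d)\<close> is the product of \<open>a \<otimes> c\<close> with \<open>h d\<close>.\<close>
  let ?\<Phi> = "\<lambda>a c u v. ?p (a \<otimes>\<^bsub>H\<^esub> S v) (c \<otimes>\<^bsub>H\<^esub> S u)"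
  let ?\<Psi> = "\<lambda>a c d. sweedler k ?T H (\<lambda>u v. ?\<Phi> a c u v) d"
  have R: "(\<lambda>z. c \<otimes>\<^bsub>H\<^esub> S z) \<in> module_hom k H H" if "c \<in> carrier H" for c
    by (rule module_hom_comp[OF Sl bilinear_map_right[OF b that]])
  have \<Phi>uv: "bilinear_map k H H ?T (?\<Phi> a c)" if "a \<in> carrier H" "c \<in> carrier H" for a c
    by (rule bilinear_map_flip[OF bilinear_map_comp[OF pb R[OF that(1)] R[OF that(2)]]])
  have \<Phi>ac: "bilinear_map k H H ?T (\<lambda>a c. ?\<Phi> a c u v)" if "u \<in> carrier H" "v \<in> carrier H" for u v
    by (rule bilinear_map_comp[OF pb bilinear_map_left[OF b Sc[OF that(2)]] bilinear_map_left[OF b Sc[OF that(1)]]])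
  have \<Phi>tri: "trilinear_map k H H H ?T (?\<Phi> a)" if "a \<in> carrier H" for a
    using that by (simp add: trilinear_map_def \<Phi>uv bilinear_map_right[OF \<Phi>ac])
  have \<Psi>ac: "bilinear_map k H H ?T (\<lambda>a c. ?\<Psi> a c d)" if "d \<in> carrier H" for d
    by (rule tensor_lift_param_bilinear[OF M M T M M comult_closed[OF C that] \<Phi>uv \<Phi>ac])
  have \<Psi>tri: "trilinear_map k H H H ?T ?\<Psi>"
    unfolding trilinear_map_def
    by (auto intro!: bilinear_mapI sweedler_hom[OF C T] \<Phi>uv bilinear_map_left[OF \<Psi>ac]
        bilinear_map_right[OF \<Psi>ac])
  have prod: "comult H a \<otimes>\<^bsub>?A\<^esub> h d = sweedler k ?T H (\<lambda>u v. ?\<Psi> u v d) a"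
    if ad: "a \<in> carrier H" "d \<in> carrier H" for a d
  proof -
    note hd = module_hom_closed[OF h ad(2)]
    have "comult H a \<otimes>\<^bsub>?A\<^esub> h d = sweedler k ?T H ?p a \<otimes>\<^bsub>?A\<^esub> h d"
      by (simp add: tensor_lift_pure_id[OF M M comult_closed[OF C ad(1)]])
    also have "\<dots> = sweedler k ?T H (\<lambda>u v. ?p u v \<otimes>\<^bsub>?A\<^esub> h d) a"
      by (rule sweedler_post[OF C T T pb bilinear_map_left[OF mb hd] ad(1)])
    also have "\<dots> = sweedler k ?T H (\<lambda>u v. ?\<Psi> u v d) a"
    proof (rule sweedler_cong[OF C T bilinear_map_post[OF pb bilinear_map_left[OF mb hd]] \<Psi>ac[OF ad(2)] _ ad(1)])
      fix u v assume uv: "u \<in> carrier H" "v \<in> carrier H"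
      show "?p u v \<otimes>\<^bsub>?A\<^esub> h d = ?\<Psi> u v d"
        unfolding h_def sweedler_post[OF C T T hb bilinear_map_right[OF mb pc[OF uv]] ad(2)]
        by (rule sweedler_cong[OF C T bilinear_map_post[OF hb bilinear_map_right[OF mb pc[OF uv]]] \<Phi>uv[OF uv] _ ad(2)])
          (simp add: tensor_algebra_mult_pure[OF A A] uv Sc)
    qed
    finally show ?thesis .
  qed
  have collapse: "sweedler k ?T H (\<lambda>c d. ?\<Psi> a c d) d = ?p (a \<otimes>\<^bsub>H\<^esub> S d) \<one>\<^bsub>H\<^esub>"
    if ad: "a \<in> carrier H" "d \<in> carrier H" for a d
  proof -
    have u: "(\<lambda>v. ?p (a \<otimes>\<^bsub>H\<^esub> S v) \<one>\<^bsub>H\<^esub>) \<in> module_hom k H ?T"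
      by (rule module_hom_comp[OF R[OF ad(1)] bilinear_map_left[OF pb H.one_closed]])
    have "sweedler k ?T H (\<lambda>c d. ?\<Psi> a c d) d =
        sweedler k ?T H (\<lambda>e v. sweedler k ?T H (\<lambda>c u. ?\<Phi> a c u v) e) d"
      by (rule sweedler_coassoc[OF C T \<Phi>tri[OF ad(1)] ad(2), symmetric])
    also have "\<dots> = sweedler k ?T H (\<lambda>e v. counit H e \<odot>\<^bsub>?T\<^esub> ?p (a \<otimes>\<^bsub>H\<^esub> S v) \<one>\<^bsub>H\<^esub>) d"
    proof (rule sweedler_cong[OF C T trilinear_sweedler_bilinear(2)[OF C C T \<Phi>tri[OF ad(1)]]
          counit_smult_bilinear(1)[OF C T u] _ ad(2)])
      fix e v assume ev: "e \<in> carrier H" "v \<in> carrier H"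
      have av: "a \<otimes>\<^bsub>H\<^esub> S v \<in> carrier H" using ad ev Sc by simp
      have "sweedler k ?T H (\<lambda>c u. ?\<Phi> a c u v) e = ?p (a \<otimes>\<^bsub>H\<^esub> S v) (conv k H H (\<lambda>x. x) S e)"
        unfolding conv_def
        by (rule sweedler_post[OF C M T conv_bilinear[OF C A module_hom_id Sl]
              bilinear_map_right[OF pb av] ev(1), symmetric])
      then show "sweedler k ?T H (\<lambda>c u. ?\<Phi> a c u v) e = counit H e \<odot>\<^bsub>?T\<^esub> ?p (a \<otimes>\<^bsub>H\<^esub> S v) \<one>\<^bsub>H\<^esub>"
        by (simp add: antipode_right[OF S ev(1)] module_hom_smult[OF bilinear_map_right[OF pb av]] ec ev)
    qed
    also have "\<dots> = ?p (a \<otimes>\<^bsub>H\<^esub> S d) \<one>\<^bsub>H\<^esub>" by (rule sweedler_counit(1)[OF C T u ad(2)])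
    finally show ?thesis .
  qed
  have right: "conv k H ?A (comult H) h x = counit H x \<odot>\<^bsub>?A\<^esub> \<one>\<^bsub>?A\<^esub>" if x: "x \<in> carrier H" for x
  proof -
    note b1 = trilinear_sweedler_bilinear[OF C C T \<Psi>tri]
    have bp1: "bilinear_map k H H ?T (\<lambda>a d. ?p (a \<otimes>\<^bsub>H\<^esub> S d) \<one>\<^bsub>H\<^esub>)"
      by (rule bilinear_map_post[OF conv_bilinear[OF C A module_hom_id Sl]
            bilinear_map_left[OF pb H.one_closed]])
    have "conv k H ?A (comult H) h x = sweedler k ?T H (\<lambda>a d. comult H a \<otimes>\<^bsub>?A\<^esub> h d) x"
      by (simp add: conv_def lift_eq)
    also have "\<dots> = sweedler k ?T H (\<lambda>a d. sweedler k ?T H (\<lambda>u v. ?\<Psi> u v d) a) x"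
      by (rule sweedler_cong[OF C T bilinear_map_comp[OF mb D h] b1(2) prod x])
    also have "\<dots> = sweedler k ?T H (\<lambda>a d. sweedler k ?T H (\<lambda>u v. ?\<Psi> a u v) d) x"
      by (rule sweedler_coassoc[OF C T \<Psi>tri x])
    also have "\<dots> = sweedler k ?T H (\<lambda>a d. ?p (a \<otimes>\<^bsub>H\<^esub> S d) \<one>\<^bsub>H\<^esub>) x"
      by (rule sweedler_cong[OF C T b1(1) bp1 collapse x])
    also have "\<dots> = ?p (conv k H H (\<lambda>x. x) S x) \<one>\<^bsub>H\<^esub>"
      unfolding conv_def
      by (rule sweedler_post[OF C M T conv_bilinear[OF C A module_hom_id Sl]
            bilinear_map_left[OF pb H.one_closed] x, symmetric])
    also have "\<dots> = counit H x \<odot>\<^bsub>?A\<^esub> \<one>\<^bsub>?A\<^esub>"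
      by (simp add: antipode_right[OF S x] module_hom_smult[OF bilinear_map_left[OF pb]] ec x
          tensor_algebra_simps)
    finally show ?thesis .
  qed
  have homs: "(\<lambda>x. comult H (S x)) \<in> module_hom k H ?A" "comult H \<in> module_hom k H ?A"
    "h \<in> module_hom k H ?A"
    using D h module_hom_comp[OF Sl D] by (simp_all add: module_hom_tensor_algebra_iff)
  have "comult H (S x) = h x"
    by (rule conv_inverse_unique[OF C TA homs left right x])
  then show ?thesis by (simp add: h_def)
qed

end


section \<open>Opposite multiplication\<close>

text \<open>The inverse of a bijective antipode becomes an antipode when the multiplication is reversed. It is
  the convolution with values in \<open>opp A\<close>, over an unchanged coalgebra, that is relevant.\<close>

definition opp :: "('a, 'm, 's) module_scheme \<Rightarrow> ('a, 'm, 's) module_scheme" where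
  "opp A = A\<lparr>mult := \<lambda>x y. y \<otimes>\<^bsub>A\<^esub> x\<rparr>"

lemma opp_simps [simp]:
  "carrier (opp A) = carrier A" "add (opp A) = add A" "zero (opp A) = zero A"
  "smult (opp A) = smult A" "\<one>\<^bsub>opp A\<^esub> = \<one>\<^bsub>A\<^esub>" "mult (opp A) = (\<lambda>x y. y \<otimes>\<^bsub>A\<^esub> x)"
  by (simp_all add: opp_def)

lemma opp_bialg_simps [simp]:
  "comult (opp B) = comult B" "counit (opp B) = counit B"
  by (simp_all add: opp_def)

text \<open>Tensor products see only the linear structure, so they do not change when a multiplication is
  reversed.\<close>

lemma tensor_cong:
  assumes "carrier M = carrier M'" "add M = add M'" "smult M = smult M'"
    and "carrier N = carrier N'" "add N = add N'" "smult N = smult N'"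
  shows "tensor k M N = tensor k M' N'" "pure_tensor k M N = pure_tensor k M' N'"
  using assms by (simp_all add: tensor_def pure_tensor_def tensor_rel_def tensor_relators_def fun_eq_iff)

lemma tensor_lift_target_cong:
  assumes "carrier P = carrier P'" "add P = add P'" "smult P = smult P'" "zero P = zero P'"
  shows "tensor_lift k P = tensor_lift k P'"
  by (intro ext) (simp add: assms tensor_lift_def Let_def finsum_def finprod_def)

lemma module_hom_cong_modules:
  assumes "carrier M = carrier M'" "add M = add M'" "smult M = smult M'"
    and "carrier N = carrier N'" "add N = add N'" "smult N = smult N'"
  shows "module_hom k M N = module_hom k M' N'"
  using assms by (simp add: module_hom_def)

lemma opp_k_algebra:
  assumes "k_algebra k A"
  shows "k_algebra k (opp A)"
proof -
  interpret A: k_algebra k A by fact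
  show ?thesis
  proof (rule k_algebraI)
    show "module k (opp A)" by (rule module_transfer[OF A.module_axioms]) simp_all
    have "module_hom k (opp A) (opp A) = module_hom k A A"
      by (rule module_hom_cong_modules) simp_all
    then show "bilinear_map k (opp A) (opp A) (opp A) (mult (opp A))"
      using bilinear_map_flip[OF k_algebra_bilinear[OF assms]] by (simp add: bilinear_map_def)
  qed (simp_all add: A.m_assoc)
qed

lemma opp_coalgebra:
  assumes C: "coalgebra k C"
  shows "coalgebra k (opp C)"
proof -
  have m: "module k (opp C)" by (rule module_transfer[OF coalgebra_is_module[OF C]]) simp_all
  have T: "tensor k (opp C) (opp C) = tensor k C C" "pure_tensor k (opp C) (opp C) = pure_tensor k C C"
    by (rule tensor_cong; simp)+
  have T2: "tensor k (opp C) Q = tensor k C Q" "pure_tensor k (opp C) Q = pure_tensor k C Q"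
    for Q :: "('a, 'x) module"
    by (rule tensor_cong; simp)+
  have T3: "tensor k (tensor k C C) (opp C) = tensor k (tensor k C C) C"
    "pure_tensor k (tensor k C C) (opp C) = pure_tensor k (tensor k C C) C"
    by (rule tensor_cong; simp)+
  have h: "module_hom k (opp C) Q = module_hom k C Q" for Q :: "('a, 'x) module"
    by (rule module_hom_cong_modules) simp_all
  have l: "tensor_lift k (opp C) = tensor_lift k C" by (rule tensor_lift_target_cong) simp_all
  show ?thesis
    using C m by (simp add: coalgebra_def tensor_assoc_def tensor_map_def Let_def T T2 T3 h l)
qed

lemma opp_coalg_hom: "coalg_hom k D (opp C) = coalg_hom k D C"
proof -
  have T: "tensor k (opp C) (opp C) = tensor k C C" "pure_tensor k (opp C) (opp C) = pure_tensor k C C"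
    by (rule tensor_cong; simp)+
  have h: "module_hom k D (opp C) = module_hom k D C"
    by (rule module_hom_cong_modules) simp_all
  show ?thesis by (simp add: coalg_hom_def tensor_map_def T h)
qed

lemma opp_hom:
  "g \<in> ring_hom A B \<Longrightarrow> g \<in> ring_hom (opp A) (opp B)"
  "g \<in> module_hom k A B \<Longrightarrow> g \<in> module_hom k (opp A) (opp B)"
  by (auto simp: ring_hom_def module_hom_def)

text \<open>The inverse of \<open>S\<close> reverses products because \<open>S\<close> does; applied to
  \<open>\<Sum> S(x\<^sub>1) x\<^sub>2 = \<epsilon>(x) 1\<close> and its mirror image it yields the two antipode laws for the reversed
  multiplication.\<close>

lemma inverse_antipode:
  assumes H: "bialgebra k H" and S: "antipode k H S" and bij: "bij_betw S (carrier H) (carrier H)"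
  shows "antipode k (opp H) (inv_into (carrier H) S)"
    and "\<And>x y. x \<in> carrier H \<Longrightarrow> y \<in> carrier H \<Longrightarrow> inv_into (carrier H) S (x \<otimes>\<^bsub>H\<^esub> y) =
      inv_into (carrier H) S y \<otimes>\<^bsub>H\<^esub> inv_into (carrier H) S x"
    and "\<And>x. x \<in> carrier H \<Longrightarrow> comult H (inv_into (carrier H) S x) = sweedler k (tensor k H H) H
      (\<lambda>a b. pure_tensor k H H (inv_into (carrier H) S b) (inv_into (carrier H) S a)) x"
proof -
  let ?T = "inv_into (carrier H) S"
  note A = bialgebra_is_k_algebra[OF H] and C = bialgebra_is_coalgebra[OF H]
  interpret H: k_algebra k H by (rule A)
  note M = H.module_axioms
  note Sl = antipode_linear[OF S]
  note Sc = module_hom_closed[OF Sl]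
  have inj: "inj_on S (carrier H)" and im: "S ` carrier H = carrier H"
    using bij by (auto simp: bij_betw_def)
  have Tc: "?T x \<in> carrier H" if "x \<in> carrier H" for x
    using inv_into_into[of x S "carrier H"] that im by simp
  have ST: "S (?T x) = x" if "x \<in> carrier H" for x using f_inv_into_f[of x S "carrier H"] that im by simp
  have TS: "?T (S x) = x" if "x \<in> carrier H" for x using inv_into_f_f[OF inj that] .
  have eqI: "x = y" if "S x = S y" "x \<in> carrier H" "y \<in> carrier H" for x y
    by (rule inj_onD[OF inj that])
  have Tl: "?T \<in> module_hom k H H"
  proof (rule module_homI)
    fix x y assume "x \<in> carrier H" "y \<in> carrier H"
    then show "?T (x \<oplus>\<^bsub>H\<^esub> y) = ?T x \<oplus>\<^bsub>H\<^esub> ?T y"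
      by - (rule eqI, simp_all add: ST Tc module_hom_add[OF Sl])
  next
    fix c x assume "c \<in> carrier k" "x \<in> carrier H"
    then show "?T (c \<odot>\<^bsub>H\<^esub> x) = c \<odot>\<^bsub>H\<^esub> ?T x"
      by - (rule eqI, simp_all add: ST Tc module_hom_smult[OF Sl])
  qed (rule Tc)
  show Tm: "?T (x \<otimes>\<^bsub>H\<^esub> y) = ?T y \<otimes>\<^bsub>H\<^esub> ?T x" if "x \<in> carrier H" "y \<in> carrier H" for x y
    by (rule eqI) (simp_all add: that ST Tc antipode_mult[OF H S])
  have Tone: "?T \<one>\<^bsub>H\<^esub> = \<one>\<^bsub>H\<^esub>"
  proof -
    have "?T \<one>\<^bsub>H\<^esub> = ?T \<one>\<^bsub>H\<^esub> \<otimes>\<^bsub>H\<^esub> ?T (S \<one>\<^bsub>H\<^esub>)" by (simp add: TS Tc)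
    also have "\<dots> = ?T (S \<one>\<^bsub>H\<^esub> \<otimes>\<^bsub>H\<^esub> \<one>\<^bsub>H\<^esub>)" by (rule Tm[symmetric]) (simp_all add: Sc)
    also have "\<dots> = \<one>\<^bsub>H\<^esub>" by (simp add: TS Sc)
    finally show ?thesis .
  qed
  have l: "tensor_lift k (opp H) = tensor_lift k H" by (rule tensor_lift_target_cong) simp_all
  note b = k_algebra_bilinear[OF A]
  note bo = bilinear_map_flip[OF b]
  have unit: "?T (counit H x \<odot>\<^bsub>H\<^esub> \<one>\<^bsub>H\<^esub>) = counit H x \<odot>\<^bsub>H\<^esub> \<one>\<^bsub>H\<^esub>" if "x \<in> carrier H" for x
    using that by (simp add: module_hom_smult[OF Tl] counit_closed[OF C] Tone)
  have 1: "sweedler k H H (\<lambda>a b. b \<otimes>\<^bsub>H\<^esub> ?T a) x = counit H x \<odot>\<^bsub>H\<^esub> \<one>\<^bsub>H\<^esub>" if x: "x \<in> carrier H" for x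
  proof -
    note b1 = conv_bilinear[OF C A module_hom_id Sl]
    have "sweedler k H H (\<lambda>a b. b \<otimes>\<^bsub>H\<^esub> ?T a) x = sweedler k H H (\<lambda>a b. ?T (a \<otimes>\<^bsub>H\<^esub> S b)) x"
      by (rule sweedler_cong[OF C M bilinear_map_comp[OF bo Tl module_hom_id] bilinear_map_post[OF b1 Tl] _ x])
        (simp add: Tm Sc TS)
    also have "\<dots> = ?T (conv k H H (\<lambda>x. x) S x)"
      unfolding conv_def by (rule sweedler_post[OF C M M b1 Tl x, symmetric])
    finally show ?thesis by (simp add: antipode_right[OF S x] unit x)
  qed
  have 2: "sweedler k H H (\<lambda>a b. ?T b \<otimes>\<^bsub>H\<^esub> a) x = counit H x \<odot>\<^bsub>H\<^esub> \<one>\<^bsub>H\<^esub>" if x: "x \<in> carrier H" for x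
  proof -
    note b1 = conv_bilinear[OF C A Sl module_hom_id]
    have "sweedler k H H (\<lambda>a b. ?T b \<otimes>\<^bsub>H\<^esub> a) x = sweedler k H H (\<lambda>a b. ?T (S a \<otimes>\<^bsub>H\<^esub> b)) x"
      by (rule sweedler_cong[OF C M bilinear_map_comp[OF bo module_hom_id Tl] bilinear_map_post[OF b1 Tl] _ x])
        (simp add: Tm Sc TS)
    also have "\<dots> = ?T (conv k H H S (\<lambda>x. x) x)"
      unfolding conv_def by (rule sweedler_post[OF C M M b1 Tl x, symmetric])
    finally show ?thesis by (simp add: antipode_left[OF S x] unit x)
  qed
  show "antipode k (opp H) ?T"
    using opp_hom(2)[OF Tl] 1 2 by (simp add: antipode_def l)
  fix x assume x: "x \<in> carrier H"
  note T = tensor_is_module[OF M M]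
  note pb = pure_tensor_bilinear[OF M M]
  have bT: "bilinear_map k H H (tensor k H H) (\<lambda>a b. pure_tensor k H H (?T b) (?T a))"
    by (rule bilinear_map_flip[OF bilinear_map_comp[OF pb Tl Tl]])
  have bS: "bilinear_map k H H (tensor k H H) (\<lambda>a b. pure_tensor k H H (S b) (S a))"
    by (rule bilinear_map_flip[OF bilinear_map_comp[OF pb Sl Sl]])
  note \<theta> = tensor_lift_hom[OF M M T bT]
  let ?\<theta> = "tensor_lift k (tensor k H H) (\<lambda>a b. pure_tensor k H H (?T b) (?T a))"
  have "?\<theta> (comult H (S (?T x))) =
      sweedler k (tensor k H H) H (\<lambda>a b. ?\<theta> (pure_tensor k H H (S b) (S a))) (?T x)"
    unfolding antipode_comult[OF H S Tc[OF x]] by (rule sweedler_post[OF C T T bS \<theta> Tc[OF x]])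
  also have "\<dots> = sweedler k (tensor k H H) H (pure_tensor k H H) (?T x)"
    by (rule sweedler_cong[OF C T bilinear_map_post[OF bS \<theta>] pb _ Tc[OF x]])
      (simp add: tensor_lift_pure[OF M M T bT] Sc TS)
  also have "\<dots> = comult H (?T x)" by (rule tensor_lift_pure_id[OF M M comult_closed[OF C Tc[OF x]]])
  finally show "comult H (?T x) = ?\<theta> (comult H x)" by (simp add: ST x)
qed


section \<open>Linear retractions onto subspaces\<close>

lemma submodule_zero:
  assumes "submodule N k M"
  shows "\<zero>\<^bsub>M\<^esub> \<in> N"
  using subgroup.one_closed[OF submodule.axioms(1)[OF assms]] by simp

text \<open>The field enters only here. A complement of \<open>N\<close> is a maximal subspace \<open>C\<close> meeting \<open>N\<close> trivially: if
  \<open>x\<close> were outside \<open>N + C\<close>, then \<open>C + k x\<close> would still meet \<open>N\<close> trivially, as one can divide by a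
  nonzero coefficient of \<open>x\<close>.\<close>

lemma ex_linear_retraction:
  assumes k: "field k" and M: "module k M" and N: "submodule N k M"
  shows "\<exists>q\<in>module_hom k M M. (\<forall>x\<in>carrier M. q x \<in> N) \<and> (\<forall>x\<in>N. q x = x)"
proof -
  interpret k: field k by (rule k)
  interpret M: module k M by (rule M)
  note Ns = M.submoduleE[OF N]
  define \<A> where "\<A> = {C. submodule C k M \<and> C \<inter> N = {\<zero>\<^bsub>M\<^esub>}}"
  have "submodule {\<zero>\<^bsub>M\<^esub>} k M" by (rule M.submoduleI) auto
  then have "{\<zero>\<^bsub>M\<^esub>} \<in> \<A>" using submodule_zero[OF N] by (simp add: \<A>_def)
  moreover have "\<Union>\<C> \<in> \<A>" if ne: "\<C> \<noteq> {}" and ch: "subset.chain \<A> \<C>" for \<C>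
  proof -
    have sub: "submodule C k M" and int: "C \<inter> N = {\<zero>\<^bsub>M\<^esub>}" if "C \<in> \<C>" for C
      using that ch by (auto simp: subset.chain_def \<A>_def)
    note Cs = M.submoduleE[OF sub]
    have "submodule (\<Union>\<C>) k M"
    proof (rule M.submoduleI)
      fix x y assume "x \<in> \<Union>\<C>" "y \<in> \<Union>\<C>"
      then obtain C D where CD: "C \<in> \<C>" "x \<in> C" "D \<in> \<C>" "y \<in> D" by auto
      then consider "C \<subseteq> D" | "D \<subseteq> C" using ch by (auto simp: subset.chain_def)
      then show "x \<oplus>\<^bsub>M\<^esub> y \<in> \<Union>\<C>" using CD Cs(5) by cases blast+
    next
      obtain C where "C \<in> \<C>" using ne by auto
      then show "\<zero>\<^bsub>M\<^esub> \<in> \<Union>\<C>" using submodule_zero[OF sub] by auto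
    qed (use Cs(1,3,4) in blast)+
    moreover have "\<Union>\<C> \<inter> N = {\<zero>\<^bsub>M\<^esub>}" using int ne by blast
    ultimately show ?thesis by (simp add: \<A>_def)
  qed
  ultimately obtain C where C: "C \<in> \<A>" and max: "\<And>X. X \<in> \<A> \<Longrightarrow> C \<subseteq> X \<Longrightarrow> X = C"
    using subset_Zorn_nonempty[of \<A>] by blast
  have Csub: "submodule C k M" and CN: "C \<inter> N = {\<zero>\<^bsub>M\<^esub>}" using C by (auto simp: \<A>_def)
  note Cs = M.submoduleE[OF Csub]
  have inC: "x \<in> carrier M" if "x \<in> C" for x using that Cs(1) by auto
  have inN: "x \<in> carrier M" if "x \<in> N" for x using that Ns(1) by auto
  have ex: "\<exists>n\<in>N. x \<ominus>\<^bsub>M\<^esub> n \<in> C" if x: "x \<in> carrier M" for x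
  proof (rule ccontr)
    assume neg: "\<not> ?thesis"
    \<comment> \<open>\<open>C + k x\<close> would be a larger subspace with trivial intersection.\<close>
    define D where "D = {c \<oplus>\<^bsub>M\<^esub> a \<odot>\<^bsub>M\<^esub> x | c a. c \<in> C \<and> a \<in> carrier k}"
    have Dsub: "submodule D k M"
    proof (rule M.submoduleI)
      show "D \<subseteq> carrier M" using inC x by (auto simp: D_def)
      show "\<zero>\<^bsub>M\<^esub> \<in> D" unfolding D_def
        using submodule_zero[OF Csub] x by (auto intro!: exI[of _ "\<zero>\<^bsub>M\<^esub>"] exI[of _ "\<zero>\<^bsub>k\<^esub>"])
    next
      fix u v assume "u \<in> D" "v \<in> D"
      then obtain c a d b where u: "u = c \<oplus>\<^bsub>M\<^esub> a \<odot>\<^bsub>M\<^esub> x" "c \<in> C" "a \<in> carrier k"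
        and v: "v = d \<oplus>\<^bsub>M\<^esub> b \<odot>\<^bsub>M\<^esub> x" "d \<in> C" "b \<in> carrier k" by (auto simp: D_def)
      have "u \<oplus>\<^bsub>M\<^esub> v = (c \<oplus>\<^bsub>M\<^esub> d) \<oplus>\<^bsub>M\<^esub> (a \<oplus>\<^bsub>k\<^esub> b) \<odot>\<^bsub>M\<^esub> x"
        using u v x inC by (simp add: M.smult_l_distr M.add.m_ac)
      then show "u \<oplus>\<^bsub>M\<^esub> v \<in> D" using u v Cs(5) unfolding D_def by blast
    next
      fix r u assume r: "r \<in> carrier k" and "u \<in> D"
      then obtain c a where u: "u = c \<oplus>\<^bsub>M\<^esub> a \<odot>\<^bsub>M\<^esub> x" "c \<in> C" "a \<in> carrier k" by (auto simp: D_def)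
      have "r \<odot>\<^bsub>M\<^esub> u = r \<odot>\<^bsub>M\<^esub> c \<oplus>\<^bsub>M\<^esub> (r \<otimes>\<^bsub>k\<^esub> a) \<odot>\<^bsub>M\<^esub> x"
        using u r x inC by (simp add: M.smult_r_distr M.smult_assoc1)
      then show "r \<odot>\<^bsub>M\<^esub> u \<in> D" using u r Cs(4) unfolding D_def by blast
    next
      fix u assume "u \<in> D"
      then obtain c a where u: "u = c \<oplus>\<^bsub>M\<^esub> a \<odot>\<^bsub>M\<^esub> x" "c \<in> C" "a \<in> carrier k" by (auto simp: D_def)
      show "\<ominus>\<^bsub>M\<^esub> u \<in> D"
      proof -
        have "\<ominus>\<^bsub>M\<^esub> u = \<ominus>\<^bsub>M\<^esub> c \<oplus>\<^bsub>M\<^esub> (\<ominus>\<^bsub>k\<^esub> a) \<odot>\<^bsub>M\<^esub> x"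
          using u x inC by (simp add: M.minus_add M.smult_l_minus)
        then show ?thesis using u Cs(3) unfolding D_def by blast
      qed
    qed
    have "D \<inter> N = {\<zero>\<^bsub>M\<^esub>}"
    proof
      show "{\<zero>\<^bsub>M\<^esub>} \<subseteq> D \<inter> N" using submodule_zero[OF Dsub] submodule_zero[OF N] by simp
      show "D \<inter> N \<subseteq> {\<zero>\<^bsub>M\<^esub>}"
      proof
        fix n assume "n \<in> D \<inter> N"
        then obtain c a where n: "n = c \<oplus>\<^bsub>M\<^esub> a \<odot>\<^bsub>M\<^esub> x" "c \<in> C" "a \<in> carrier k" "n \<in> N"
          by (auto simp: D_def)
        show "n \<in> {\<zero>\<^bsub>M\<^esub>}"
        proof (cases "a = \<zero>\<^bsub>k\<^esub>")
          case True
          then have "n = c" using n inC x by simp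
          then show ?thesis using n CN by auto
        next
          case False
          then have a: "a \<in> Units k" using n(3) k.field_Units by simp
          let ?b = "inv\<^bsub>k\<^esub> a"
          have b: "?b \<in> carrier k" "?b \<otimes>\<^bsub>k\<^esub> a = \<one>\<^bsub>k\<^esub>" using a by simp_all
          have nM: "n \<in> carrier M" by (rule inN[OF n(4)])
          have "?b \<odot>\<^bsub>M\<^esub> n = ?b \<odot>\<^bsub>M\<^esub> c \<oplus>\<^bsub>M\<^esub> x"
            using n(1-3) b x inC M.smult_assoc1[of ?b a x] by (simp add: M.smult_r_distr)
          then have "x \<ominus>\<^bsub>M\<^esub> ?b \<odot>\<^bsub>M\<^esub> n = \<ominus>\<^bsub>M\<^esub> (?b \<odot>\<^bsub>M\<^esub> c)"
            using b n(2) x inC by (simp add: a_minus_def M.minus_add M.add.m_ac M.r_neg1 M.r_neg2 M.r_neg)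
          moreover have "\<ominus>\<^bsub>M\<^esub> (?b \<odot>\<^bsub>M\<^esub> c) \<in> C" using Cs(3,4) b n(2) by simp
          moreover have "?b \<odot>\<^bsub>M\<^esub> n \<in> N" using Ns(4) b n(4) by simp
          ultimately show ?thesis using neg by auto
        qed
      qed
    qed
    then have "D \<in> \<A>" using Dsub by (simp add: \<A>_def)
    moreover have "C \<subseteq> D"
    proof
      fix c assume "c \<in> C"
      moreover then have "c = c \<oplus>\<^bsub>M\<^esub> \<zero>\<^bsub>k\<^esub> \<odot>\<^bsub>M\<^esub> x" using x inC by simp
      ultimately show "c \<in> D" unfolding D_def by blast
    qed
    ultimately have "D = C" by (rule max)
    moreover have "x \<in> D"
    proof -
      have "x = \<zero>\<^bsub>M\<^esub> \<oplus>\<^bsub>M\<^esub> \<one>\<^bsub>k\<^esub> \<odot>\<^bsub>M\<^esub> x" using x by simp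
      then show ?thesis using submodule_zero[OF Csub] unfolding D_def by blast
    qed
    ultimately have "x \<ominus>\<^bsub>M\<^esub> \<zero>\<^bsub>M\<^esub> \<in> C" using x by (simp add: a_minus_def module_minus_eq[OF M M.zero_closed])
    then show False using neg submodule_zero[OF N] by blast
  qed
  have uniq: "n = m" if "n \<in> N" "m \<in> N" "x \<ominus>\<^bsub>M\<^esub> n \<in> C" "x \<ominus>\<^bsub>M\<^esub> m \<in> C" "x \<in> carrier M" for n m x
  proof -
    have c: "n \<in> carrier M" "m \<in> carrier M" using that inN by auto
    have "(x \<ominus>\<^bsub>M\<^esub> n) \<oplus>\<^bsub>M\<^esub> \<ominus>\<^bsub>M\<^esub> (x \<ominus>\<^bsub>M\<^esub> m) = m \<ominus>\<^bsub>M\<^esub> n"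
      using c that(5) by (simp add: a_minus_def M.minus_add M.add.m_ac M.r_neg1 M.r_neg2)
        (simp add: M.add.m_lcomm[of x "\<ominus>\<^bsub>M\<^esub> n"] M.r_neg)
    moreover have "(x \<ominus>\<^bsub>M\<^esub> n) \<oplus>\<^bsub>M\<^esub> \<ominus>\<^bsub>M\<^esub> (x \<ominus>\<^bsub>M\<^esub> m) \<in> C" using that Cs(3,5) by simp
    moreover have "m \<ominus>\<^bsub>M\<^esub> n \<in> N" using that Ns(3,5) by (simp add: a_minus_def)
    ultimately have "m \<ominus>\<^bsub>M\<^esub> n = \<zero>\<^bsub>M\<^esub>" using CN by auto
    then show ?thesis using module_eq_if_minus_zero[OF M c(2,1)] by simp
  qed
  define q where "q x = (SOME n. n \<in> N \<and> x \<ominus>\<^bsub>M\<^esub> n \<in> C)" for x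
  have q: "q x \<in> N" "x \<ominus>\<^bsub>M\<^esub> q x \<in> C" if "x \<in> carrier M" for x
    using someI_ex[of "\<lambda>n. n \<in> N \<and> x \<ominus>\<^bsub>M\<^esub> n \<in> C"] ex[OF that] unfolding q_def by blast+
  have qM: "q x \<in> carrier M" if "x \<in> carrier M" for x by (rule inN[OF q(1)[OF that]])
  have "q \<in> module_hom k M M"
  proof (rule module_homI)
    fix x y assume x: "x \<in> carrier M" and y: "y \<in> carrier M"
    have "(x \<ominus>\<^bsub>M\<^esub> q x) \<oplus>\<^bsub>M\<^esub> (y \<ominus>\<^bsub>M\<^esub> q y) = (x \<oplus>\<^bsub>M\<^esub> y) \<ominus>\<^bsub>M\<^esub> (q x \<oplus>\<^bsub>M\<^esub> q y)"
      using x y qM by (simp add: a_minus_def M.minus_add M.add.m_ac)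
    moreover have "(x \<ominus>\<^bsub>M\<^esub> q x) \<oplus>\<^bsub>M\<^esub> (y \<ominus>\<^bsub>M\<^esub> q y) \<in> C" using q(2)[OF x] q(2)[OF y] Cs(5) by simp
    moreover have "q x \<oplus>\<^bsub>M\<^esub> q y \<in> N" using q(1)[OF x] q(1)[OF y] Ns(5) by simp
    ultimately show "q (x \<oplus>\<^bsub>M\<^esub> y) = q x \<oplus>\<^bsub>M\<^esub> q y"
      using uniq[of "q (x \<oplus>\<^bsub>M\<^esub> y)" "q x \<oplus>\<^bsub>M\<^esub> q y" "x \<oplus>\<^bsub>M\<^esub> y"] q[of "x \<oplus>\<^bsub>M\<^esub> y"] x y by simp
  next
    fix c x assume c: "c \<in> carrier k" and x: "x \<in> carrier M"
    have "c \<odot>\<^bsub>M\<^esub> (x \<ominus>\<^bsub>M\<^esub> q x) = c \<odot>\<^bsub>M\<^esub> x \<ominus>\<^bsub>M\<^esub> c \<odot>\<^bsub>M\<^esub> q x"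
      using x c qM by (simp add: a_minus_def M.smult_r_distr M.smult_r_minus)
    moreover have "c \<odot>\<^bsub>M\<^esub> (x \<ominus>\<^bsub>M\<^esub> q x) \<in> C" using q(2)[OF x] c Cs(4) by simp
    moreover have "c \<odot>\<^bsub>M\<^esub> q x \<in> N" using q(1)[OF x] c Ns(4) by simp
    ultimately show "q (c \<odot>\<^bsub>M\<^esub> x) = c \<odot>\<^bsub>M\<^esub> q x"
      using uniq[of "q (c \<odot>\<^bsub>M\<^esub> x)" "c \<odot>\<^bsub>M\<^esub> q x" "c \<odot>\<^bsub>M\<^esub> x"] q[of "c \<odot>\<^bsub>M\<^esub> x"] x c by simp
  qed (rule qM)
  moreover have "q x = x" if "x \<in> N" for x
  proof (rule uniq[OF _ that])
    show "x \<ominus>\<^bsub>M\<^esub> x \<in> C" using inN[OF that] submodule_zero[OF Csub] by (simp add: a_minus_def M.r_neg)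
  qed (use q inN[OF that] in auto)
  ultimately show ?thesis using q(1) by blast
qed


section \<open>Transport of structure\<close>

text \<open>Every element of \<open>R\<close> is some \<open>\<pi> x\<close>, and a sum over the coproduct of \<open>\<pi> x\<close> is the sum over the
  coproduct of \<open>x\<close> of the values at images under \<open>\<pi>\<close>. Each axiom for \<open>R\<close> is thereby an identity
  in \<open>H\<close>.\<close>

lemma bialgebra_of_surjection:
  assumes H: "bialgebra k H" and R: "module k R"
    and \<pi>: "\<pi> \<in> module_hom k H R" and surj: "\<pi> ` carrier H = carrier R"
    and mult: "\<And>x y. x \<in> carrier H \<Longrightarrow> y \<in> carrier H \<Longrightarrow> \<pi> (x \<otimes>\<^bsub>H\<^esub> y) = \<pi> x \<otimes>\<^bsub>R\<^esub> \<pi> y"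
    and one: "\<pi> \<one>\<^bsub>H\<^esub> = \<one>\<^bsub>R\<^esub>"
    and \<Delta>: "\<And>x. x \<in> carrier H \<Longrightarrow>
      comult R (\<pi> x) = sweedler k (tensor k R R) H (\<lambda>a b. pure_tensor k R R (\<pi> a) (\<pi> b)) x"
    and \<epsilon>: "\<And>x. x \<in> carrier H \<Longrightarrow> counit R (\<pi> x) = counit H x"
  shows "bialgebra k R" and "\<pi> \<in> bialg_hom k H R"
proof -
  note A = bialgebra_is_k_algebra[OF H] and C = bialgebra_is_coalgebra[OF H]
  interpret H: k_algebra k H by (rule A)
  interpret R: module k R by (rule R)
  note M = H.module_axioms
  note pc = module_hom_closed[OF \<pi>]
  have ex: "\<exists>x\<in>carrier H. r = \<pi> x" if "r \<in> carrier R" for r using that surj by auto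
  have lift: "f \<in> module_hom k R Q" if "\<And>x. x \<in> carrier H \<Longrightarrow> f (\<pi> x) = f' x" "f' \<in> module_hom k H Q"
    for f f' and Q :: "('a, 'q) module"
    proof (rule module_homI)
      fix r assume "r \<in> carrier R"
      then obtain x where "x \<in> carrier H" "r = \<pi> x" using ex by auto
      then show "f r \<in> carrier Q" using that by (simp add: module_hom_closed[OF that(2)])
    next
      fix r s assume "r \<in> carrier R" "s \<in> carrier R"
      then obtain x y where "x \<in> carrier H" "r = \<pi> x" "y \<in> carrier H" "s = \<pi> y" using ex by meson
      then show "f (r \<oplus>\<^bsub>R\<^esub> s) = f r \<oplus>\<^bsub>Q\<^esub> f s"
        using that(1) by (simp add: module_hom_add[OF \<pi>, symmetric] module_hom_add[OF that(2)])
    next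
      fix c r assume c: "c \<in> carrier k" "r \<in> carrier R"
      then obtain x where "x \<in> carrier H" "r = \<pi> x" using ex by auto
      then show "f (c \<odot>\<^bsub>R\<^esub> r) = c \<odot>\<^bsub>Q\<^esub> f r"
        using that(1) c by (simp add: module_hom_smult[OF \<pi>, symmetric] module_hom_smult[OF that(2)])
    qed
  have T: "module k (tensor k R R)" by (rule tensor_is_module[OF R R])
  note pb = pure_tensor_bilinear[OF R R]
  have bpp: "bilinear_map k H H (tensor k R R) (\<lambda>a b. pure_tensor k R R (\<pi> a) (\<pi> b))"
    by (rule bilinear_map_comp[OF pb \<pi> \<pi>])
  have D: "comult R \<in> module_hom k R (tensor k R R)"
    using lift[OF \<Delta> sweedler_hom[OF C T bpp]] by simp
  have E: "counit R \<in> module_hom k R (self_module k)"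
    using lift[OF \<epsilon> counit_hom[OF C]] by simp
  have \<pi>C: "\<pi> \<in> coalg_hom k H R" by (rule coalg_homI[OF \<pi> \<Delta> \<epsilon>])
  note push = sweedler_coalg_hom[OF \<pi>C C R]
  have algR: "k_algebra k R"
  proof (rule k_algebraI[OF R])
    show "bilinear_map k R R R (mult R)"
    proof (rule bilinear_mapI; rule module_homI)
      fix r s assume "r \<in> carrier R" "s \<in> carrier R"
      then obtain x y where xy: "x \<in> carrier H" "r = \<pi> x" "y \<in> carrier H" "s = \<pi> y" using ex by meson
      then show "r \<otimes>\<^bsub>R\<^esub> s \<in> carrier R" by (simp add: mult[symmetric] pc)
      then show "r \<otimes>\<^bsub>R\<^esub> s \<in> carrier R" .
      fix t assume "t \<in> carrier R"
      then obtain z where z: "z \<in> carrier H" "t = \<pi> z" using ex by meson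
      show "r \<otimes>\<^bsub>R\<^esub> (s \<oplus>\<^bsub>R\<^esub> t) = r \<otimes>\<^bsub>R\<^esub> s \<oplus>\<^bsub>R\<^esub> r \<otimes>\<^bsub>R\<^esub> t"
        "(r \<oplus>\<^bsub>R\<^esub> s) \<otimes>\<^bsub>R\<^esub> t = r \<otimes>\<^bsub>R\<^esub> t \<oplus>\<^bsub>R\<^esub> s \<otimes>\<^bsub>R\<^esub> t"
        using xy z by (simp_all add: mult[symmetric] module_hom_add[OF \<pi>, symmetric] H.l_distr H.r_distr)
    next
      fix c r s assume c: "c \<in> carrier k" and "r \<in> carrier R" "s \<in> carrier R"
      then obtain x y where xy: "x \<in> carrier H" "r = \<pi> x" "y \<in> carrier H" "s = \<pi> y" using ex by meson
      show "r \<otimes>\<^bsub>R\<^esub> (c \<odot>\<^bsub>R\<^esub> s) = c \<odot>\<^bsub>R\<^esub> (r \<otimes>\<^bsub>R\<^esub> s)" "(c \<odot>\<^bsub>R\<^esub> r) \<otimes>\<^bsub>R\<^esub> s = c \<odot>\<^bsub>R\<^esub> (r \<otimes>\<^bsub>R\<^esub> s)"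
        using xy c by (simp_all add: mult[symmetric] module_hom_smult[OF \<pi>, symmetric]
            H.smult_mult_left H.smult_mult_right)
    qed
    show "\<one>\<^bsub>R\<^esub> \<in> carrier R" by (simp add: one[symmetric] pc)
  next
    fix r s t assume "r \<in> carrier R" "s \<in> carrier R" "t \<in> carrier R"
    then obtain x y z where "x \<in> carrier H" "r = \<pi> x" "y \<in> carrier H" "s = \<pi> y" "z \<in> carrier H" "t = \<pi> z"
      using ex by meson
    then show "r \<otimes>\<^bsub>R\<^esub> s \<otimes>\<^bsub>R\<^esub> t = r \<otimes>\<^bsub>R\<^esub> (s \<otimes>\<^bsub>R\<^esub> t)" by (simp add: mult[symmetric] H.m_assoc)
  next
    fix r assume "r \<in> carrier R"
    then obtain x where "x \<in> carrier H" "r = \<pi> x" using ex by meson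
    then show "\<one>\<^bsub>R\<^esub> \<otimes>\<^bsub>R\<^esub> r = r" "r \<otimes>\<^bsub>R\<^esub> \<one>\<^bsub>R\<^esub> = r" by (simp_all add: mult[symmetric] one[symmetric])
  qed
  note bR = k_algebra_bilinear[OF algR]
  have coR: "coalgebra k R"
  proof (rule coalgebraI[OF R D E])
    fix r assume "r \<in> carrier R"
    then obtain x where x: "x \<in> carrier H" "r = \<pi> x" using ex by meson
    let ?Q = "tensor k R (tensor k R R)"
    let ?t = "\<lambda>a b c. pure_tensor k R (tensor k R R) a (pure_tensor k R R b c)"
    note Q = tensor_is_module[OF R T]
    have tri: "trilinear_map k R R R ?Q ?t"
      by (rule trilinear_map_right_nested[OF pure_tensor_bilinear[OF R T] pb])
    have tri': "trilinear_map k H H H ?Q (\<lambda>a b c. ?t (\<pi> a) (\<pi> b) (\<pi> c))"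
      by (rule trilinear_map_comp[OF tri \<pi> \<pi> \<pi>])
    note b2 = trilinear_sweedler_bilinear[OF C C Q tri']
    note bR = sweedler_trilinear_bilinear[OF R D Q tri]
    have "sweedler k ?Q R (\<lambda>a b. sweedler k ?Q R (\<lambda>c d. ?t c d b) a) r =
        sweedler k ?Q H (\<lambda>a b. sweedler k ?Q H (\<lambda>c d. ?t (\<pi> c) (\<pi> d) (\<pi> b)) a) x"
      unfolding x(2) push[OF Q bR(2) x(1)]
      by (rule sweedler_cong[OF C Q bilinear_map_comp[OF bR(2) \<pi> \<pi>] b2(2) _ x(1)])
        (rule push[OF Q trilinear_map_bilinear_left[OF tri pc]])
    also have "\<dots> = sweedler k ?Q H (\<lambda>a b. sweedler k ?Q H (\<lambda>c d. ?t (\<pi> a) (\<pi> c) (\<pi> d)) b) x"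
      by (rule sweedler_coassoc[OF C Q tri' x(1)])
    also have "\<dots> = sweedler k ?Q R (\<lambda>a b. sweedler k ?Q R (\<lambda>c d. ?t a c d) b) r"
      unfolding x(2) push[OF Q bR(1) x(1)]
      by (rule sweedler_cong[OF C Q b2(1) bilinear_map_comp[OF bR(1) \<pi> \<pi>] _ x(1)])
        (rule push[OF Q trilinear_map_bilinear_right[OF tri pc], symmetric])
    finally show "sweedler k ?Q R (\<lambda>a b. sweedler k ?Q R (\<lambda>c d. ?t c d b) a) r = \<dots>" .
    have be: "bilinear_map k R R R (\<lambda>a b. counit R a \<odot>\<^bsub>R\<^esub> b)"
      by (rule bilinear_map_comp[OF smult_bilinear[OF R] E module_hom_id])
    note be' = bilinear_map_flip[OF be]
    have "sweedler k R R (\<lambda>a b. counit R a \<odot>\<^bsub>R\<^esub> b) r = sweedler k R H (\<lambda>a b. counit H a \<odot>\<^bsub>R\<^esub> \<pi> b) x"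
      unfolding x(2) push[OF R be x(1)]
      by (rule sweedler_cong[OF C R bilinear_map_comp[OF be \<pi> \<pi>] counit_smult_bilinear(1)[OF C R \<pi>] _ x(1)])
        (simp add: \<epsilon>)
    then show "sweedler k R R (\<lambda>a b. counit R a \<odot>\<^bsub>R\<^esub> b) r = r"
      by (simp add: sweedler_counit(1)[OF C R \<pi> x(1)] x(2))
    have "sweedler k R R (\<lambda>a b. counit R b \<odot>\<^bsub>R\<^esub> a) r = sweedler k R H (\<lambda>a b. counit H b \<odot>\<^bsub>R\<^esub> \<pi> a) x"
      unfolding x(2) push[OF R be' x(1)]
      by (rule sweedler_cong[OF C R bilinear_map_comp[OF be' \<pi> \<pi>] counit_smult_bilinear(2)[OF C R \<pi>] _ x(1)])
        (simp add: \<epsilon>)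
    then show "sweedler k R R (\<lambda>a b. counit R b \<odot>\<^bsub>R\<^esub> a) r = r"
      by (simp add: sweedler_counit(2)[OF C R \<pi> x(1)] x(2))
  qed
  show "bialgebra k R"
  proof (rule bialgebraI[OF algR coR])
    fix r s assume "r \<in> carrier R" "s \<in> carrier R"
    then obtain x y where x: "x \<in> carrier H" "r = \<pi> x" and y: "y \<in> carrier H" "s = \<pi> y" using ex by meson
    show "counit R (r \<otimes>\<^bsub>R\<^esub> s) = counit R r \<otimes>\<^bsub>k\<^esub> counit R s"
      by (simp add: x y mult[symmetric] \<epsilon> counit_mult[OF H])
    let ?p = "pure_tensor k R R"
    have s: "s \<in> carrier R" by (simp add: y pc)
    have bi: "bilinear_map k H H (tensor k R R) (\<lambda>c d. ?p (\<pi> (a \<otimes>\<^bsub>H\<^esub> c)) (\<pi> (b \<otimes>\<^bsub>H\<^esub> d)))"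
      if "a \<in> carrier H" "b \<in> carrier H" for a b
      by (rule bilinear_map_comp[OF bpp bilinear_map_right[OF k_algebra_bilinear[OF A] that(1)]
            bilinear_map_right[OF k_algebra_bilinear[OF A] that(2)]])
    have bo: "bilinear_map k H H (tensor k R R) (\<lambda>a b. ?p (\<pi> (a \<otimes>\<^bsub>H\<^esub> c)) (\<pi> (b \<otimes>\<^bsub>H\<^esub> d)))"
      if "c \<in> carrier H" "d \<in> carrier H" for c d
      by (rule bilinear_map_comp[OF bpp bilinear_map_left[OF k_algebra_bilinear[OF A] that(1)]
            bilinear_map_left[OF k_algebra_bilinear[OF A] that(2)]])
    note bs = tensor_mult_lift_bilinear[OF algR algR module_hom_closed[OF D s]]
    have "comult R (r \<otimes>\<^bsub>R\<^esub> s) =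
      sweedler k (tensor k R R) H (\<lambda>a b. ?p (\<pi> a) (\<pi> b)) (x \<otimes>\<^bsub>H\<^esub> y)"
      by (simp add: x y mult[symmetric] \<Delta>)
    also have "\<dots> = sweedler k (tensor k R R) H (\<lambda>a b.
        sweedler k (tensor k R R) H (\<lambda>c d. ?p (\<pi> (a \<otimes>\<^bsub>H\<^esub> c)) (\<pi> (b \<otimes>\<^bsub>H\<^esub> d))) y) x"
      by (rule sweedler_mult[OF H T bpp x(1) y(1)])
    also have "\<dots> = comult R r \<otimes>\<^bsub>tensor_algebra k R R\<^esub> comult R s"
      unfolding tensor_algebra_simps unfolding x(2) push[OF T bs x(1)]
    proof (rule sweedler_cong[OF C T tensor_lift_param_bilinear[OF M M T M M comult_closed[OF C y(1)] bi bo]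
          bilinear_map_comp[OF bs \<pi> \<pi>] _ x(1)])
      fix a b assume ab: "a \<in> carrier H" "b \<in> carrier H"
      note b' = tensor_mult_bilinear_inner[OF algR algR pc[OF ab(1)] pc[OF ab(2)]]
      show "sweedler k (tensor k R R) H (\<lambda>c d. ?p (\<pi> (a \<otimes>\<^bsub>H\<^esub> c)) (\<pi> (b \<otimes>\<^bsub>H\<^esub> d))) y =
        sweedler k (tensor k R R) R (\<lambda>c d. ?p (\<pi> a \<otimes>\<^bsub>R\<^esub> c) (\<pi> b \<otimes>\<^bsub>R\<^esub> d)) s"
        unfolding y(2) push[OF T b' y(1)]
        by (rule sweedler_cong[OF C T bi[OF ab] bilinear_map_comp[OF b' \<pi> \<pi>] _ y(1)])
          (simp add: mult ab)
    qed
    finally show "comult R (r \<otimes>\<^bsub>R\<^esub> s) = comult R r \<otimes>\<^bsub>tensor_algebra k R R\<^esub> comult R s" .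
  next
    show "counit R \<one>\<^bsub>R\<^esub> = \<one>\<^bsub>k\<^esub>" by (simp add: one[symmetric] \<epsilon> counit_one[OF H])
    show "comult R \<one>\<^bsub>R\<^esub> = pure_tensor k R R \<one>\<^bsub>R\<^esub> \<one>\<^bsub>R\<^esub>"
      using \<Delta>[OF H.one_closed] sweedler_one[OF H T bpp] by (simp add: one)
  qed
  show "\<pi> \<in> bialg_hom k H R"
    using \<pi>C pc by (auto simp: bialg_hom_iff mult one module_hom_add[OF \<pi>] intro!: ring_hom_memI)
qed

text \<open>The left inverse \<open>p\<close> stands for the injectivity of the tensor powers of \<open>i\<close>: a trilinear \<open>f\<close> on \<open>R\<close>
  is the restriction along \<open>i\<close> of \<open>f(p a, p b, p c)\<close>, a trilinear function on \<open>H\<close>, and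
  coassociativity of \<open>H\<close> applies to the latter.\<close>

lemma bialgebra_of_injection:
  assumes H: "bialgebra k H" and R: "module k R"
    and i: "i \<in> module_hom k R H" and p: "p \<in> module_hom k H R"
    and pi: "\<And>x. x \<in> carrier R \<Longrightarrow> p (i x) = x"
    and m: "\<And>x y. x \<in> carrier R \<Longrightarrow> y \<in> carrier R \<Longrightarrow> x \<otimes>\<^bsub>R\<^esub> y \<in> carrier R"
    and mult: "\<And>x y. x \<in> carrier R \<Longrightarrow> y \<in> carrier R \<Longrightarrow> i (x \<otimes>\<^bsub>R\<^esub> y) = i x \<otimes>\<^bsub>H\<^esub> i y"
    and o: "\<one>\<^bsub>R\<^esub> \<in> carrier R" and one: "i \<one>\<^bsub>R\<^esub> = \<one>\<^bsub>H\<^esub>"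
    and D: "comult R \<in> module_hom k R (tensor k R R)"
    and \<Delta>: "\<And>x. x \<in> carrier R \<Longrightarrow>
      comult H (i x) = sweedler k (tensor k H H) R (\<lambda>a b. pure_tensor k H H (i a) (i b)) x"
    and \<epsilon>: "\<And>x. x \<in> carrier R \<Longrightarrow> counit H (i x) = counit R x"
  shows "bialgebra k R" and "i \<in> bialg_hom k R H"
proof -
  note A = bialgebra_is_k_algebra[OF H] and C = bialgebra_is_coalgebra[OF H]
  interpret H: k_algebra k H by (rule A)
  interpret R: module k R by (rule R)
  note M = H.module_axioms
  note ic = module_hom_closed[OF i] and pc = module_hom_closed[OF p]
  note Dc = module_hom_closed[OF D]
  have inj: "x = y" if "i x = i y" "x \<in> carrier R" "y \<in> carrier R" for x y
    using that pi by metis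
  have pm: "p (i x \<otimes>\<^bsub>H\<^esub> i y) = x \<otimes>\<^bsub>R\<^esub> y" if "x \<in> carrier R" "y \<in> carrier R" for x y
    using that by (simp add: mult[symmetric] pi m)
  have iC: "i \<in> coalg_hom k R H" by (rule coalg_homI[OF i \<Delta> \<epsilon>])
  have pull: "sweedler k P H u (i x) = sweedler k P R (\<lambda>a b. u (i a) (i b)) x"
    if P: "module k P" and u: "bilinear_map k H H P u" and x: "x \<in> carrier R"
    for P :: "('a, 'p, 's) module_scheme" and u x
    using tensor_lift_tensor_map[OF R R M M P i i u Dc[OF x]] \<Delta>[OF x] by (simp add: tensor_map_def)
  have scong: "sweedler k P R f x = sweedler k P R g x"
    if "module k P" "bilinear_map k R R P f" "bilinear_map k R R P g"
      "\<And>a b. a \<in> carrier R \<Longrightarrow> b \<in> carrier R \<Longrightarrow> f a b = g a b" "x \<in> carrier R"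
    for P :: "('a, 'p, 's) module_scheme" and f g x
    by (rule tensor_lift_cong[OF R R that(1-4) Dc[OF that(5)]])
  have push: "sweedler k P R u x = sweedler k P H (\<lambda>a b. u (p a) (p b)) (i x)"
    if P: "module k P" and u: "bilinear_map k R R P u" and x: "x \<in> carrier R"
    for P :: "('a, 'p, 's) module_scheme" and u x
    unfolding pull[OF P bilinear_map_comp[OF u p p] x]
    by (rule scong[OF P u bilinear_map_comp[OF bilinear_map_comp[OF u p p] i i] _ x]) (simp add: pi)
  have T: "module k (tensor k R R)" by (rule tensor_is_module[OF R R])
  note pb = pure_tensor_bilinear[OF R R]
  have E: "counit R \<in> module_hom k R (self_module k)"
    by (rule module_hom_cong[OF module_hom_comp[OF i counit_hom[OF C]] R]) (simp add: \<epsilon>)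
  have algR: "k_algebra k R"
  proof (rule k_algebraI[OF R])
    show "bilinear_map k R R R (mult R)"
      by (rule bilinear_mapI; rule module_homI; (rule inj)?)
        (auto simp: m mult ic module_hom_add[OF i] module_hom_smult[OF i] H.l_distr H.r_distr
          H.smult_mult_left H.smult_mult_right)
  next
    fix x y z assume "x \<in> carrier R" "y \<in> carrier R" "z \<in> carrier R"
    then show "x \<otimes>\<^bsub>R\<^esub> y \<otimes>\<^bsub>R\<^esub> z = x \<otimes>\<^bsub>R\<^esub> (y \<otimes>\<^bsub>R\<^esub> z)"
      by - (rule inj, simp_all add: m mult ic H.m_assoc)
  next
    fix x assume "x \<in> carrier R"
    then show "\<one>\<^bsub>R\<^esub> \<otimes>\<^bsub>R\<^esub> x = x" "x \<otimes>\<^bsub>R\<^esub> \<one>\<^bsub>R\<^esub> = x"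
      by - (rule inj, simp_all add: m mult one o ic)+
  qed (rule o)
  have coR: "coalgebra k R"
  proof (rule coalgebraI[OF R D E])
    fix x assume x: "x \<in> carrier R"
    let ?Q = "tensor k R (tensor k R R)"
    let ?t = "\<lambda>a b c. pure_tensor k R (tensor k R R) a (pure_tensor k R R b c)"
    let ?t' = "\<lambda>a b c. ?t (p a) (p b) (p c)"
    note Q = tensor_is_module[OF R T]
    have tri: "trilinear_map k R R R ?Q ?t"
      by (rule trilinear_map_right_nested[OF pure_tensor_bilinear[OF R T] pb])
    have tri': "trilinear_map k H H H ?Q ?t'"
      by (rule trilinear_map_comp[OF tri p p p])
    note b2 = trilinear_sweedler_bilinear[OF C C Q tri']
    note bR = sweedler_trilinear_bilinear[OF R D Q tri]
    have "sweedler k ?Q R (\<lambda>a b. sweedler k ?Q R (\<lambda>c d. ?t c d b) a) x =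
        sweedler k ?Q R (\<lambda>a b. sweedler k ?Q H (\<lambda>c d. ?t' c d (i b)) (i a)) x"
      by (rule scong[OF Q bR(2) bilinear_map_comp[OF b2(2) i i] _ x])
        (simp add: push[OF Q trilinear_map_bilinear_left[OF tri]] pi)
    also have "\<dots> = sweedler k ?Q H (\<lambda>a b. sweedler k ?Q H (\<lambda>c d. ?t' c d b) a) (i x)"
      by (rule pull[OF Q b2(2) x, symmetric])
    also have "\<dots> = sweedler k ?Q H (\<lambda>a b. sweedler k ?Q H (\<lambda>c d. ?t' a c d) b) (i x)"
      by (rule sweedler_coassoc[OF C Q tri' ic[OF x]])
    also have "\<dots> = sweedler k ?Q R (\<lambda>a b. sweedler k ?Q H (\<lambda>c d. ?t' (i a) c d) (i b)) x"
      by (rule pull[OF Q b2(1) x])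
    also have "\<dots> = sweedler k ?Q R (\<lambda>a b. sweedler k ?Q R (\<lambda>c d. ?t a c d) b) x"
      by (rule scong[OF Q bilinear_map_comp[OF b2(1) i i] bR(1) _ x])
        (simp add: push[OF Q trilinear_map_bilinear_right[OF tri]] pi)
    finally show "sweedler k ?Q R (\<lambda>a b. sweedler k ?Q R (\<lambda>c d. ?t c d b) a) x = \<dots>" .
    have be: "bilinear_map k R R R (\<lambda>a b. counit R a \<odot>\<^bsub>R\<^esub> b)"
      by (rule bilinear_map_comp[OF smult_bilinear[OF R] E module_hom_id])
    note be' = bilinear_map_flip[OF be]
    note ce = counit_smult_bilinear[OF C R p]
    have "sweedler k R R (\<lambda>a b. counit R a \<odot>\<^bsub>R\<^esub> b) x = sweedler k R H (\<lambda>a b. counit H a \<odot>\<^bsub>R\<^esub> p b) (i x)"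
      unfolding pull[OF R ce(1) x]
      by (rule scong[OF R be bilinear_map_comp[OF ce(1) i i] _ x]) (simp add: \<epsilon> pi)
    then show "sweedler k R R (\<lambda>a b. counit R a \<odot>\<^bsub>R\<^esub> b) x = x"
      by (simp add: sweedler_counit(1)[OF C R p ic[OF x]] pi x)
    have "sweedler k R R (\<lambda>a b. counit R b \<odot>\<^bsub>R\<^esub> a) x = sweedler k R H (\<lambda>a b. counit H b \<odot>\<^bsub>R\<^esub> p a) (i x)"
      unfolding pull[OF R ce(2) x]
      by (rule scong[OF R be' bilinear_map_comp[OF ce(2) i i] _ x]) (simp add: \<epsilon> pi)
    then show "sweedler k R R (\<lambda>a b. counit R b \<odot>\<^bsub>R\<^esub> a) x = x"
      by (simp add: sweedler_counit(2)[OF C R p ic[OF x]] pi x)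
  qed
  show "bialgebra k R"
  proof (rule bialgebraI[OF algR coR])
    fix x y assume x: "x \<in> carrier R" and y: "y \<in> carrier R"
    show "counit R (x \<otimes>\<^bsub>R\<^esub> y) = counit R x \<otimes>\<^bsub>k\<^esub> counit R y"
      using x y by (simp add: \<epsilon>[symmetric] m mult counit_mult[OF H] ic)
    let ?p = "pure_tensor k R R"
    have bpp: "bilinear_map k H H (tensor k R R) (\<lambda>a b. ?p (p a) (p b))"
      by (rule bilinear_map_comp[OF pb p p])
    have bi: "bilinear_map k H H (tensor k R R) (\<lambda>c d. ?p (p (a \<otimes>\<^bsub>H\<^esub> c)) (p (b \<otimes>\<^bsub>H\<^esub> d)))"
      if "a \<in> carrier H" "b \<in> carrier H" for a b
      by (rule bilinear_map_comp[OF bpp bilinear_map_right[OF k_algebra_bilinear[OF A] that(1)]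
            bilinear_map_right[OF k_algebra_bilinear[OF A] that(2)]])
    have bo: "bilinear_map k H H (tensor k R R) (\<lambda>a b. ?p (p (a \<otimes>\<^bsub>H\<^esub> c)) (p (b \<otimes>\<^bsub>H\<^esub> d)))"
      if "c \<in> carrier H" "d \<in> carrier H" for c d
      by (rule bilinear_map_comp[OF bpp bilinear_map_left[OF k_algebra_bilinear[OF A] that(1)]
            bilinear_map_left[OF k_algebra_bilinear[OF A] that(2)]])
    note bs = tensor_mult_lift_bilinear[OF algR algR Dc[OF y]]
    note bx = tensor_lift_param_bilinear[OF M M T M M comult_closed[OF C ic[OF y]] bi bo]
    have "comult R (x \<otimes>\<^bsub>R\<^esub> y) = sweedler k (tensor k R R) R ?p (x \<otimes>\<^bsub>R\<^esub> y)"
      by (simp add: tensor_lift_pure_id[OF R R] Dc m x y)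
    also have "\<dots> = sweedler k (tensor k R R) H (\<lambda>a b. ?p (p a) (p b)) (i x \<otimes>\<^bsub>H\<^esub> i y)"
      using push[OF T pb m[OF x y]] by (simp add: mult x y)
    also have "\<dots> = sweedler k (tensor k R R) H (\<lambda>a b.
        sweedler k (tensor k R R) H (\<lambda>c d. ?p (p (a \<otimes>\<^bsub>H\<^esub> c)) (p (b \<otimes>\<^bsub>H\<^esub> d))) (i y)) (i x)"
      by (rule sweedler_mult[OF H T bpp ic[OF x] ic[OF y]])
    also have "\<dots> = sweedler k (tensor k R R) R (\<lambda>a b.
        sweedler k (tensor k R R) H (\<lambda>c d. ?p (p (i a \<otimes>\<^bsub>H\<^esub> c)) (p (i b \<otimes>\<^bsub>H\<^esub> d))) (i y)) x"
      by (rule pull[OF T bx x])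
    also have "\<dots> = comult R x \<otimes>\<^bsub>tensor_algebra k R R\<^esub> comult R y"
      unfolding tensor_algebra_simps
    proof (rule scong[OF T bilinear_map_comp[OF bx i i] bs _ x])
      fix a b assume ab: "a \<in> carrier R" "b \<in> carrier R"
      note b' = tensor_mult_bilinear_inner[OF algR algR ab]
      show "sweedler k (tensor k R R) H (\<lambda>c d. ?p (p (i a \<otimes>\<^bsub>H\<^esub> c)) (p (i b \<otimes>\<^bsub>H\<^esub> d))) (i y) =
        sweedler k (tensor k R R) R (\<lambda>c d. ?p (a \<otimes>\<^bsub>R\<^esub> c) (b \<otimes>\<^bsub>R\<^esub> d)) y"
        unfolding pull[OF T bi[OF ic[OF ab(1)] ic[OF ab(2)]] y]
        by (rule scong[OF T bilinear_map_comp[OF bi[OF ic[OF ab(1)] ic[OF ab(2)]] i i] b' _ y])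
          (simp add: pm ab)
    qed
    finally show "comult R (x \<otimes>\<^bsub>R\<^esub> y) = comult R x \<otimes>\<^bsub>tensor_algebra k R R\<^esub> comult R y" .
  next
    show "counit R \<one>\<^bsub>R\<^esub> = \<one>\<^bsub>k\<^esub>" by (simp add: \<epsilon>[symmetric] one o counit_one[OF H])
    have "comult R \<one>\<^bsub>R\<^esub> = sweedler k (tensor k R R) R (pure_tensor k R R) \<one>\<^bsub>R\<^esub>"
      by (simp add: tensor_lift_pure_id[OF R R] Dc o)
    also have "\<dots> = pure_tensor k R R (p (i \<one>\<^bsub>R\<^esub>)) (p (i \<one>\<^bsub>R\<^esub>))"
      unfolding push[OF T pb o] by (simp add: one sweedler_one[OF H T bilinear_map_comp[OF pb p p]])
    finally show "comult R \<one>\<^bsub>R\<^esub> = pure_tensor k R R \<one>\<^bsub>R\<^esub> \<one>\<^bsub>R\<^esub>" by (simp add: pi o)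
  qed
  show "i \<in> bialg_hom k R H"
    using iC ic by (auto simp: bialg_hom_iff mult one module_hom_add[OF i] intro!: ring_hom_memI)
qed

lemma antipode_of_surjection:
  assumes H: "bialgebra k H" and R: "bialgebra k R" and \<pi>: "\<pi> \<in> bialg_hom k H R"
    and surj: "\<pi> ` carrier H = carrier R" and S: "antipode k H S"
    and S': "S' \<in> module_hom k R R" and eq: "\<And>x. x \<in> carrier H \<Longrightarrow> S' (\<pi> x) = \<pi> (S x)"
  shows "antipode k R S'"
proof -
  note A = bialgebra_is_k_algebra[OF H] and C = bialgebra_is_coalgebra[OF H]
  note AR = bialgebra_is_k_algebra[OF R] and CR = bialgebra_is_coalgebra[OF R]
  note M = bialgebra_is_module[OF H] and MR = bialgebra_is_module[OF R]
  note \<pi>l = bialg_hom_linear[OF \<pi>] and Sl = antipode_linear[OF S]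
  have \<pi>C: "\<pi> \<in> coalg_hom k H R" and \<pi>A: "\<pi> \<in> ring_hom H R" using \<pi> by (auto simp: bialg_hom_iff)
  have "conv k R R u' v' (\<pi> x) = \<pi> (conv k H H u v x)"
    if "u \<in> module_hom k H H" "v \<in> module_hom k H H" "u' \<in> module_hom k R R" "v' \<in> module_hom k R R"
      "\<And>x. x \<in> carrier H \<Longrightarrow> u' (\<pi> x) = \<pi> (u x)" "\<And>x. x \<in> carrier H \<Longrightarrow> v' (\<pi> x) = \<pi> (v x)"
      "x \<in> carrier H" for u v u' v' x
  proof -
    have "conv k R R u' v' (\<pi> x) = conv k H R (\<lambda>x. u' (\<pi> x)) (\<lambda>x. v' (\<pi> x)) x"
      by (rule conv_coalg_hom[OF CR AR that(3,4) \<pi>C C that(7)])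
    also have "\<dots> = conv k H R (\<lambda>x. \<pi> (u x)) (\<lambda>x. \<pi> (v x)) x"
      by (rule conv_cong[OF C AR module_hom_comp[OF \<pi>l that(3)] module_hom_comp[OF \<pi>l that(4)]
            module_hom_comp[OF that(1) \<pi>l] module_hom_comp[OF that(2) \<pi>l] that(5,6,7)])
    also have "\<dots> = \<pi> (conv k H H u v x)"
      by (rule conv_post[OF C A that(1,2) MR \<pi>l _ k_algebra_bilinear[OF AR] that(7), symmetric])
        (rule ring_hom_mult[OF \<pi>A])
    finally show ?thesis .
  qed
  note cv = this
  have unit: "\<pi> (counit H x \<odot>\<^bsub>H\<^esub> \<one>\<^bsub>H\<^esub>) = counit R (\<pi> x) \<odot>\<^bsub>R\<^esub> \<one>\<^bsub>R\<^esub>" if "x \<in> carrier H" for x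
  proof -
    interpret H: k_algebra k H by (rule A)
    show ?thesis using that \<pi>C counit_closed[OF C that]
      by (simp add: module_hom_smult[OF \<pi>l] ring_hom_one[OF \<pi>A] coalg_hom_def)
  qed
  show ?thesis unfolding antipode_iff_conv
  proof (intro conjI ballI)
    show "S' \<in> module_hom k R R" by (rule S')
    fix r assume "r \<in> carrier R"
    then obtain x where x: "x \<in> carrier H" "r = \<pi> x" using surj by auto
    show "conv k R R S' (\<lambda>x. x) r = counit R r \<odot>\<^bsub>R\<^esub> \<one>\<^bsub>R\<^esub>"
      using cv[OF Sl module_hom_id S' module_hom_id eq _ x(1)] antipode_left[OF S x(1)] unit[OF x(1)] x(2)
      by simp
    show "conv k R R (\<lambda>x. x) S' r = counit R r \<odot>\<^bsub>R\<^esub> \<one>\<^bsub>R\<^esub>"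
      using cv[OF module_hom_id Sl module_hom_id S' _ eq x(1)] antipode_right[OF S x(1)] unit[OF x(1)] x(2)
      by simp
  qed
qed

lemma antipode_of_injection:
  assumes H: "bialgebra k H" and R: "bialgebra k R" and i: "i \<in> bialg_hom k R H"
    and inj: "inj_on i (carrier R)" and S: "antipode k H S"
    and S': "S' \<in> module_hom k R R" and eq: "\<And>x. x \<in> carrier R \<Longrightarrow> i (S' x) = S (i x)"
  shows "antipode k R S'"
proof -
  note A = bialgebra_is_k_algebra[OF H] and C = bialgebra_is_coalgebra[OF H]
  note AR = bialgebra_is_k_algebra[OF R] and CR = bialgebra_is_coalgebra[OF R]
  note M = bialgebra_is_module[OF H] and MR = bialgebra_is_module[OF R]
  note il = bialg_hom_linear[OF i] and Sl = antipode_linear[OF S]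
  have iC: "i \<in> coalg_hom k R H" and iA: "i \<in> ring_hom R H" using i by (auto simp: bialg_hom_iff)
  have cv: "i (conv k R R u' v' x) = conv k H H u v (i x)"
    if "u \<in> module_hom k H H" "v \<in> module_hom k H H" "u' \<in> module_hom k R R" "v' \<in> module_hom k R R"
      "\<And>x. x \<in> carrier R \<Longrightarrow> i (u' x) = u (i x)" "\<And>x. x \<in> carrier R \<Longrightarrow> i (v' x) = v (i x)"
      "x \<in> carrier R" for u v u' v' x
  proof -
    have "i (conv k R R u' v' x) = conv k R H (\<lambda>x. i (u' x)) (\<lambda>x. i (v' x)) x"
      by (rule conv_post[OF CR AR that(3,4) M il _ k_algebra_bilinear[OF A] that(7)])
        (rule ring_hom_mult[OF iA])
    also have "\<dots> = conv k R H (\<lambda>x. u (i x)) (\<lambda>x. v (i x)) x"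
      by (rule conv_cong[OF CR A module_hom_comp[OF that(3) il] module_hom_comp[OF that(4) il]
            module_hom_comp[OF il that(1)] module_hom_comp[OF il that(2)] that(5,6,7)])
    also have "\<dots> = conv k H H u v (i x)"
      by (rule conv_coalg_hom[OF C A that(1,2) iC CR that(7), symmetric])
    finally show ?thesis .
  qed
  interpret R: k_algebra k R by (rule AR)
  have unit: "counit H (i x) \<odot>\<^bsub>H\<^esub> \<one>\<^bsub>H\<^esub> = i (counit R x \<odot>\<^bsub>R\<^esub> \<one>\<^bsub>R\<^esub>)" if "x \<in> carrier R" for x
    using that iC counit_closed[OF CR that]
    by (simp add: module_hom_smult[OF il] ring_hom_one[OF iA] coalg_hom_def)
  have unitc: "counit R x \<odot>\<^bsub>R\<^esub> \<one>\<^bsub>R\<^esub> \<in> carrier R" if "x \<in> carrier R" for x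
    using counit_closed[OF CR that] by simp
  show ?thesis unfolding antipode_iff_conv
  proof (intro conjI ballI)
    show "S' \<in> module_hom k R R" by (rule S')
    fix x assume x: "x \<in> carrier R"
    have ix: "i x \<in> carrier H" by (rule module_hom_closed[OF il x])
    show "conv k R R S' (\<lambda>x. x) x = counit R x \<odot>\<^bsub>R\<^esub> \<one>\<^bsub>R\<^esub>"
      by (rule inj_onD[OF inj _ module_hom_closed[OF conv_hom[OF CR AR S' module_hom_id] x] unitc[OF x]])
        (use cv[OF Sl module_hom_id S' module_hom_id eq _ x] antipode_left[OF S ix] unit[OF x] in simp)
    show "conv k R R (\<lambda>x. x) S' x = counit R x \<odot>\<^bsub>R\<^esub> \<one>\<^bsub>R\<^esub>"
      by (rule inj_onD[OF inj _ module_hom_closed[OF conv_hom[OF CR AR module_hom_id S'] x] unitc[OF x]])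
        (use cv[OF module_hom_id Sl module_hom_id S' _ eq x] antipode_right[OF S ix] unit[OF x] in simp)
  qed
qed


section \<open>The bialgebra carried by the image of a linear projection\<close>

text \<open>If \<open>p\<close> is a retraction onto a subbialgebra \<open>N\<close>, this is the restricted structure; if \<open>N\<close> is a
  complement of a biideal and \<open>p\<close> the projection along it, this is the quotient. Either way the carrier
  is a subset of that of \<open>H\<close>.\<close>

definition image_bialg ::
  "('a, 'r) ring_scheme \<Rightarrow> ('a, 'b) bialg \<Rightarrow> 'b set \<Rightarrow> ('b \<Rightarrow> 'b) \<Rightarrow> ('a, 'b) bialg" where
  "image_bialg k H N p = H\<lparr>carrier := N, mult := \<lambda>x y. p (x \<otimes>\<^bsub>H\<^esub> y), one := p \<one>\<^bsub>H\<^esub>,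
     comult := \<lambda>x. tensor_map k (H\<lparr>carrier := N\<rparr>) (H\<lparr>carrier := N\<rparr>) p p (comult H x)\<rparr>"

lemma image_bialg_simps:
  "carrier (image_bialg k H N p) = N" "add (image_bialg k H N p) = add H"
  "zero (image_bialg k H N p) = zero H" "smult (image_bialg k H N p) = smult H"
  "mult (image_bialg k H N p) = (\<lambda>x y. p (x \<otimes>\<^bsub>H\<^esub> y))" "one (image_bialg k H N p) = p \<one>\<^bsub>H\<^esub>"
  "counit (image_bialg k H N p) = counit H"
  by (simp_all add: image_bialg_def)

lemma image_bialg_comult:
  fixes H :: "('a, 'b) bialg"
  shows "comult (image_bialg k H N p) x =
    sweedler k (tensor k (image_bialg k H N p) (image_bialg k H N p)) H
      (\<lambda>a b. pure_tensor k (image_bialg k H N p) (image_bialg k H N p) (p a) (p b)) x"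
proof -
  let ?R = "image_bialg k H N p" and ?N = "H\<lparr>carrier := N\<rparr>"
  have "tensor k ?N ?N = tensor k ?R ?R" "pure_tensor k ?N ?N = pure_tensor k ?R ?R"
    by (rule tensor_cong; simp add: image_bialg_simps(1,2,4))+
  moreover have "comult (image_bialg k H N p) x = tensor_map k ?N ?N p p (comult H x)"
    by (simp add: image_bialg_def)
  ultimately show ?thesis by (simp only: tensor_map_def)
qed

lemma image_bialg_is_module:
  assumes "module k H" "submodule N k H"
  shows "module k (image_bialg k H N p)"
  by (rule module_transfer[OF submodule.submodule_is_module[OF assms(2,1)]])
    (simp_all add: image_bialg_simps)

lemma image_bialg_proj_hom:
  assumes "p \<in> module_hom k H H" "\<And>x. x \<in> carrier H \<Longrightarrow> p x \<in> N"
  shows "p \<in> module_hom k H (image_bialg k H N p)"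
  using assms by (auto simp: module_hom_def image_bialg_simps)

lemma image_bialg_incl_hom:
  assumes "N \<subseteq> carrier H"
  shows "(\<lambda>x. x) \<in> module_hom k (image_bialg k H N p) H"
  using assms by (auto simp: module_hom_def image_bialg_simps)


section \<open>The largest subcoalgebra in the equalizer of two morphisms\<close>

text \<open>The linear span of the \<open>a \<otimes> b\<close> with \<open>a, b \<in> X\<close>, taken inside \<open>H \<otimes> H\<close>; the tensor square of a
  subspace \<open>X\<close> would be a different set of cosets.\<close>

inductive_set tensor_span ::
  "('a, 'r) ring_scheme \<Rightarrow> ('a, 'm, 's) module_scheme \<Rightarrow> 'm set \<Rightarrow> ('m \<times> 'm \<Rightarrow> 'a) set set"
  for k H X where
  pure: "a \<in> X \<Longrightarrow> b \<in> X \<Longrightarrow> pure_tensor k H H a b \<in> tensor_span k H X"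
| add: "s \<in> tensor_span k H X \<Longrightarrow> t \<in> tensor_span k H X \<Longrightarrow> s \<oplus>\<^bsub>tensor k H H\<^esub> t \<in> tensor_span k H X"
| smult: "c \<in> carrier k \<Longrightarrow> t \<in> tensor_span k H X \<Longrightarrow> c \<odot>\<^bsub>tensor k H H\<^esub> t \<in> tensor_span k H X"

lemma tensor_span_closed:
  assumes H: "module k H" and X: "X \<subseteq> carrier H" and t: "t \<in> tensor_span k H X"
  shows "t \<in> carrier (tensor k H H)"
proof -
  interpret T: module k "tensor k H H" by (rule tensor_is_module[OF H H])
  show ?thesis using t
    by induction (use X in \<open>auto intro: pure_tensor_closed[OF H H]\<close>)
qed

lemma tensor_span_hom:
  assumes H: "module k H" and X: "X \<subseteq> carrier H"
    and f: "f \<in> module_hom k (tensor k H H) (tensor k K K)"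
    and pure: "\<And>a b. a \<in> X \<Longrightarrow> b \<in> X \<Longrightarrow> f (pure_tensor k H H a b) \<in> tensor_span k K Y"
    and t: "t \<in> tensor_span k H X"
  shows "f t \<in> tensor_span k K Y"
  using t
proof induction
  case (add s t)
  then show ?case
    by (simp add: module_hom_add[OF f] tensor_span_closed[OF H X] tensor_span.add)
next
  case (smult c t)
  then show ?case
    by (simp add: module_hom_smult[OF f] tensor_span_closed[OF H X] tensor_span.smult)
qed (rule pure)

lemma tensor_span_mono:
  assumes "X \<subseteq> Y" "t \<in> tensor_span k H X"
  shows "t \<in> tensor_span k H Y"
  using assms(2) by induction (use assms(1) in \<open>auto intro: tensor_span.intros\<close>)

lemma carrier_tensor_span:
  assumes H: "module k H" and t: "t \<in> carrier (tensor k H H)"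
  shows "t \<in> tensor_span k H (carrier H)"
  by (rule tensor_induct[OF H H t]) (auto intro: tensor_span.intros)

text \<open>The span of such a set is a subcoalgebra. Not asking for a subspace allows sets of products and
  images under arbitrary linear maps.\<close>

definition comult_closed_set :: "('a, 'r) ring_scheme \<Rightarrow> ('a, 'b) bialg \<Rightarrow> 'b set \<Rightarrow> bool" where
  "comult_closed_set k H X \<longleftrightarrow> X \<subseteq> carrier H \<and> (\<forall>x\<in>X. comult H x \<in> tensor_span k H X)"

definition coalgebra_core :: "('a, 'r) ring_scheme \<Rightarrow> ('a, 'b) bialg \<Rightarrow> 'b set \<Rightarrow> 'b set" where
  "coalgebra_core k H E = \<Union>{X. comult_closed_set k H X \<and> X \<subseteq> E}"

lemma coalgebra_core_comult_closed: "comult_closed_set k H (coalgebra_core k H E)"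
  unfolding comult_closed_set_def
proof (intro conjI ballI)
  fix x assume "x \<in> coalgebra_core k H E"
  then obtain X where X: "comult_closed_set k H X" "X \<subseteq> E" "x \<in> X"
    by (auto simp: coalgebra_core_def)
  then have "X \<subseteq> coalgebra_core k H E" by (auto simp: coalgebra_core_def)
  then show "comult H x \<in> tensor_span k H (coalgebra_core k H E)"
    by (rule tensor_span_mono) (use X in \<open>auto simp: comult_closed_set_def\<close>)
qed (auto simp: coalgebra_core_def comult_closed_set_def)

lemma coalgebra_core_greatest:
  "comult_closed_set k H X \<Longrightarrow> X \<subseteq> E \<Longrightarrow> X \<subseteq> coalgebra_core k H E"
  by (auto simp: coalgebra_core_def)

lemma coalgebra_core_subset: "coalgebra_core k H E \<subseteq> E"
  by (auto simp: coalgebra_core_def)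

lemma comult_closed_image:
  assumes f: "f \<in> coalg_hom k B H" and B: "coalgebra k B" and H: "module k H"
  shows "comult_closed_set k H (f ` carrier B)"
  unfolding comult_closed_set_def
proof (intro conjI ballI)
  note M = coalgebra_is_module[OF B]
  note fl = coalg_hom_linear[OF f]
  show "f ` carrier B \<subseteq> carrier H" using module_hom_closed[OF fl] by auto
  fix y assume "y \<in> f ` carrier B"
  then obtain x where x: "x \<in> carrier B" "y = f x" by auto
  have b: "bilinear_map k B B (tensor k H H) (\<lambda>a b. pure_tensor k H H (f a) (f b))"
    by (rule tensor_map_bilinear[OF M M H H fl fl])
  show "comult H y \<in> tensor_span k H (f ` carrier B)"
    unfolding x(2) coalg_hom_comult[OF f x(1)]
    by (rule tensor_span_hom[OF M order_refl tensor_lift_hom[OF M M tensor_is_module[OF H H] b]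
          _ carrier_tensor_span[OF M comult_closed[OF B x(1)]]])
      (auto simp: tensor_lift_pure[OF M M tensor_is_module[OF H H] b] intro: tensor_span.pure)
qed

lemma flip_bilinear:
  assumes H: "module k H" and U: "U \<in> module_hom k H H"
  shows "bilinear_map k H H (tensor k H H) (\<lambda>a b. pure_tensor k H H (U b) (U a))"
  by (rule bilinear_map_flip[OF bilinear_map_comp[OF pure_tensor_bilinear[OF H H] U U]])

lemma comult_closed_flip:
  assumes H: "module k H" and X: "comult_closed_set k H X" and U: "U \<in> module_hom k H H"
    and flip: "\<And>x. x \<in> carrier H \<Longrightarrow>
      comult H (U x) = sweedler k (tensor k H H) H (\<lambda>a b. pure_tensor k H H (U b) (U a)) x"
  shows "comult_closed_set k H (U ` X)"
  unfolding comult_closed_set_def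
proof (intro conjI ballI)
  have XH: "X \<subseteq> carrier H" using X by (simp add: comult_closed_set_def)
  then show "U ` X \<subseteq> carrier H" using module_hom_closed[OF U] by auto
  fix y assume "y \<in> U ` X"
  then obtain x where x: "x \<in> X" "y = U x" by auto
  note b = flip_bilinear[OF H U]
  have xH: "x \<in> carrier H" using x XH by auto
  have "comult H x \<in> tensor_span k H X" using X x by (simp add: comult_closed_set_def)
  then show "comult H y \<in> tensor_span k H (U ` X)"
    unfolding x(2) flip[OF xH]
    by (rule tensor_span_hom[OF H XH tensor_lift_hom[OF H H tensor_is_module[OF H H] b], rotated])
      (use XH in \<open>auto simp: tensor_lift_pure[OF H H tensor_is_module[OF H H] b] subset_iff
        intro!: tensor_span.pure\<close>)
qed

lemma tensor_span_mult:
  assumes A: "k_algebra k H" and X: "X \<subseteq> carrier H"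
    and s: "s \<in> tensor_span k H X" and t: "t \<in> tensor_span k H X"
  shows "s \<otimes>\<^bsub>tensor_algebra k H H\<^esub> t \<in> tensor_span k H {x \<otimes>\<^bsub>H\<^esub> y | x y. x \<in> X \<and> y \<in> X}"
proof -
  note M = k_algebra_is_module[OF A] and mb = tensor_algebra_mult_bilinear[OF A A]
  have pc: "pure_tensor k H H a b \<in> carrier (tensor k H H)" if "a \<in> X" "b \<in> X" for a b
    using that X by (auto intro: pure_tensor_closed[OF M M])
  have 1: "pure_tensor k H H a b \<otimes>\<^bsub>tensor_algebra k H H\<^esub> t
      \<in> tensor_span k H {x \<otimes>\<^bsub>H\<^esub> y | x y. x \<in> X \<and> y \<in> X}" if ab: "a \<in> X" "b \<in> X" for a b
    by (rule tensor_span_hom[OF M X bilinear_map_right[OF mb pc[OF ab]] _ t])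
      (use ab X in \<open>auto simp: tensor_algebra_mult_pure[OF A A] subset_iff intro!: tensor_span.pure\<close>)
  show ?thesis
    by (rule tensor_span_hom[OF M X bilinear_map_left[OF mb tensor_span_closed[OF M X t]] 1 s])
qed

definition equalizer :: "('b, 'm) ring_scheme \<Rightarrow> ('b \<Rightarrow> 'c) \<Rightarrow> ('b \<Rightarrow> 'c) \<Rightarrow> 'b set" where
  "equalizer H g h = {x \<in> carrier H. g x = h x}"

context
  fixes k :: "('a, 'r) ring_scheme" and H :: "('a, 'b) bialg" and C :: "('a, 'c) bialg"
    and g h :: "'b \<Rightarrow> 'c"
  assumes k: "field k" and H: "bialgebra k H" and C: "bialgebra k C"
    and g: "g \<in> bialg_hom k H C" and h: "h \<in> bialg_hom k H C"
begin

interpretation H: k_algebra k H by (rule bialgebra_is_k_algebra[OF H])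

private lemmas H_alg = bialgebra_is_k_algebra[OF H]
private lemmas H_coalg = bialgebra_is_coalgebra[OF H]
private lemmas H_mod = H.module_axioms
private lemmas g_lin = bialg_hom_linear[OF g]
private lemmas h_lin = bialg_hom_linear[OF h]

private lemma ga: "g \<in> ring_hom H C" and ha: "h \<in> ring_hom H C"
  using g h by (auto simp: bialg_hom_iff)

private abbreviation (input) core where "core \<equiv> coalgebra_core k H (equalizer H g h)"

lemma core_eq: "x \<in> core \<Longrightarrow> g x = h x"
  and core_carrier: "x \<in> core \<Longrightarrow> x \<in> carrier H"
  and core_comult: "x \<in> core \<Longrightarrow> comult H x \<in> tensor_span k H core"
  using coalgebra_core_subset[of k H "equalizer H g h"]
    coalgebra_core_comult_closed[of k H "equalizer H g h"]
  by (auto simp: equalizer_def comult_closed_set_def)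

text \<open>Maximality of the core: adjoining \<open>X\<close> to it must not lead outside the sets considered.\<close>

lemma coreI:
  assumes "X \<subseteq> carrier H" "\<And>x. x \<in> X \<Longrightarrow> g x = h x"
    "\<And>x. x \<in> X \<Longrightarrow> comult H x \<in> tensor_span k H (X \<union> core)"
    and "x \<in> X"
  shows "x \<in> core"
proof -
  have "comult_closed_set k H (X \<union> core)"
    unfolding comult_closed_set_def
  proof (intro conjI ballI)
    fix z assume "z \<in> X \<union> core"
    then show "comult H z \<in> tensor_span k H (X \<union> core)"
      using assms(3) tensor_span_mono[OF _ core_comult, of "X \<union> core"] by auto
  qed (use assms(1) core_carrier in auto)
  moreover have "X \<union> core \<subseteq> equalizer H g h"
  proof
    fix z assume "z \<in> X \<union> core"
    then have "z \<in> carrier H" "g z = h z" using assms(1,2) core_eq core_carrier by blast+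
    then show "z \<in> equalizer H g h" by (simp add: equalizer_def)
  qed
  ultimately have "X \<union> core \<subseteq> core" by (rule coalgebra_core_greatest)
  then show ?thesis using assms(4) by auto
qed

lemma core_add:
  assumes "x \<in> core" "y \<in> core"
  shows "x \<oplus>\<^bsub>H\<^esub> y \<in> core"
proof (rule coreI[of "{x \<oplus>\<^bsub>H\<^esub> y}"])
  have "comult H (x \<oplus>\<^bsub>H\<^esub> y) \<in> tensor_span k H core"
    using assms by (simp add: module_hom_add[OF comult_hom[OF H_coalg]] core_carrier core_comult tensor_span.add)
  then show "comult H z \<in> tensor_span k H ({x \<oplus>\<^bsub>H\<^esub> y} \<union> core)" if "z \<in> {x \<oplus>\<^bsub>H\<^esub> y}" for z
    using that tensor_span_mono[of core] by blast
qed (use assms in \<open>auto simp: core_carrier core_eq module_hom_add[OF g_lin] module_hom_add[OF h_lin]\<close>)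

lemma core_smult:
  assumes "c \<in> carrier k" "x \<in> core"
  shows "c \<odot>\<^bsub>H\<^esub> x \<in> core"
proof (rule coreI[of "{c \<odot>\<^bsub>H\<^esub> x}"])
  have "comult H (c \<odot>\<^bsub>H\<^esub> x) \<in> tensor_span k H core"
    using assms by (simp add: module_hom_smult[OF comult_hom[OF H_coalg]] core_carrier core_comult tensor_span.smult)
  then show "comult H z \<in> tensor_span k H ({c \<odot>\<^bsub>H\<^esub> x} \<union> core)" if "z \<in> {c \<odot>\<^bsub>H\<^esub> x}" for z
    using that tensor_span_mono[of core] by blast
qed (use assms in \<open>auto simp: core_carrier core_eq module_hom_smult[OF g_lin] module_hom_smult[OF h_lin]\<close>)

lemma core_one: "\<one>\<^bsub>H\<^esub> \<in> core"
  by (rule coreI[of "{\<one>\<^bsub>H\<^esub>}"])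
    (auto simp: comult_one[OF H] ring_hom_one[OF ga] ring_hom_one[OF ha] intro: tensor_span.pure)

lemma core_mult:
  assumes "x \<in> core" "y \<in> core"
  shows "x \<otimes>\<^bsub>H\<^esub> y \<in> core"
proof (rule coreI[of "{x \<otimes>\<^bsub>H\<^esub> y | x y. x \<in> core \<and> y \<in> core}"])
  show "comult H z \<in> tensor_span k H ({x \<otimes>\<^bsub>H\<^esub> y | x y. x \<in> core \<and> y \<in> core} \<union> core)"
    if "z \<in> {x \<otimes>\<^bsub>H\<^esub> y | x y. x \<in> core \<and> y \<in> core}" for z
  proof -
    obtain x y where z: "z = x \<otimes>\<^bsub>H\<^esub> y" "x \<in> core" "y \<in> core" using \<open>z \<in> _\<close> by auto
    then have "comult H z \<in> tensor_span k H {x \<otimes>\<^bsub>H\<^esub> y | x y. x \<in> core \<and> y \<in> core}"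
      using tensor_span_mult[OF H_alg _ core_comult core_comult, of x y] core_carrier
      by (simp add: comult_mult[OF H] subset_iff)
    then show ?thesis by (rule tensor_span_mono[rotated]) simp
  qed
qed (use assms in \<open>auto simp: core_carrier core_eq ring_hom_mult[OF ga] ring_hom_mult[OF ha]\<close>)

lemma core_submodule: "submodule core k H"
proof (rule H.submoduleI)
  show "core \<subseteq> carrier H" using core_carrier by auto
  show "\<zero>\<^bsub>H\<^esub> \<in> core" using core_smult[OF H.R.zero_closed core_one] by simp
  show "\<ominus>\<^bsub>H\<^esub> x \<in> core" if "x \<in> core" for x
    using core_smult[OF _ that, of "\<ominus>\<^bsub>k\<^esub> \<one>\<^bsub>k\<^esub>"] core_carrier[OF that]
    by (simp add: module_minus_eq[OF H_mod])
qed (simp_all add: core_add core_smult)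

definition core_retraction where
  "core_retraction = (SOME q. q \<in> module_hom k H H \<and> (\<forall>x\<in>carrier H. q x \<in> core) \<and> (\<forall>x\<in>core. q x = x))"

lemma core_retraction:
  "core_retraction \<in> module_hom k H H"
  "x \<in> carrier H \<Longrightarrow> core_retraction x \<in> core"
  "x \<in> core \<Longrightarrow> core_retraction x = x"
proof -
  have "\<exists>q. q \<in> module_hom k H H \<and> (\<forall>x\<in>carrier H. q x \<in> core) \<and> (\<forall>x\<in>core. q x = x)"
    using ex_linear_retraction[OF k H_mod core_submodule] by blast
  from someI_ex[OF this, folded core_retraction_def]
  show "core_retraction \<in> module_hom k H H"
    "x \<in> carrier H \<Longrightarrow> core_retraction x \<in> core"
    "x \<in> core \<Longrightarrow> core_retraction x = x" by blast+
qed

definition core_bialg :: "('a, 'b) bialg" where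
  "core_bialg = image_bialg k H core core_retraction"

lemma core_bialg_carrier: "carrier core_bialg = core"
  by (simp add: core_bialg_def image_bialg_simps)

text \<open>By \<open>core_comult\<close> the coproduct of an element of the core has all its legs in the core, so projecting
  them onto the core and including them back changes nothing.\<close>

lemma core_bialg_bialgebra:
  "bialgebra k core_bialg" "(\<lambda>x. x) \<in> bialg_hom k core_bialg H"
proof -
  let ?R = core_bialg and ?p = core_retraction
  note rs = image_bialg_simps[of k H core ?p, folded core_bialg_def]
  note p = core_retraction
  have R: "module k ?R" unfolding core_bialg_def by (rule image_bialg_is_module[OF H_mod core_submodule])
  have pR: "?p \<in> module_hom k H ?R" unfolding core_bialg_def by (rule image_bialg_proj_hom[OF p(1,2)])
  have i: "(\<lambda>x. x) \<in> module_hom k ?R H"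
    unfolding core_bialg_def by (rule image_bialg_incl_hom) (use core_carrier in auto)
  note T = tensor_is_module[OF R R] and TH = tensor_is_module[OF H_mod H_mod]
  have bR: "bilinear_map k H H (tensor k ?R ?R) (\<lambda>a b. pure_tensor k ?R ?R (?p a) (?p b))"
    by (rule tensor_map_bilinear[OF H_mod H_mod R R pR pR])
  have bH: "bilinear_map k H H (tensor k H H) (\<lambda>a b. pure_tensor k H H (?p a) (?p b))"
    by (rule tensor_map_bilinear[OF H_mod H_mod H_mod H_mod p(1) p(1)])
  have D: "comult ?R x = sweedler k (tensor k ?R ?R) H (\<lambda>a b. pure_tensor k ?R ?R (?p a) (?p b)) x" for x
    unfolding core_bialg_def by (rule image_bialg_comult)
  have Dh: "comult ?R \<in> module_hom k ?R (tensor k ?R ?R)"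
    by (rule module_hom_cong[OF module_hom_comp[OF i sweedler_hom[OF H_coalg T bR]] R]) (simp add: D)
  have span_closed: "t \<in> carrier (tensor k H H)" if "t \<in> tensor_span k H core" for t
    by (rule tensor_span_closed[OF H_mod _ that]) (use core_carrier in auto)
  have id_on_span: "tensor_lift k (tensor k H H) (\<lambda>a b. pure_tensor k H H (?p a) (?p b)) t = t"
    if "t \<in> tensor_span k H core" for t
    using that
  proof induction
    case (pure a b)
    then show ?case by (simp add: tensor_lift_pure[OF H_mod H_mod TH bH] core_carrier p(3))
  next
    case (add s t)
    then show ?case
      by (simp add: module_hom_add[OF tensor_lift_hom[OF H_mod H_mod TH bH]] span_closed)
  next
    case (smult c t)
    then show ?case
      by (simp add: module_hom_smult[OF tensor_lift_hom[OF H_mod H_mod TH bH]] span_closed)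
  qed
  have Di: "comult H x = sweedler k (tensor k H H) ?R (\<lambda>a b. pure_tensor k H H a b) x"
    if x: "x \<in> carrier ?R" for x
  proof -
    have xc: "x \<in> core" using x by (simp add: core_bialg_carrier)
    have bi: "bilinear_map k ?R ?R (tensor k H H) (pure_tensor k H H)"
      by (rule tensor_map_bilinear[OF R R H_mod H_mod i i])
    have "sweedler k (tensor k H H) ?R (pure_tensor k H H) x =
        tensor_lift k (tensor k H H) (pure_tensor k H H) (tensor_map k ?R ?R ?p ?p (comult H x))"
      by (simp add: D tensor_map_def)
    also have "\<dots> = sweedler k (tensor k H H) H (\<lambda>a b. pure_tensor k H H (?p a) (?p b)) x"
      by (rule tensor_lift_tensor_map[OF H_mod H_mod R R TH pR pR bi comult_closed[OF H_coalg core_carrier[OF xc]]])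
    also have "\<dots> = comult H x" by (rule id_on_span[OF core_comult[OF xc]])
    finally show ?thesis by simp
  qed
  show "bialgebra k core_bialg" "(\<lambda>x. x) \<in> bialg_hom k core_bialg H"
    by (rule bialgebra_of_injection[OF H R i pR _ _ _ _ _ Dh Di];
        simp add: rs p core_mult core_one core_carrier)+
qed

lemma bialg_hom_into_core:
  assumes B: "bialgebra k B" and f: "f \<in> bialg_hom k B H"
    and eq: "\<And>x. x \<in> carrier B \<Longrightarrow> g (f x) = h (f x)"
  shows "f \<in> bialg_hom k B core_bialg"
proof -
  let ?R = core_bialg and ?p = core_retraction
  note rs = image_bialg_simps[of k H core ?p, folded core_bialg_def]
  note p = core_retraction
  note CB = bialgebra_is_coalgebra[OF B] and MB = bialgebra_is_module[OF B]
  interpret B: k_algebra k B by (rule bialgebra_is_k_algebra[OF B])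
  have R: "module k ?R" by (rule bialgebra_is_module[OF core_bialg_bialgebra(1)])
  have fC: "f \<in> coalg_hom k B H" and fA: "f \<in> ring_hom B H" using f by (auto simp: bialg_hom_iff)
  note fl = coalg_hom_linear[OF fC]
  have im: "f x \<in> core" if "x \<in> carrier B" for x
  proof -
    have "f ` carrier B \<subseteq> core"
      by (rule coalgebra_core_greatest[OF comult_closed_image[OF fC CB H_mod]])
        (use eq module_hom_closed[OF fl] in \<open>auto simp: equalizer_def\<close>)
    then show ?thesis using that by auto
  qed
  have pR: "?p \<in> module_hom k H ?R" unfolding core_bialg_def by (rule image_bialg_proj_hom[OF p(1,2)])
  have flR: "f \<in> module_hom k B ?R"
    by (rule module_homI) (simp_all add: rs im module_hom_add[OF fl] module_hom_smult[OF fl])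
  have "f \<in> coalg_hom k B ?R"
  proof (rule coalg_homI[OF flR])
    fix x assume x: "x \<in> carrier B"
    show "counit ?R (f x) = counit B x" using fC x by (simp add: rs coalg_hom_def)
    note bR = tensor_map_bilinear[OF H_mod H_mod R R pR pR]
    note T = tensor_is_module[OF R R]
    have "comult ?R (f x) = sweedler k (tensor k ?R ?R) H (\<lambda>a b. pure_tensor k ?R ?R (?p a) (?p b)) (f x)"
      unfolding core_bialg_def by (rule image_bialg_comult)
    also have "\<dots> = sweedler k (tensor k ?R ?R) B (\<lambda>a b. pure_tensor k ?R ?R (?p (f a)) (?p (f b))) x"
      by (rule sweedler_coalg_hom[OF fC CB H_mod T bR x])
    also have "\<dots> = sweedler k (tensor k ?R ?R) B (\<lambda>a b. pure_tensor k ?R ?R (f a) (f b)) x"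
      by (rule sweedler_cong[OF CB T bilinear_map_comp[OF bR fl fl]
            tensor_map_bilinear[OF MB MB R R flR flR] _ x]) (simp add: p(3) im)
    finally show "comult ?R (f x) = \<dots>" .
  qed
  moreover have "f \<in> ring_hom B ?R"
    by (rule ring_hom_memI)
      (simp_all add: rs im p(3) core_mult core_one ring_hom_mult[OF fA] ring_hom_one[OF fA]
        module_hom_add[OF fl])
  ultimately show ?thesis by (simp add: bialg_hom_iff)
qed

text \<open>The inclusion \<open>i\<close> of the core satisfies \<open>g \<circ> i = h \<circ> i\<close>, so \<open>g \<circ> S \<circ> i = h \<circ> S \<circ> i\<close>. As
  \<open>S\<close> reverses coproducts, the image of the core under \<open>S\<close> is closed under coproducts, and maximality
  applies.\<close>

lemma antipode_core:
  assumes S: "antipode k H S" and x: "x \<in> core"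
  shows "S x \<in> core"
proof -
  let ?i = "\<lambda>x. x"
  have i: "?i \<in> coalg_hom k core_bialg H" using core_bialg_bialgebra(2) by (simp add: bialg_hom_iff)
  have eq: "g (S x) = h (S x)" if "x \<in> core" for x
    by (rule antipode_sandwich[OF bialgebra_is_coalgebra[OF core_bialg_bialgebra(1)] H_alg H_coalg
          bialgebra_is_k_algebra[OF C] S i i ga g_lin ha h_lin])
      (simp_all add: core_bialg_carrier core_eq that)
  have "S ` core \<subseteq> core"
    by (rule coalgebra_core_greatest[OF comult_closed_flip[OF H_mod coalgebra_core_comult_closed
            antipode_linear[OF S] antipode_comult[OF H S]]])
      (use eq core_carrier module_hom_closed[OF antipode_linear[OF S]] in \<open>auto simp: equalizer_def\<close>)
  then show ?thesis using x by auto
qed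

text \<open>The previous argument, with the multiplications of \<open>H\<close> and \<open>C\<close> reversed.\<close>

lemma inverse_antipode_core:
  assumes S: "antipode k H S" and bij: "bij_betw S (carrier H) (carrier H)" and x: "x \<in> core"
  shows "inv_into (carrier H) S x \<in> core"
proof -
  let ?i = "\<lambda>x. x" and ?T = "inv_into (carrier H) S"
  note T = inverse_antipode[OF H S bij]
  have Tl: "?T \<in> module_hom k H H"
    using antipode_linear[OF T(1)] by (simp add: module_hom_def)
  have i: "?i \<in> coalg_hom k core_bialg (opp H)"
    using core_bialg_bialgebra(2) by (simp add: bialg_hom_iff opp_coalg_hom)
  have eq: "g (?T x) = h (?T x)" if "x \<in> core" for x
    by (rule antipode_sandwich[OF bialgebra_is_coalgebra[OF core_bialg_bialgebra(1)] opp_k_algebra[OF H_alg]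
          opp_coalgebra[OF H_coalg] opp_k_algebra[OF bialgebra_is_k_algebra[OF C]] T(1) i i
          opp_hom(1)[OF ga] opp_hom(2)[OF g_lin] opp_hom(1)[OF ha] opp_hom(2)[OF h_lin]])
      (simp_all add: core_bialg_carrier core_eq that)
  have "?T ` core \<subseteq> core"
    by (rule coalgebra_core_greatest[OF comult_closed_flip[OF H_mod coalgebra_core_comult_closed Tl T(3)]])
      (use eq core_carrier module_hom_closed[OF Tl] in \<open>auto simp: equalizer_def\<close>)
  then show ?thesis using x by auto
qed

lemma core_antipode:
  assumes S: "antipode k H S"
  shows "antipode k core_bialg S"
proof (rule antipode_of_injection[OF H core_bialg_bialgebra _ S])
  show "S \<in> module_hom k core_bialg core_bialg"
    using antipode_core[OF S] core_carrier antipode_linear[OF S]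
    by (auto simp: module_hom_def core_bialg_def image_bialg_simps)
qed simp_all

lemma core_hopf:
  assumes "hopf_algebra k H"
  shows "hopf_algebra k core_bialg"
  using assms core_antipode core_bialg_bialgebra(1) by (auto simp: hopf_algebra_def)

lemma core_shopf:
  assumes "shopf_algebra k H"
  shows "shopf_algebra k core_bialg"
proof -
  obtain S where S: "antipode k H S" and bij: "bij_betw S (carrier H) (carrier H)"
    using assms by (auto simp: shopf_algebra_def)
  let ?T = "inv_into (carrier H) S"
  have ST: "S (?T x) = x" if "x \<in> carrier H" for x
    using bij that by (simp add: bij_betw_def f_inv_into_f)
  have "bij_betw S core core"
    unfolding bij_betw_def
  proof (intro conjI equalityI subsetI)
    show "inj_on S core" using bij core_carrier by (auto simp: bij_betw_def intro: inj_on_subset)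
    show "x \<in> core" if "x \<in> S ` core" for x using that antipode_core[OF S] by auto
    show "x \<in> S ` core" if "x \<in> core" for x
      using inverse_antipode_core[OF S bij that] ST[OF core_carrier[OF that]] by (metis imageI)
  qed
  then show ?thesis
    using core_antipode[OF S] core_bialg_bialgebra(1) by (auto simp: shopf_algebra_def core_bialg_carrier)
qed

end

text \<open>The unit factors through the core, so the core is a test object for its universal property. The
  resulting \<open>\<phi>: H \<rightarrow> core\<close>, read as an endomorphism of \<open>H\<close>, fixes the image of \<open>\<eta>\<close> and is
  therefore the identity, which puts all of \<open>H\<close> into the core.\<close>

theorem left_adjoint_unit_epi:
  fixes P :: "('a, 'u) bialg \<Rightarrow> bool" and k :: "('a, 'r) ring_scheme"
  assumes k: "field k" and B: "bialgebra k B" and unit: "left_adjoint_unit P k B H \<eta>"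
    and P: "P H \<Longrightarrow> bialgebra k H" and Q: "\<And>C. Q C \<Longrightarrow> bialgebra k C"
    and core: "\<And>(C :: ('a, 'c) bialg) g h. bialgebra k C \<Longrightarrow> g \<in> bialg_hom k H C \<Longrightarrow> h \<in> bialg_hom k H C \<Longrightarrow>
      P (core_bialg k H g h)"
  shows "epi_in (Q :: ('a, 'c) bialg \<Rightarrow> bool) k B H \<eta>"
  unfolding epi_in_def
proof (intro conjI allI impI ballI)
  have PH: "P H" and \<eta>: "\<eta> \<in> bialg_hom k B H" using unit by (auto simp: left_adjoint_unit_def)
  have H: "bialgebra k H" by (rule P[OF PH])
  show "\<eta> \<in> bialg_hom k B H" by (rule \<eta>)
  fix C :: "('a, 'c) bialg" and g h y
  assume a: "Q C \<and> g \<in> bialg_hom k H C \<and> h \<in> bialg_hom k H C \<and> (\<forall>x\<in>carrier B. g (\<eta> x) = h (\<eta> x))"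
    and y: "y \<in> carrier H"
  have C: "bialgebra k C" and g: "g \<in> bialg_hom k H C" and h: "h \<in> bialg_hom k H C"
    and eq: "\<And>x. x \<in> carrier B \<Longrightarrow> g (\<eta> x) = h (\<eta> x)" using a Q by auto
  let ?R = "core_bialg k H g h"
  note hyps = k H C g h
  have "\<eta> \<in> bialg_hom k B ?R" by (rule bialg_hom_into_core[OF hyps B \<eta> eq])
  then obtain \<phi> where \<phi>: "\<phi> \<in> bialg_hom k H ?R" "\<And>x. x \<in> carrier B \<Longrightarrow> \<phi> (\<eta> x) = \<eta> x"
    using unit core[OF C g h] unfolding left_adjoint_unit_def by blast
  have "\<phi> \<in> bialg_hom k H H"
    using bialg_hom_comp[OF \<phi>(1) core_bialg_bialgebra(2)[OF hyps] H core_bialg_bialgebra(1)[OF hyps] H] .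
  moreover obtain \<psi> where "\<And>\<chi>. \<chi> \<in> bialg_hom k H H \<Longrightarrow> (\<forall>x\<in>carrier B. \<chi> (\<eta> x) = \<eta> x) \<Longrightarrow>
      (\<forall>y\<in>carrier H. \<chi> y = \<psi> y)"
    using unit PH \<eta> unfolding left_adjoint_unit_def by blast
  ultimately have "\<phi> y = y" using \<phi>(2) bialg_hom_id[OF H] y by metis
  then have "y \<in> carrier ?R" using module_hom_closed[OF bialg_hom_linear[OF \<phi>(1)] y] by simp
  then show "g y = h y" using core_eq[OF hyps] by (simp add: core_bialg_carrier[OF hyps])
qed


section \<open>The quotient by the ideal of the differences of two morphisms\<close>

inductive_set difference_ideal ::
  "('b, 'm) ring_scheme \<Rightarrow> 'c set \<Rightarrow> ('c \<Rightarrow> 'b) \<Rightarrow> ('c \<Rightarrow> 'b) \<Rightarrow> 'b set"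
  for H :: "('b, 'm) ring_scheme" and X :: "'c set" and g h :: "'c \<Rightarrow> 'b" where
  gen: "a \<in> carrier H \<Longrightarrow> b \<in> carrier H \<Longrightarrow> c \<in> X \<Longrightarrow>
    a \<otimes>\<^bsub>H\<^esub> (g c \<ominus>\<^bsub>H\<^esub> h c) \<otimes>\<^bsub>H\<^esub> b \<in> difference_ideal H X g h"
| add: "x \<in> difference_ideal H X g h \<Longrightarrow> y \<in> difference_ideal H X g h \<Longrightarrow>
    x \<oplus>\<^bsub>H\<^esub> y \<in> difference_ideal H X g h"

context
  fixes k :: "('a, 'r) ring_scheme" and H :: "('a, 'b) bialg" and C :: "('a, 'c) bialg"
    and g h :: "'c \<Rightarrow> 'b"
  assumes k: "field k" and H: "bialgebra k H" and C: "bialgebra k C"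
    and g: "g \<in> bialg_hom k C H" and h: "h \<in> bialg_hom k C H"
begin

interpretation H: k_algebra k H by (rule bialgebra_is_k_algebra[OF H])
interpretation C: k_algebra k C by (rule bialgebra_is_k_algebra[OF C])

private lemmas alg_H = bialgebra_is_k_algebra[OF H]
private lemmas coalg_H = bialgebra_is_coalgebra[OF H]
private lemmas CC = bialgebra_is_coalgebra[OF C]
private lemmas mod_H = H.module_axioms
private lemmas mult_H = k_algebra_bilinear[OF alg_H]
private lemmas lin_g = bialg_hom_linear[OF g]
private lemmas lin_h = bialg_hom_linear[OF h]
private lemmas gc = module_hom_closed[OF lin_g]
private lemmas hc = module_hom_closed[OF lin_h]

private abbreviation (input) I where "I \<equiv> difference_ideal H (carrier C) g h"

private lemma gC: "g \<in> coalg_hom k C H" and hC: "h \<in> coalg_hom k C H"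
  using g h by (auto simp: bialg_hom_iff)

lemma difference_ideal_carrier: "x \<in> I \<Longrightarrow> x \<in> carrier H"
  by (induction rule: difference_ideal.induct) (simp_all add: gc hc)

lemma difference_ideal_mult_left:
  assumes "x \<in> I" "y \<in> carrier H"
  shows "y \<otimes>\<^bsub>H\<^esub> x \<in> I"
  using assms(1)
proof induction
  case (gen a b c)
  have "y \<otimes>\<^bsub>H\<^esub> (a \<otimes>\<^bsub>H\<^esub> (g c \<ominus>\<^bsub>H\<^esub> h c) \<otimes>\<^bsub>H\<^esub> b) = (y \<otimes>\<^bsub>H\<^esub> a) \<otimes>\<^bsub>H\<^esub> (g c \<ominus>\<^bsub>H\<^esub> h c) \<otimes>\<^bsub>H\<^esub> b"
    using gen assms(2) by (simp add: H.m_assoc gc hc)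
  then show ?case using gen assms(2) by (simp add: difference_ideal.gen)
next
  case (add u v)
  then show ?case using assms(2) by (simp add: H.r_distr difference_ideal_carrier difference_ideal.add)
qed

lemma difference_ideal_mult_right:
  assumes "x \<in> I" "y \<in> carrier H"
  shows "x \<otimes>\<^bsub>H\<^esub> y \<in> I"
  using assms(1)
proof induction
  case (gen a b c)
  have "a \<otimes>\<^bsub>H\<^esub> (g c \<ominus>\<^bsub>H\<^esub> h c) \<otimes>\<^bsub>H\<^esub> b \<otimes>\<^bsub>H\<^esub> y = a \<otimes>\<^bsub>H\<^esub> (g c \<ominus>\<^bsub>H\<^esub> h c) \<otimes>\<^bsub>H\<^esub> (b \<otimes>\<^bsub>H\<^esub> y)"
    using gen assms(2) by (simp add: H.m_assoc gc hc)
  then show ?case using gen assms(2) by (simp add: difference_ideal.gen)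
next
  case (add u v)
  then show ?case using assms(2) by (simp add: H.l_distr difference_ideal_carrier difference_ideal.add)
qed

lemma difference_ideal_generator: "c \<in> carrier C \<Longrightarrow> g c \<ominus>\<^bsub>H\<^esub> h c \<in> I"
  using difference_ideal.gen[of "\<one>\<^bsub>H\<^esub>" H "\<one>\<^bsub>H\<^esub>" c "carrier C" g h] by (simp add: gc hc)

lemma difference_ideal_smult:
  assumes "c \<in> carrier k" "x \<in> I"
  shows "c \<odot>\<^bsub>H\<^esub> x \<in> I"
  using difference_ideal_mult_left[OF assms(2), of "c \<odot>\<^bsub>H\<^esub> \<one>\<^bsub>H\<^esub>"] assms difference_ideal_carrier
  by (simp add: H.smult_mult_left)

lemma difference_ideal_submodule: "submodule I k H"
proof (rule H.submoduleI)
  show "I \<subseteq> carrier H" using difference_ideal_carrier by auto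
  show "\<zero>\<^bsub>H\<^esub> \<in> I" using difference_ideal_smult[OF H.R.zero_closed difference_ideal_generator[OF C.zero_closed]] by (simp add: gc hc)
  show "\<ominus>\<^bsub>H\<^esub> x \<in> I" if "x \<in> I" for x
    using difference_ideal_smult[OF _ that, of "\<ominus>\<^bsub>k\<^esub> \<one>\<^bsub>k\<^esub>"] difference_ideal_carrier[OF that] by (simp add: module_minus_eq[OF mod_H])
qed (simp_all add: difference_ideal.add difference_ideal_smult)

text \<open>The ideal is spanned by the differences of \<open>a (g c) b\<close> and \<open>a (h c) b\<close>.\<close>

lemma difference_ideal_linear_kernel:
  assumes D: "module k D" and f: "f \<in> module_hom k H D"
    and gen: "\<And>a b c. a \<in> carrier H \<Longrightarrow> b \<in> carrier H \<Longrightarrow> c \<in> carrier C \<Longrightarrow>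
      f (a \<otimes>\<^bsub>H\<^esub> g c \<otimes>\<^bsub>H\<^esub> b) = f (a \<otimes>\<^bsub>H\<^esub> h c \<otimes>\<^bsub>H\<^esub> b)"
    and x: "x \<in> I"
  shows "f x = \<zero>\<^bsub>D\<^esub>"
proof -
  interpret D: module k D by (rule D)
  show ?thesis using x
  proof induction
    case (gen a b c)
    have "a \<otimes>\<^bsub>H\<^esub> (g c \<ominus>\<^bsub>H\<^esub> h c) \<otimes>\<^bsub>H\<^esub> b = a \<otimes>\<^bsub>H\<^esub> g c \<otimes>\<^bsub>H\<^esub> b \<ominus>\<^bsub>H\<^esub> a \<otimes>\<^bsub>H\<^esub> h c \<otimes>\<^bsub>H\<^esub> b"
      using gen by (simp add: a_minus_def H.l_distr H.r_distr H.l_minus H.r_minus gc hc)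
    then show ?case
      using gen assms(3)[OF gen] module_hom_closed[OF f]
      by (simp add: module_hom_minus[OF f mod_H D] gc hc module_minus_self[OF D])
  next
    case (add u v)
    then show ?case by (simp add: module_hom_add[OF f] difference_ideal_carrier)
  qed
qed

text \<open>The operator under \<open>SOME\<close> is a linear retraction onto the ideal, so this is the projection along the
  ideal onto a complement.\<close>

definition quot_proj :: "'b \<Rightarrow> 'b" where
  "quot_proj x = x \<ominus>\<^bsub>H\<^esub> (SOME q. q \<in> module_hom k H H \<and> (\<forall>x\<in>carrier H. q x \<in> I) \<and> (\<forall>x\<in>I. q x = x)) x"

private abbreviation (input) p where "p \<equiv> quot_proj"

lemma quot_proj:
  shows quot_proj_hom: "p \<in> module_hom k H H"
    and quot_proj_idem: "x \<in> carrier H \<Longrightarrow> p (p x) = p x"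
    and quot_proj_diff: "x \<in> carrier H \<Longrightarrow> x \<ominus>\<^bsub>H\<^esub> p x \<in> I"
    and quot_proj_zero: "x \<in> I \<Longrightarrow> p x = \<zero>\<^bsub>H\<^esub>"
proof -
  have "\<exists>q. q \<in> module_hom k H H \<and> (\<forall>x\<in>carrier H. q x \<in> I) \<and> (\<forall>x\<in>I. q x = x)"
    using ex_linear_retraction[OF k mod_H difference_ideal_submodule] by blast
  from someI_ex[OF this] obtain q where q: "q \<in> module_hom k H H" "\<And>x. x \<in> carrier H \<Longrightarrow> q x \<in> I"
    "\<And>x. x \<in> I \<Longrightarrow> q x = x" and p: "p = (\<lambda>x. x \<ominus>\<^bsub>H\<^esub> q x)"
    unfolding quot_proj_def by blast
  note qc = module_hom_closed[OF q(1)]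
  show ph: "p \<in> module_hom k H H" unfolding p
    by (rule module_homI)
      (simp_all add: qc module_hom_add[OF q(1)] module_hom_smult[OF q(1)] a_minus_def H.minus_add
        H.M.add.m_ac H.smult_r_distr H.smult_r_minus)
  show z: "p x = \<zero>\<^bsub>H\<^esub>" if "x \<in> I" for x
    using that difference_ideal_carrier[OF that] by (simp add: p q(3) a_minus_def H.M.r_neg)
  show "p (p x) = p x" if x: "x \<in> carrier H" for x
  proof -
    have "p (p x) = p (x \<ominus>\<^bsub>H\<^esub> q x)" by (simp add: p)
    also have "\<dots> = p x" using x z[OF q(2)[OF x]] module_hom_closed[OF ph x]
      by (simp add: module_hom_minus[OF ph mod_H mod_H] qc module_minus_zero[OF mod_H])
    finally show ?thesis .
  qed
  show "x \<ominus>\<^bsub>H\<^esub> p x \<in> I" if x: "x \<in> carrier H" for x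
  proof -
    have "x \<ominus>\<^bsub>H\<^esub> p x = q x"
      using x by (simp add: p a_minus_def H.minus_add qc H.M.r_neg1 H.M.r_neg2 H.M.minus_minus)
    then show ?thesis using q(2)[OF x] by simp
  qed
qed

private lemmas pc = module_hom_closed[OF quot_proj_hom]

lemma linear_factors_quot_proj:
  assumes D: "module k D" and f: "f \<in> module_hom k H D" and z: "\<And>x. x \<in> I \<Longrightarrow> f x = \<zero>\<^bsub>D\<^esub>"
    and x: "x \<in> carrier H"
  shows "f (p x) = f x"
proof -
  have "f x \<ominus>\<^bsub>D\<^esub> f (p x) = \<zero>\<^bsub>D\<^esub>"
    using z[OF quot_proj_diff[OF x]] x by (simp add: module_hom_minus[OF f mod_H D] pc)
  then show ?thesis
    using module_eq_if_minus_zero[OF D] module_hom_closed[OF f] x pc by metis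
qed

lemma quot_proj_eq_iff:
  assumes "x \<in> carrier H" "y \<in> carrier H"
  shows "p x = p y \<longleftrightarrow> x \<ominus>\<^bsub>H\<^esub> y \<in> I"
proof
  assume "x \<ominus>\<^bsub>H\<^esub> y \<in> I"
  then have "p x \<ominus>\<^bsub>H\<^esub> p y = \<zero>\<^bsub>H\<^esub>"
    using quot_proj_zero assms by (simp add: module_hom_minus[OF quot_proj_hom mod_H mod_H, symmetric])
  then show "p x = p y" using module_eq_if_minus_zero[OF mod_H] assms pc by metis
next
  assume "p x = p y"
  then have "p (x \<ominus>\<^bsub>H\<^esub> y) = \<zero>\<^bsub>H\<^esub>"
    using assms pc by (simp add: module_hom_minus[OF quot_proj_hom mod_H mod_H] module_minus_self[OF mod_H])
  then show "x \<ominus>\<^bsub>H\<^esub> y \<in> I" using quot_proj_diff[of "x \<ominus>\<^bsub>H\<^esub> y"] assms by (simp add: module_minus_zero[OF mod_H])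
qed

lemma quot_proj_g_h:
  assumes "a \<in> carrier H" "b \<in> carrier H" "c \<in> carrier C"
  shows "p (a \<otimes>\<^bsub>H\<^esub> g c \<otimes>\<^bsub>H\<^esub> b) = p (a \<otimes>\<^bsub>H\<^esub> h c \<otimes>\<^bsub>H\<^esub> b)"
proof -
  have "a \<otimes>\<^bsub>H\<^esub> (g c \<ominus>\<^bsub>H\<^esub> h c) \<otimes>\<^bsub>H\<^esub> b = a \<otimes>\<^bsub>H\<^esub> g c \<otimes>\<^bsub>H\<^esub> b \<ominus>\<^bsub>H\<^esub> a \<otimes>\<^bsub>H\<^esub> h c \<otimes>\<^bsub>H\<^esub> b"
    using assms by (simp add: a_minus_def H.l_distr H.r_distr H.l_minus H.r_minus gc hc)
  then show ?thesis
    using difference_ideal.gen[of a H b c "carrier C" g h] assms by (simp add: quot_proj_eq_iff gc hc)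
qed

definition quot_bialg :: "('a, 'b) bialg" where
  "quot_bialg = image_bialg k H (p ` carrier H) p"

text \<open>The ideal is a coideal since \<open>g\<close> and \<open>h\<close> respect coproducts: the image of \<open>a (g c) b\<close> in the tensor
  square of the quotient is the sum of all \<open>p(a\<^sub>1 (g c\<^sub>1) b\<^sub>1) \<otimes> p(a\<^sub>2 (g c\<^sub>2) b\<^sub>2)\<close>, where each \<open>g\<close>
  may be replaced by \<open>h\<close>.\<close>

lemma quot_bialg_bialgebra:
  "bialgebra k quot_bialg" "p \<in> bialg_hom k H quot_bialg"
proof -
  let ?N = "p ` carrier H" and ?R = quot_bialg
  note rs = image_bialg_simps[of k H ?N p, folded quot_bialg_def]
  have N: "submodule ?N k H"
  proof (rule H.submoduleI)
    show "\<zero>\<^bsub>H\<^esub> \<in> ?N" using module_hom_zero[OF quot_proj_hom mod_H mod_H] by (metis H.M.zero_closed imageI)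
    show "\<ominus>\<^bsub>H\<^esub> x \<in> ?N" if "x \<in> ?N" for x
      using that pc by (auto simp: module_minus_eq[OF mod_H] module_hom_smult[OF quot_proj_hom, symmetric])
    show "x \<oplus>\<^bsub>H\<^esub> y \<in> ?N" if "x \<in> ?N" "y \<in> ?N" for x y
      using that by (auto simp: module_hom_add[OF quot_proj_hom, symmetric])
    show "c \<odot>\<^bsub>H\<^esub> x \<in> ?N" if "c \<in> carrier k" "x \<in> ?N" for c x
      using that by (auto simp: module_hom_smult[OF quot_proj_hom, symmetric])
  qed (use pc in auto)
  have R: "module k ?R" unfolding quot_bialg_def by (rule image_bialg_is_module[OF mod_H N])
  have pR: "p \<in> module_hom k H ?R"
    unfolding quot_bialg_def by (rule image_bialg_proj_hom[OF quot_proj_hom]) simp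
  note T = tensor_is_module[OF R R]
  let ?q = "pure_tensor k ?R ?R"
  have bR: "bilinear_map k H H (tensor k ?R ?R) (\<lambda>a b. ?q (p a) (p b))"
    by (rule tensor_map_bilinear[OF mod_H mod_H R R pR pR])
  define D where "D = sweedler k (tensor k ?R ?R) H (\<lambda>a b. ?q (p a) (p b))"
  have D: "comult ?R x = D x" for x
    unfolding D_def quot_bialg_def by (rule image_bialg_comult)
  have Dh: "D \<in> module_hom k H (tensor k ?R ?R)" unfolding D_def by (rule sweedler_hom[OF coalg_H T bR])
  have DI: "D x = \<zero>\<^bsub>tensor k ?R ?R\<^esub>" if "x \<in> I" for x
  proof (rule difference_ideal_linear_kernel[OF T Dh _ that])
    fix a d c assume a: "a \<in> carrier H" and d: "d \<in> carrier H" and c: "c \<in> carrier C"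
    \<comment> \<open>The sum over the rightmost factor \<open>d\<close>, with the legs of the left and middle factors as parameters.\<close>
    define W where "W u v = sweedler k (tensor k ?R ?R) H (\<lambda>s t. ?q (p (u \<otimes>\<^bsub>H\<^esub> s)) (p (v \<otimes>\<^bsub>H\<^esub> t))) d" for u v
    have bi: "bilinear_map k H H (tensor k ?R ?R) (\<lambda>s t. ?q (p (u \<otimes>\<^bsub>H\<^esub> s)) (p (v \<otimes>\<^bsub>H\<^esub> t)))"
      if "u \<in> carrier H" "v \<in> carrier H" for u v
      by (rule bilinear_map_comp[OF bR bilinear_map_right[OF mult_H that(1)] bilinear_map_right[OF mult_H that(2)]])
    have bo: "bilinear_map k H H (tensor k ?R ?R) (\<lambda>u v. ?q (p (u \<otimes>\<^bsub>H\<^esub> s)) (p (v \<otimes>\<^bsub>H\<^esub> t)))"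
      if "s \<in> carrier H" "t \<in> carrier H" for s t
      by (rule bilinear_map_comp[OF bR bilinear_map_left[OF mult_H that(1)] bilinear_map_left[OF mult_H that(2)]])
    have bW: "bilinear_map k H H (tensor k ?R ?R) W"
      unfolding W_def by (rule tensor_lift_param_bilinear[OF mod_H mod_H T mod_H mod_H comult_closed[OF coalg_H d] bi bo])
    have Wi: "bilinear_map k H H (tensor k ?R ?R) (\<lambda>u v. W (e \<otimes>\<^bsub>H\<^esub> u) (e' \<otimes>\<^bsub>H\<^esub> v))"
      if "e \<in> carrier H" "e' \<in> carrier H" for e e'
      by (rule bilinear_map_comp[OF bW bilinear_map_right[OF mult_H that(1)] bilinear_map_right[OF mult_H that(2)]])
    have Wo: "bilinear_map k H H (tensor k ?R ?R) (\<lambda>e e'. W (e \<otimes>\<^bsub>H\<^esub> u) (e' \<otimes>\<^bsub>H\<^esub> v))"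
      if "u \<in> carrier H" "v \<in> carrier H" for u v
      by (rule bilinear_map_comp[OF bW bilinear_map_left[OF mult_H that(1)] bilinear_map_left[OF mult_H that(2)]])
    have expand: "D (a \<otimes>\<^bsub>H\<^esub> f c \<otimes>\<^bsub>H\<^esub> d) = sweedler k (tensor k ?R ?R) H (\<lambda>e e'.
        sweedler k (tensor k ?R ?R) C (\<lambda>u v. W (e \<otimes>\<^bsub>H\<^esub> f u) (e' \<otimes>\<^bsub>H\<^esub> f v)) c) a"
      if f: "f \<in> coalg_hom k C H" for f
    proof -
      note fc = module_hom_closed[OF coalg_hom_linear[OF f]]
      have "D (a \<otimes>\<^bsub>H\<^esub> f c \<otimes>\<^bsub>H\<^esub> d) = sweedler k (tensor k ?R ?R) H W (a \<otimes>\<^bsub>H\<^esub> f c)"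
        unfolding D_def W_def using a c d fc by (intro sweedler_mult[OF H T bR]) auto
      also have "\<dots> = sweedler k (tensor k ?R ?R) H (\<lambda>e e'.
          sweedler k (tensor k ?R ?R) H (\<lambda>u v. W (e \<otimes>\<^bsub>H\<^esub> u) (e' \<otimes>\<^bsub>H\<^esub> v)) (f c)) a"
        by (rule sweedler_mult[OF H T bW a fc[OF c]])
      also have "\<dots> = sweedler k (tensor k ?R ?R) H (\<lambda>e e'.
          sweedler k (tensor k ?R ?R) C (\<lambda>u v. W (e \<otimes>\<^bsub>H\<^esub> f u) (e' \<otimes>\<^bsub>H\<^esub> f v)) c) a"
      proof (rule sweedler_cong[OF coalg_H T tensor_lift_param_bilinear[OF mod_H mod_H T mod_H mod_H comult_closed[OF coalg_H fc[OF c]] Wi Wo]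
            tensor_lift_param_bilinear[OF C.module_axioms C.module_axioms T mod_H mod_H comult_closed[OF CC c]] _ a])
        fix e e' assume e: "e \<in> carrier H" "e' \<in> carrier H"
        show "bilinear_map k C C (tensor k ?R ?R) (\<lambda>u v. W (e \<otimes>\<^bsub>H\<^esub> f u) (e' \<otimes>\<^bsub>H\<^esub> f v))"
          by (rule bilinear_map_comp[OF Wi[OF e] coalg_hom_linear[OF f] coalg_hom_linear[OF f]])
        show "sweedler k (tensor k ?R ?R) H (\<lambda>u v. W (e \<otimes>\<^bsub>H\<^esub> u) (e' \<otimes>\<^bsub>H\<^esub> v)) (f c) =
          sweedler k (tensor k ?R ?R) C (\<lambda>u v. W (e \<otimes>\<^bsub>H\<^esub> f u) (e' \<otimes>\<^bsub>H\<^esub> f v)) c"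
          by (rule sweedler_coalg_hom[OF f CC mod_H T Wi[OF e] c])
      next
        fix u v assume "u \<in> carrier C" "v \<in> carrier C"
        then show "bilinear_map k H H (tensor k ?R ?R) (\<lambda>e e'. W (e \<otimes>\<^bsub>H\<^esub> f u) (e' \<otimes>\<^bsub>H\<^esub> f v))"
          by (intro Wo fc)
      qed
      finally show ?thesis .
    qed
    have WW: "W (e \<otimes>\<^bsub>H\<^esub> g u) (e' \<otimes>\<^bsub>H\<^esub> g v) = W (e \<otimes>\<^bsub>H\<^esub> h u) (e' \<otimes>\<^bsub>H\<^esub> h v)"
      if e: "e \<in> carrier H" "e' \<in> carrier H" and uv: "u \<in> carrier C" "v \<in> carrier C" for e e' u v
      unfolding W_def
      by (rule sweedler_cong[OF coalg_H T bi bi _ d])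
        (use e uv in \<open>simp_all add: gc hc quot_proj_g_h\<close>)
    have Wf: "bilinear_map k C C (tensor k ?R ?R) (\<lambda>u v. W (e \<otimes>\<^bsub>H\<^esub> f u) (e' \<otimes>\<^bsub>H\<^esub> f v))"
      if "e \<in> carrier H" "e' \<in> carrier H" "f \<in> module_hom k C H" for e e' f
      by (rule bilinear_map_comp[OF Wi[OF that(1,2)] that(3,3)])
    have Wf': "bilinear_map k H H (tensor k ?R ?R) (\<lambda>e e'.
        sweedler k (tensor k ?R ?R) C (\<lambda>u v. W (e \<otimes>\<^bsub>H\<^esub> f u) (e' \<otimes>\<^bsub>H\<^esub> f v)) c)"
      if f: "f \<in> module_hom k C H" for f
      by (rule tensor_lift_param_bilinear[OF C.module_axioms C.module_axioms T mod_H mod_H comult_closed[OF CC c]])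
        (intro Wf f Wo module_hom_closed[OF f]; assumption)+
    show "D (a \<otimes>\<^bsub>H\<^esub> g c \<otimes>\<^bsub>H\<^esub> d) = D (a \<otimes>\<^bsub>H\<^esub> h c \<otimes>\<^bsub>H\<^esub> d)"
      unfolding expand[OF gC] expand[OF hC]
    proof (rule sweedler_cong[OF coalg_H T Wf'[OF lin_g] Wf'[OF lin_h] _ a])
      fix e e' assume e: "e \<in> carrier H" "e' \<in> carrier H"
      show "sweedler k (tensor k ?R ?R) C (\<lambda>u v. W (e \<otimes>\<^bsub>H\<^esub> g u) (e' \<otimes>\<^bsub>H\<^esub> g v)) c =
        sweedler k (tensor k ?R ?R) C (\<lambda>u v. W (e \<otimes>\<^bsub>H\<^esub> h u) (e' \<otimes>\<^bsub>H\<^esub> h v)) c"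
        by (rule sweedler_cong[OF CC T Wf[OF e lin_g] Wf[OF e lin_h] WW[OF e] c])
    qed
  qed
  have Dp: "D (p x) = D x" if "x \<in> carrier H" for x
    by (rule linear_factors_quot_proj[OF T Dh _ that]) (rule DI)
  have EI: "counit H x = \<zero>\<^bsub>self_module k\<^esub>" if "x \<in> I" for x
  proof (rule difference_ideal_linear_kernel[OF self_module_is_module[OF H.R.is_cring] counit_hom[OF coalg_H] _ that])
    fix a b c assume "a \<in> carrier H" "b \<in> carrier H" "c \<in> carrier C"
    then show "counit H (a \<otimes>\<^bsub>H\<^esub> g c \<otimes>\<^bsub>H\<^esub> b) = counit H (a \<otimes>\<^bsub>H\<^esub> h c \<otimes>\<^bsub>H\<^esub> b)"
      using gC hC by (simp add: counit_mult[OF H] gc hc coalg_hom_def)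
  qed
  have Ep: "counit H (p x) = counit H x" if "x \<in> carrier H" for x
    by (rule linear_factors_quot_proj[OF self_module_is_module[OF H.R.is_cring] counit_hom[OF coalg_H] _ that])
      (rule EI)
  have mult: "p (x \<otimes>\<^bsub>H\<^esub> y) = p (p x \<otimes>\<^bsub>H\<^esub> p y)" if x: "x \<in> carrier H" and y: "y \<in> carrier H" for x y
  proof -
    have "p (x \<otimes>\<^bsub>H\<^esub> y) = p (p x \<otimes>\<^bsub>H\<^esub> y)"
      using difference_ideal_mult_right[OF quot_proj_diff[OF x] y] x y pc
      by (simp add: quot_proj_eq_iff a_minus_def H.l_distr H.l_minus)
    also have "\<dots> = p (p x \<otimes>\<^bsub>H\<^esub> p y)"
      using difference_ideal_mult_left[OF quot_proj_diff[OF y] pc[OF x]] x y pc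
      by (simp add: quot_proj_eq_iff a_minus_def H.r_distr H.r_minus)
    finally show ?thesis .
  qed
  show "bialgebra k quot_bialg" "p \<in> bialg_hom k H quot_bialg"
    by (rule bialgebra_of_surjection[OF H R pR];
        simp add: rs D Dp Ep mult[symmetric]; simp add: D_def)+
qed

lemma quot_bialg_simps:
  "carrier quot_bialg = p ` carrier H" "counit quot_bialg = counit H" "add quot_bialg = add H"
  "smult quot_bialg = smult H"
  by (simp_all add: quot_bialg_def image_bialg_simps)

lemma quot_proj_eq: "c \<in> carrier C \<Longrightarrow> p (g c) = p (h c)"
  by (simp add: quot_proj_eq_iff gc hc difference_ideal_generator)

lemma bialg_hom_from_quot:
  assumes B: "bialgebra k B" and f: "f \<in> bialg_hom k H B"
    and eq: "\<And>c. c \<in> carrier C \<Longrightarrow> f (g c) = f (h c)"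
  shows "f \<in> bialg_hom k quot_bialg B" and "\<And>x. x \<in> carrier H \<Longrightarrow> f (p x) = f x"
proof -
  let ?R = quot_bialg
  note R = bialgebra_is_module[OF quot_bialg_bialgebra(1)]
  note MB = bialgebra_is_module[OF B]
  interpret B: k_algebra k B by (rule bialgebra_is_k_algebra[OF B])
  have fC: "f \<in> coalg_hom k H B" and fA: "f \<in> ring_hom H B" using f by (auto simp: bialg_hom_iff)
  have pC: "p \<in> coalg_hom k H ?R" using quot_bialg_bialgebra(2) by (auto simp: bialg_hom_iff)
  have pA: "p \<in> ring_hom H ?R" using quot_bialg_bialgebra(2) by (auto simp: bialg_hom_iff)
  note fl = bialg_hom_linear[OF f]
  have fI: "f x = \<zero>\<^bsub>B\<^esub>" if "x \<in> I" for x
    by (rule difference_ideal_linear_kernel[OF MB fl _ that]) (simp add: ring_hom_mult[OF fA] gc hc eq)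
  show fp: "f (p x) = f x" if "x \<in> carrier H" for x
    by (rule linear_factors_quot_proj[OF MB fl _ that]) (rule fI)
  have flR: "f \<in> module_hom k ?R B"
    using module_hom_closed[OF fl] pc
    by (auto intro!: module_homI simp: quot_bialg_simps module_hom_add[OF fl] module_hom_smult[OF fl])
  have "f \<in> coalg_hom k ?R B"
  proof (rule coalg_homI[OF flR])
    fix y assume "y \<in> carrier ?R"
    then obtain x where x: "x \<in> carrier H" "y = p x" by (auto simp: quot_bialg_simps)
    show "counit B (f y) = counit ?R y"
      using fC x pc by (simp add: quot_bialg_simps coalg_hom_def)
    note T = tensor_is_module[OF MB MB]
    have "comult B (f y) = sweedler k (tensor k B B) H (\<lambda>a b. pure_tensor k B B (f a) (f b)) x"
      unfolding x(2) fp[OF x(1)] by (rule coalg_hom_comult[OF fC x(1)])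
    also have "\<dots> = sweedler k (tensor k B B) H (\<lambda>a b. pure_tensor k B B (f (p a)) (f (p b))) x"
      by (rule sweedler_cong[OF coalg_H T tensor_map_bilinear[OF mod_H mod_H MB MB fl fl]
            tensor_map_bilinear[OF mod_H mod_H MB MB module_hom_comp[OF quot_proj_hom fl]
              module_hom_comp[OF quot_proj_hom fl]] _ x(1)]) (simp add: fp)
    also have "\<dots> = sweedler k (tensor k B B) ?R (\<lambda>a b. pure_tensor k B B (f a) (f b)) y"
      unfolding x(2)
      by (rule sweedler_coalg_hom[OF pC coalg_H R T tensor_map_bilinear[OF R R MB MB flR flR] x(1), symmetric])
    finally show "comult B (f y) = \<dots>" .
  qed
  moreover have "f \<in> ring_hom ?R B"
  proof (rule ring_hom_memI)
    fix x y assume "x \<in> carrier ?R" "y \<in> carrier ?R"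
    then obtain u v where uv: "u \<in> carrier H" "x = p u" "v \<in> carrier H" "y = p v"
      by (auto simp: quot_bialg_simps)
    show "f (x \<otimes>\<^bsub>?R\<^esub> y) = f x \<otimes>\<^bsub>B\<^esub> f y"
      unfolding uv ring_hom_mult[OF pA uv(1,3), symmetric] using uv by (simp add: fp ring_hom_mult[OF fA])
    show "f (x \<oplus>\<^bsub>?R\<^esub> y) = f x \<oplus>\<^bsub>B\<^esub> f y"
      using module_hom_add[OF flR] \<open>x \<in> carrier ?R\<close> \<open>y \<in> carrier ?R\<close> by simp
  next
    show "f \<one>\<^bsub>?R\<^esub> = \<one>\<^bsub>B\<^esub>" by (simp add: ring_hom_one[OF pA, symmetric] fp ring_hom_one[OF fA])
  qed (rule module_hom_closed[OF flR])
  ultimately show "f \<in> bialg_hom k ?R B" by (simp add: bialg_hom_iff)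
qed

text \<open>The conclusion says that \<open>U\<close> maps the ideal into itself: \<open>U(a (g c - h c) b)\<close> is
  \<open>U(b) (U(g c) - U(h c)) U(a)\<close>.\<close>

lemma antihom_preserves_difference_ideal:
  assumes U: "U \<in> module_hom k H H"
    and anti: "\<And>x y. x \<in> carrier H \<Longrightarrow> y \<in> carrier H \<Longrightarrow> U (x \<otimes>\<^bsub>H\<^esub> y) = U y \<otimes>\<^bsub>H\<^esub> U x"
    and eq: "\<And>c. c \<in> carrier C \<Longrightarrow> p (U (g c)) = p (U (h c))"
    and x: "x \<in> carrier H"
  shows "p (U (p x)) = p (U x)"
proof (rule linear_factors_quot_proj[OF mod_H module_hom_comp[OF U quot_proj_hom] _ x])
  note Uc = module_hom_closed[OF U]
  show "p (U z) = \<zero>\<^bsub>H\<^esub>" if "z \<in> I" for z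
  proof (rule difference_ideal_linear_kernel[OF mod_H module_hom_comp[OF U quot_proj_hom] _ that])
    fix a b c assume abc: "a \<in> carrier H" "b \<in> carrier H" "c \<in> carrier C"
    have "U (g c) \<ominus>\<^bsub>H\<^esub> U (h c) \<in> I" using eq[OF abc(3)] abc by (simp add: quot_proj_eq_iff Uc gc hc)
    then have "U b \<otimes>\<^bsub>H\<^esub> ((U (g c) \<ominus>\<^bsub>H\<^esub> U (h c)) \<otimes>\<^bsub>H\<^esub> U a) \<in> I"
      by (intro difference_ideal_mult_left difference_ideal_mult_right Uc abc)
    then show "p (U (a \<otimes>\<^bsub>H\<^esub> g c \<otimes>\<^bsub>H\<^esub> b)) = p (U (a \<otimes>\<^bsub>H\<^esub> h c \<otimes>\<^bsub>H\<^esub> b))"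
      using abc by (simp add: anti gc hc Uc quot_proj_eq_iff a_minus_def H.l_distr H.r_distr H.l_minus H.r_minus)
  qed
qed

text \<open>The morphism of algebras \<open>p\<close> satisfies \<open>p \<circ> g = p \<circ> h\<close>, so \<open>p \<circ> S \<circ> g = p \<circ> S \<circ> h\<close>.\<close>

lemma antipode_quot_proj:
  assumes S: "antipode k H S" and x: "x \<in> carrier H"
  shows "p (S (p x)) = p (S x)"
proof (rule antihom_preserves_difference_ideal[OF antipode_linear[OF S] antipode_mult[OF H S] _ x])
  have p: "p \<in> ring_hom H quot_bialg" "p \<in> module_hom k H quot_bialg"
    using quot_bialg_bialgebra(2) by (simp_all add: bialg_hom_iff coalg_hom_linear)
  show "p (S (g c)) = p (S (h c))" if "c \<in> carrier C" for c
    by (rule antipode_sandwich[OF CC alg_H coalg_H bialgebra_is_k_algebra[OF quot_bialg_bialgebra(1)] S gC hC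
          p p quot_proj_eq that])
qed

text \<open>The previous argument, with the multiplications of \<open>H\<close> and of the quotient reversed.\<close>

lemma inverse_antipode_quot_proj:
  assumes S: "antipode k H S" and bij: "bij_betw S (carrier H) (carrier H)" and x: "x \<in> carrier H"
  shows "p (inv_into (carrier H) S (p x)) = p (inv_into (carrier H) S x)"
proof -
  let ?T = "inv_into (carrier H) S"
  note T = inverse_antipode[OF H S bij]
  have Tl: "?T \<in> module_hom k H H"
    using antipode_linear[OF T(1)] by (simp add: module_hom_def)
  have p: "p \<in> ring_hom H quot_bialg" "p \<in> module_hom k H quot_bialg"
    using quot_bialg_bialgebra(2) by (simp_all add: bialg_hom_iff coalg_hom_linear)
  show ?thesis
  proof (rule antihom_preserves_difference_ideal[OF Tl T(2) _ x])
    have "g \<in> coalg_hom k C (opp H)" "h \<in> coalg_hom k C (opp H)" using gC hC by (simp_all add: opp_coalg_hom)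
    then show "p (?T (g c)) = p (?T (h c))" if "c \<in> carrier C" for c
      by (rule antipode_sandwich[OF CC opp_k_algebra[OF alg_H] opp_coalgebra[OF coalg_H]
            opp_k_algebra[OF bialgebra_is_k_algebra[OF quot_bialg_bialgebra(1)]] T(1) _ _
            opp_hom(1)[OF p(1)] opp_hom(2)[OF p(2)] opp_hom(1)[OF p(1)] opp_hom(2)[OF p(2)]
            quot_proj_eq that])
  qed
qed

lemma quot_antipode:
  assumes S: "antipode k H S"
  shows "antipode k quot_bialg (\<lambda>x. p (S x))"
proof (rule antipode_of_surjection[OF H quot_bialg_bialgebra _ S])
  note Sl = antipode_linear[OF S]
  show "p ` carrier H = carrier quot_bialg" by (simp add: quot_bialg_simps)
  show "(\<lambda>x. p (S x)) \<in> module_hom k quot_bialg quot_bialg"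
    using pc module_hom_closed[OF Sl]
    by (auto intro!: module_homI simp: quot_bialg_simps module_hom_add[OF Sl] module_hom_smult[OF Sl]
        module_hom_add[OF quot_proj_hom] module_hom_smult[OF quot_proj_hom])
qed (rule antipode_quot_proj[OF S])

lemma quot_hopf:
  assumes "hopf_algebra k H"
  shows "hopf_algebra k quot_bialg"
  using assms quot_antipode quot_bialg_bialgebra(1) by (auto simp: hopf_algebra_def)

lemma quot_shopf:
  assumes "shopf_algebra k H"
  shows "shopf_algebra k quot_bialg"
proof -
  obtain S where S: "antipode k H S" and bij: "bij_betw S (carrier H) (carrier H)"
    using assms by (auto simp: shopf_algebra_def)
  let ?T = "inv_into (carrier H) S"
  note Sc = module_hom_closed[OF antipode_linear[OF S]]
  have Tc: "?T x \<in> carrier H" if "x \<in> carrier H" for x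
    using inv_into_into[of x S "carrier H"] bij that by (simp add: bij_betw_def)
  have ST: "S (?T x) = x" if "x \<in> carrier H" for x
    using bij that by (simp add: bij_betw_def f_inv_into_f)
  have TS: "?T (S x) = x" if "x \<in> carrier H" for x
    using bij that by (simp add: bij_betw_def inv_into_f_f)
  have "bij_betw (\<lambda>x. p (S x)) (p ` carrier H) (p ` carrier H)"
    by (rule bij_betw_byWitness[where f' = "\<lambda>x. p (?T x)"])
      (auto simp: antipode_quot_proj[OF S] inverse_antipode_quot_proj[OF S bij] Sc Tc ST TS pc)
  then show ?thesis
    using quot_antipode[OF S] quot_bialg_bialgebra(1) by (auto simp: shopf_algebra_def quot_bialg_simps)
qed

end

text \<open>The counit factors through the quotient, so the quotient is a test object for its universal
  property. The resulting \<open>\<phi>\<close> from the quotient to \<open>H\<close>, preceded by the projection, lies over the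
  identity of \<open>B\<close> and is therefore the identity of \<open>H\<close>; the projection, which identifies \<open>g c\<close> with
  \<open>h c\<close>, is thus injective.\<close>

theorem right_adjoint_counit_mono:
  fixes P :: "('a, 'u) bialg \<Rightarrow> bool" and k :: "('a, 'r) ring_scheme"
  assumes k: "field k" and B: "bialgebra k B" and counit: "right_adjoint_counit P k H B \<epsilon>"
    and P: "P H \<Longrightarrow> bialgebra k H" and Q: "\<And>C. Q C \<Longrightarrow> bialgebra k C"
    and quot: "\<And>(C :: ('a, 'c) bialg) g h. bialgebra k C \<Longrightarrow> g \<in> bialg_hom k C H \<Longrightarrow> h \<in> bialg_hom k C H \<Longrightarrow>
      P (quot_bialg k H C g h)"
  shows "mono_in (Q :: ('a, 'c) bialg \<Rightarrow> bool) k H B \<epsilon>"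
  unfolding mono_in_def
proof (intro conjI allI impI ballI)
  have PH: "P H" and \<epsilon>: "\<epsilon> \<in> bialg_hom k H B" using counit by (auto simp: right_adjoint_counit_def)
  have H: "bialgebra k H" by (rule P[OF PH])
  show "\<epsilon> \<in> bialg_hom k H B" by (rule \<epsilon>)
  fix C :: "('a, 'c) bialg" and g h c
  assume a: "Q C \<and> g \<in> bialg_hom k C H \<and> h \<in> bialg_hom k C H \<and> (\<forall>x\<in>carrier C. \<epsilon> (g x) = \<epsilon> (h x))"
    and c: "c \<in> carrier C"
  have C: "bialgebra k C" and g: "g \<in> bialg_hom k C H" and h: "h \<in> bialg_hom k C H"
    and eq: "\<And>x. x \<in> carrier C \<Longrightarrow> \<epsilon> (g x) = \<epsilon> (h x)" using a Q by auto
  let ?R = "quot_bialg k H C g h" and ?p = "quot_proj k H C g h"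
  note hyps = k H C g h
  note p = quot_bialg_bialgebra(2)[OF hyps]
  have \<epsilon>R: "\<epsilon> \<in> bialg_hom k ?R B"
    by (rule bialg_hom_from_quot(1)[OF hyps B \<epsilon>]) (rule eq)
  have \<epsilon>p: "\<epsilon> (?p x) = \<epsilon> x" if "x \<in> carrier H" for x
    by (rule bialg_hom_from_quot(2)[OF hyps B \<epsilon> _ that]) (rule eq)
  obtain \<phi> where \<phi>: "\<phi> \<in> bialg_hom k ?R H" "\<And>x. x \<in> carrier ?R \<Longrightarrow> \<epsilon> (\<phi> x) = \<epsilon> x"
    using counit quot[OF C g h] \<epsilon>R unfolding right_adjoint_counit_def by blast
  have "(\<lambda>x. \<phi> (?p x)) \<in> bialg_hom k H H"
    by (rule bialg_hom_comp[OF p \<phi>(1) H quot_bialg_bialgebra(1)[OF hyps] H])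
  moreover have "\<epsilon> (\<phi> (?p x)) = \<epsilon> x" if "x \<in> carrier H" for x
    using \<phi>(2)[OF module_hom_closed[OF bialg_hom_linear[OF p] that]] \<epsilon>p[OF that] by simp
  moreover obtain \<psi> where "\<And>\<chi>. \<chi> \<in> bialg_hom k H H \<Longrightarrow> (\<forall>x\<in>carrier H. \<epsilon> (\<chi> x) = \<epsilon> x) \<Longrightarrow>
      (\<forall>x\<in>carrier H. \<chi> x = \<psi> x)"
    using counit PH \<epsilon> unfolding right_adjoint_counit_def by blast
  ultimately have id: "\<phi> (?p x) = x" if "x \<in> carrier H" for x
    using bialg_hom_id[OF H] that by metis
  have "g c = \<phi> (?p (g c))"
    by (rule id[symmetric]) (rule module_hom_closed[OF bialg_hom_linear[OF g] c])
  also have "\<dots> = \<phi> (?p (h c))" by (simp add: quot_proj_eq[OF hyps c])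
  also have "\<dots> = h c"
    by (rule id) (rule module_hom_closed[OF bialg_hom_linear[OF h] c])
  finally show "g c = h c" .
qed


section \<open>Units and counits of the reflections and coreflections\<close>

lemma inverse_bialg_hom:
  assumes A: "bialgebra k A" and B: "bialgebra k B" and f: "f \<in> bialg_hom k A B"
    and bij: "bij_betw f (carrier A) (carrier B)"
  shows "inv_into (carrier A) f \<in> bialg_hom k B A"
proof -
  let ?i = "inv_into (carrier A) f"
  interpret A: k_algebra k A by (rule bialgebra_is_k_algebra[OF A])
  interpret B: k_algebra k B by (rule bialgebra_is_k_algebra[OF B])
  note MA = A.module_axioms and MB = B.module_axioms
  have fC: "f \<in> coalg_hom k A B" and fA: "f \<in> ring_hom A B" using f by (auto simp: bialg_hom_iff)
  note fl = bialg_hom_linear[OF f]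
  have inj: "inj_on f (carrier A)" and im: "f ` carrier A = carrier B" using bij by (auto simp: bij_betw_def)
  have ex: "\<exists>x\<in>carrier A. y = f x" if "y \<in> carrier B" for y using im that by auto
  have i: "?i (f x) = x" if "x \<in> carrier A" for x by (rule inv_into_f_f[OF inj that])
  have il: "?i \<in> module_hom k B A"
  proof (rule module_homI)
    fix y assume "y \<in> carrier B"
    then obtain x where "x \<in> carrier A" "y = f x" using ex by meson
    then show "?i y \<in> carrier A" by (simp add: i)
  next
    fix y y' assume "y \<in> carrier B" "y' \<in> carrier B"
    then obtain x x' where "x \<in> carrier A" "y = f x" "x' \<in> carrier A" "y' = f x'" using ex by meson
    then show "?i (y \<oplus>\<^bsub>B\<^esub> y') = ?i y \<oplus>\<^bsub>A\<^esub> ?i y'" by (simp add: i module_hom_add[OF fl, symmetric])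
  next
    fix c y assume "c \<in> carrier k" "y \<in> carrier B"
    moreover then obtain x where "x \<in> carrier A" "y = f x" using ex by meson
    ultimately show "?i (c \<odot>\<^bsub>B\<^esub> y) = c \<odot>\<^bsub>A\<^esub> ?i y" by (simp add: i module_hom_smult[OF fl, symmetric])
  qed
  have "?i \<in> coalg_hom k B A"
  proof (rule coalg_homI[OF il])
    fix y assume "y \<in> carrier B"
    then obtain x where x: "x \<in> carrier A" "y = f x" using ex by meson
    show "counit A (?i y) = counit B y" using fC x by (simp add: i coalg_hom_def)
    note T = tensor_is_module[OF MA MA] and CA = bialgebra_is_coalgebra[OF A]
    note bi = tensor_map_bilinear[OF MB MB MA MA il il]
    have "sweedler k (tensor k A A) B (\<lambda>a b. pure_tensor k A A (?i a) (?i b)) y =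
        sweedler k (tensor k A A) A (\<lambda>a b. pure_tensor k A A (?i (f a)) (?i (f b))) x"
      unfolding x(2) by (rule sweedler_coalg_hom[OF fC CA MB T bi x(1)])
    also have "\<dots> = sweedler k (tensor k A A) A (pure_tensor k A A) x"
      by (rule sweedler_cong[OF CA T bilinear_map_comp[OF bi fl fl] pure_tensor_bilinear[OF MA MA] _ x(1)])
        (simp add: i)
    also have "\<dots> = comult A (?i y)"
      by (simp add: x i tensor_lift_pure_id[OF MA MA comult_closed[OF CA]])
    finally show "comult A (?i y) = sweedler k (tensor k A A) B (\<lambda>a b. pure_tensor k A A (?i a) (?i b)) y"
      by simp
  qed
  moreover have "?i \<in> ring_hom B A"
  proof (rule ring_hom_memI)
    fix y y' assume y: "y \<in> carrier B" "y' \<in> carrier B"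
    then obtain x x' where "x \<in> carrier A" "y = f x" "x' \<in> carrier A" "y' = f x'" using ex by meson
    then show "?i (y \<otimes>\<^bsub>B\<^esub> y') = ?i y \<otimes>\<^bsub>A\<^esub> ?i y'" by (simp add: i ring_hom_mult[OF fA, symmetric])
    show "?i (y \<oplus>\<^bsub>B\<^esub> y') = ?i y \<oplus>\<^bsub>A\<^esub> ?i y'" by (rule module_hom_add[OF il y])
  next
    show "?i \<one>\<^bsub>B\<^esub> = \<one>\<^bsub>A\<^esub>" using i[OF A.one_closed] by (simp add: ring_hom_one[OF fA])
  qed (rule module_hom_closed[OF il])
  ultimately show ?thesis by (simp add: bialg_hom_iff)
qed

lemma antipode_of_iso:
  assumes A: "bialgebra k A" and B: "bialgebra k B" and f: "f \<in> bialg_hom k A B"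
    and bij: "bij_betw f (carrier A) (carrier B)" and S: "antipode k A S"
  shows "antipode k B (\<lambda>y. f (S (inv_into (carrier A) f y)))"
proof (rule antipode_of_surjection[OF A B f _ S])
  show "f ` carrier A = carrier B" using bij by (simp add: bij_betw_def)
  show "(\<lambda>y. f (S (inv_into (carrier A) f y))) \<in> module_hom k B B"
    by (rule module_hom_comp[OF module_hom_comp[OF bialg_hom_linear[OF inverse_bialg_hom[OF A B f bij]]
            antipode_linear[OF S]] bialg_hom_linear[OF f]])
  show "f (S (inv_into (carrier A) f (f x))) = f (S x)" if "x \<in> carrier A" for x
    using bij that by (simp add: bij_betw_def inv_into_f_f)
qed

lemma hopf_algebra_of_iso:
  assumes "hopf_algebra k A" "bialgebra k B" "f \<in> bialg_hom k A B" "bij_betw f (carrier A) (carrier B)"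
  shows "hopf_algebra k B"
  using assms antipode_of_iso[OF _ assms(2-4)] by (auto simp: hopf_algebra_def)

lemma shopf_algebra_of_iso:
  assumes A: "shopf_algebra k A" and B: "bialgebra k B" and f: "f \<in> bialg_hom k A B"
    and bij: "bij_betw f (carrier A) (carrier B)"
  shows "shopf_algebra k B"
proof -
  obtain S where S: "antipode k A S" "bij_betw S (carrier A) (carrier A)" and Ab: "bialgebra k A"
    using A by (auto simp: shopf_algebra_def)
  have "bij_betw (f \<circ> (S \<circ> inv_into (carrier A) f)) (carrier B) (carrier B)"
    by (rule bij_betw_trans[OF bij_betw_trans[OF bij_betw_inv_into[OF bij] S(2)] bij])
  then show ?thesis
    using antipode_of_iso[OF Ab B f bij S(1)] B by (auto simp: shopf_algebra_def comp_def)
qed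

text \<open>The embedding of \<open>B\<close> into \<open>L\<close> factors through the unit.\<close>

lemma left_adjoint_unit_inj:
  assumes "left_adjoint_unit P k B H \<eta>" "P L" "sub_bialgebra_of k B L"
  shows "inj_on \<eta> (carrier B)"
proof -
  obtain f where f: "f \<in> bialg_hom k B L" "inj_on f (carrier B)"
    using assms(3) by (auto simp: sub_bialgebra_of_def)
  obtain \<phi> where \<phi>: "\<forall>x\<in>carrier B. \<phi> (\<eta> x) = f x"
    using assms(1,2) f(1) unfolding left_adjoint_unit_def by blast
  show ?thesis
    by (rule inj_onI) (use \<phi> f(2) in \<open>metis inj_onD\<close>)
qed

lemma left_adjoint_unit_not_surj:
  assumes unit: "left_adjoint_unit P k B H \<eta>" and inj: "inj_on \<eta> (carrier B)"
    and B: "bialgebra k B" "\<not> P B" and P: "P H \<Longrightarrow> bialgebra k H"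
    and iso: "\<And>f. P H \<Longrightarrow> f \<in> bialg_hom k H B \<Longrightarrow> bij_betw f (carrier H) (carrier B) \<Longrightarrow> P B"
  shows "\<eta> ` carrier B \<noteq> carrier H"
proof
  assume "\<eta> ` carrier B = carrier H"
  then have bij: "bij_betw \<eta> (carrier B) (carrier H)" using inj by (simp add: bij_betw_def)
  have PH: "P H" and \<eta>: "\<eta> \<in> bialg_hom k B H" using unit by (auto simp: left_adjoint_unit_def)
  show False
    using iso[OF PH inverse_bialg_hom[OF B(1) P[OF PH] \<eta> bij] bij_betw_inv_into[OF bij]] B(2) by simp
qed

text \<open>The projection of \<open>L\<close> onto \<open>B\<close> factors through the counit.\<close>

lemma right_adjoint_counit_surj:
  assumes "right_adjoint_counit P k H B \<epsilon>" "P L" "quotient_bialgebra_of k B L"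
  shows "\<epsilon> ` carrier H = carrier B"
proof -
  obtain f where f: "f \<in> bialg_hom k L B" "f ` carrier L = carrier B"
    using assms(3) by (auto simp: quotient_bialgebra_of_def)
  obtain \<phi> where \<phi>: "\<phi> \<in> bialg_hom k L H" "\<forall>x\<in>carrier L. \<epsilon> (\<phi> x) = f x"
    using assms(1,2) f(1) unfolding right_adjoint_counit_def by blast
  have "\<epsilon> \<in> bialg_hom k H B" using assms(1) by (simp add: right_adjoint_counit_def)
  then have "\<epsilon> ` carrier H \<subseteq> carrier B" by (auto dest: bialg_hom_linear module_hom_closed)
  moreover have "carrier B \<subseteq> \<epsilon> ` carrier H"
  proof
    fix y assume "y \<in> carrier B"
    then obtain x where "x \<in> carrier L" "y = f x" using f(2) by auto
    then show "y \<in> \<epsilon> ` carrier H"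
      using \<phi>(2) module_hom_closed[OF bialg_hom_linear[OF \<phi>(1)]] by (metis imageI)
  qed
  ultimately show ?thesis by auto
qed

lemma right_adjoint_counit_not_inj:
  assumes counit: "right_adjoint_counit P k H B \<epsilon>" and surj: "\<epsilon> ` carrier H = carrier B"
    and B: "\<not> P B"
    and iso: "\<And>f. P H \<Longrightarrow> f \<in> bialg_hom k H B \<Longrightarrow> bij_betw f (carrier H) (carrier B) \<Longrightarrow> P B"
  shows "\<not> inj_on \<epsilon> (carrier H)"
  using iso[of \<epsilon>] counit surj B by (auto simp: right_adjoint_counit_def bij_betw_def)

lemma hopf_algebra_bialgebra: "hopf_algebra k H \<Longrightarrow> bialgebra k H"
  and shopf_algebra_bialgebra: "shopf_algebra k H \<Longrightarrow> bialgebra k H"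
  by (simp_all add: hopf_algebra_def shopf_algebra_def)

theorem corollary3p4:
  fixes k :: "('a, 'r) ring_scheme"
  assumes "field k"
  shows
    "(\<forall>(B :: ('a, 'u) bialg) L H \<eta>.
        bialgebra k B \<and> \<not> hopf_algebra k B \<and>
        hopf_algebra k (L :: ('a, 'u) bialg) \<and> sub_bialgebra_of k B L \<and>
        left_adjoint_unit (hopf_algebra k) k B H \<eta> \<longrightarrow>
          inj_on \<eta> (carrier B) \<and> \<eta> ` carrier B \<noteq> carrier H \<and>
          epi_in (bialgebra k :: ('a, 'c) bialg \<Rightarrow> bool) k B H \<eta>)
     \<and>
     (\<forall>(B :: ('a, 'u) bialg) L H \<epsilon>.
        bialgebra k B \<and> \<not> hopf_algebra k B \<and>
        hopf_algebra k (L :: ('a, 'u) bialg) \<and> quotient_bialgebra_of k B L \<and>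
        right_adjoint_counit (hopf_algebra k) k H B \<epsilon> \<longrightarrow>
          \<epsilon> ` carrier H = carrier B \<and> \<not> inj_on \<epsilon> (carrier H) \<and>
          mono_in (bialgebra k :: ('a, 'c) bialg \<Rightarrow> bool) k H B \<epsilon>)
     \<and>
     (\<forall>(H :: ('a, 'u) bialg) L K \<eta>.
        hopf_algebra k H \<and> \<not> shopf_algebra k H \<and>
        shopf_algebra k (L :: ('a, 'u) bialg) \<and> sub_bialgebra_of k H L \<and>
        left_adjoint_unit (shopf_algebra k) k H K \<eta> \<longrightarrow>
          inj_on \<eta> (carrier H) \<and> \<eta> ` carrier H \<noteq> carrier K \<and>
          epi_in (hopf_algebra k :: ('a, 'c) bialg \<Rightarrow> bool) k H K \<eta>)
     \<and>
     (\<forall>(H :: ('a, 'u) bialg) L K \<epsilon>.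
        hopf_algebra k H \<and> \<not> shopf_algebra k H \<and>
        shopf_algebra k (L :: ('a, 'u) bialg) \<and> quotient_bialgebra_of k H L \<and>
        right_adjoint_counit (shopf_algebra k) k K H \<epsilon> \<longrightarrow>
          \<not> inj_on \<epsilon> (carrier K) \<and> \<epsilon> ` carrier K = carrier H \<and>
          mono_in (hopf_algebra k :: ('a, 'c) bialg \<Rightarrow> bool) k K H \<epsilon>)"
proof (intro conjI allI impI; elim conjE)
  fix B L H :: "('a, 'u) bialg" and \<eta>
  assume B: "bialgebra k B" "\<not> hopf_algebra k B" and L: "hopf_algebra k L" "sub_bialgebra_of k B L"
    and unit: "left_adjoint_unit (hopf_algebra k) k B H \<eta>"
  have H: "hopf_algebra k H" using unit by (simp add: left_adjoint_unit_def)
  show inj: "inj_on \<eta> (carrier B)" by (rule left_adjoint_unit_inj[OF unit L])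
  show "\<eta> ` carrier B \<noteq> carrier H"
    by (rule left_adjoint_unit_not_surj[OF unit inj B hopf_algebra_bialgebra])
      (auto intro: hopf_algebra_of_iso[OF _ B(1)])
  show "epi_in (bialgebra k :: ('a, 'c) bialg \<Rightarrow> bool) k B H \<eta>"
    by (rule left_adjoint_unit_epi[OF assms B(1) unit hopf_algebra_bialgebra])
      (auto intro: core_hopf[OF assms hopf_algebra_bialgebra[OF H] _ _ _ H])
next
  fix B L H :: "('a, 'u) bialg" and \<epsilon>
  assume B: "bialgebra k B" "\<not> hopf_algebra k B" and L: "hopf_algebra k L" "quotient_bialgebra_of k B L"
    and counit: "right_adjoint_counit (hopf_algebra k) k H B \<epsilon>"
  have H: "hopf_algebra k H" using counit by (simp add: right_adjoint_counit_def)
  show surj: "\<epsilon> ` carrier H = carrier B" by (rule right_adjoint_counit_surj[OF counit L])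
  show "\<not> inj_on \<epsilon> (carrier H)"
    by (rule right_adjoint_counit_not_inj[OF counit surj B(2)])
      (auto intro: hopf_algebra_of_iso[OF _ B(1)])
  show "mono_in (bialgebra k :: ('a, 'c) bialg \<Rightarrow> bool) k H B \<epsilon>"
    by (rule right_adjoint_counit_mono[OF assms B(1) counit hopf_algebra_bialgebra])
      (auto intro: quot_hopf[OF assms hopf_algebra_bialgebra[OF H] _ _ _ H])
next
  fix H L K :: "('a, 'u) bialg" and \<eta>
  assume H: "hopf_algebra k H" "\<not> shopf_algebra k H" and L: "shopf_algebra k L" "sub_bialgebra_of k H L"
    and unit: "left_adjoint_unit (shopf_algebra k) k H K \<eta>"
  note Hb = hopf_algebra_bialgebra[OF H(1)]
  have K: "shopf_algebra k K" using unit by (simp add: left_adjoint_unit_def)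
  show inj: "inj_on \<eta> (carrier H)" by (rule left_adjoint_unit_inj[OF unit L])
  show "\<eta> ` carrier H \<noteq> carrier K"
    by (rule left_adjoint_unit_not_surj[OF unit inj Hb H(2) shopf_algebra_bialgebra])
      (auto intro: shopf_algebra_of_iso[OF _ Hb])
  show "epi_in (hopf_algebra k :: ('a, 'c) bialg \<Rightarrow> bool) k H K \<eta>"
    by (rule left_adjoint_unit_epi[OF assms Hb unit shopf_algebra_bialgebra hopf_algebra_bialgebra])
      (auto intro: core_shopf[OF assms shopf_algebra_bialgebra[OF K] _ _ _ K])
next
  fix H L K :: "('a, 'u) bialg" and \<epsilon>
  assume H: "hopf_algebra k H" "\<not> shopf_algebra k H" and L: "shopf_algebra k L" "quotient_bialgebra_of k H L"
    and counit: "right_adjoint_counit (shopf_algebra k) k K H \<epsilon>"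
  note Hb = hopf_algebra_bialgebra[OF H(1)]
  have K: "shopf_algebra k K" using counit by (simp add: right_adjoint_counit_def)
  show surj: "\<epsilon> ` carrier K = carrier H" by (rule right_adjoint_counit_surj[OF counit L])
  show "\<not> inj_on \<epsilon> (carrier K)"
    by (rule right_adjoint_counit_not_inj[OF counit surj H(2)])
      (auto intro: shopf_algebra_of_iso[OF _ Hb])
  show "mono_in (hopf_algebra k :: ('a, 'c) bialg \<Rightarrow> bool) k K H \<epsilon>"
    by (rule right_adjoint_counit_mono[OF assms Hb counit shopf_algebra_bialgebra hopf_algebra_bialgebra])
      (auto intro: quot_shopf[OF assms shopf_algebra_bialgebra[OF K] _ _ _ K])
qed

end
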